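(* Let $\mu_m$ be a Borel probability measure on $\mathcal{M}$, $\mathcal{Z}_{ad}\subset\mathcal{Z}$ convex and compact, $\mathcal{B}\supset\mathcal{Z}_{ad}$ open in $\mathcal{Z}$, $p\ge2$, and suppose $u:\mathcal{M}\times\mathcal{B}\to\mathcal{U}$ satisfies Assumption A and $Q:\mathcal{U}\times\mathcal{M}\times\mathcal{B}\to\mathbb{R}$ satisfies Assumption B with $(\mu_m,\mathcal{Z}_{ad},\mathcal{B},p)$. Consider $$\min_{z\in\mathcal{Z}_{ad}}\mathcal{J}(z):=\mathbb{E}_{m\sim\mu_m}[Q(u(m,z),m,z)]+\mathcal{P}(z),$$ where $Q$, $u$ and $\mathcal{P}:\mathcal{Z}\to\mathbb{R}$ are such that $\mathcal{J}\in C^1(\mathcal{B};\mathbb{R})$ is strongly convex, and let $z^\star$ be its minimizer over $\mathcal{Z}_{ad}$. Let $\{\phi_i\}_{i=1}^\infty$ and $\{\psi_i\}_{i=1}^\infty$ be orthonormal bases of $\mathcal{U}$ and $\mathcal{M}$, respectively, and let $b_u\in\mathcal{U}$, $b_m\in\mathcal{M}$ be any two vectors. Then for any $\epsilon>0$ there exist ranks $r_m,r_u\in\mathbb{N}$ and a GELU neural network $g_\theta:\mathbb{R}^{r_m}\times\mathbb{R}^{d_z}\to\mathbb{R}^{r_u}$ such that, with $u_\theta(m,z)=\mathbf{\Phi}_{r_u}g_\theta(\mathbf{\Psi}_{r_m}^*(m-b_m),z)+b_u$, any point $z^\dagger\in\mathcal{Z}_{ad}$ satisfying the first-order optimality conditions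 of $$\min_{z\in\mathcal{Z}_{ad}}\mathcal{J}_\theta(z):=\mathbb{E}_{m\sim\mu_m}[Q(u_\theta(m,z),m,z)]+\mathcal{P}(z),$$ i.e. $\langle D_z\mathcal{J}_\theta(z^\dagger),z-z^\dagger\rangle_{\mathcal{Z}'\times\mathcal{Z}}\ge0$ for all $z\in\mathcal{Z}_{ad}$, satisfies $$\|z^\star-z^\dagger\|_{\mathcal{Z}}\le\epsilon\qquad\text{and}\qquad\mathcal{J}(z^\dagger)-\mathcal{J}(z^\star)\le\epsilon^2 .$$
   Context: $\mathcal{M}$ and $\mathcal{U}$ are separable real Hilbert spaces and $\mathcal{Z}=\mathbb{R}^{d_z}$ is a finite-dimensional real Hilbert space. A prime denotes the topological dual, $\mathcal{L}(X,Y)$ bounded linear operators, $\mathrm{HS}(X,Y)$ Hilbert–Schmidt operators with the Hilbert–Schmidt norm, $D$ Fréchet derivatives, $D_{uz}Q=D_uD_zQ\in\mathcal{L}(\mathcal{U},\mathcal{Z}')$. Strong convexity of $\mathcal{J}$ on $\mathcal{B}$: there is $\lambda>0$ with $\mathcal{J}(z_2)\ge\mathcal{J}(z_1)+\langle D_z\mathcal{J}(z_1),z_2-z_1\rangle_{\mathcal{Z}'\times\mathcal{Z}}+\frac\lambda2\|z_2-z_1\|_{\mathcal{Z}}^2$ for all $z_1,z_2\in\mathcal{B}$. Assumption A (on a map $u$, with $(\mu_m,\mathcal{Z}_{ad},\mathcal{B},p)$): $\mu_m$ is a Borel probability measure on $\mathcal{M}$ with finite $p$-th moment $\mathbb{E}_{\mu_m}\|m\|_{\mathcal{M}}^p<\infty$,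 $\mathcal{Z}_{ad}\subset\mathcal{Z}$ is compact, $\mathcal{B}\supset\mathcal{Z}_{ad}$ is open, and: (1) $u:\mathcal{M}\times\mathcal{B}\to\mathcal{U}$ is continuously (Fréchet) differentiable; (2) there are constants $\kappa_u,\kappa_{u_z}>0$ such that for all $z_1,z_2\in\mathcal{B}$, $m_1,m_2\in\mathcal{M}$: $\|u(m_2,z_2)-u(m_1,z_1)\|_{\mathcal{U}}\le\kappa_u(\|m_2-m_1\|_{\mathcal{M}}+\|z_2-z_1\|_{\mathcal{Z}})$ and $\|D_zu(m_2,z_2)-D_zu(m_1,z_1)\|_{\mathrm{HS}(\mathcal{Z},\mathcal{U})}\le\kappa_{u_z}(\|m_2-m_1\|_{\mathcal{M}}+\|z_2-z_1\|_{\mathcal{Z}})$. Assumption B (on $Q$, with $\mathcal{Z}_{ad}$ compact and $\mathcal{B}\supset\mathcal{Z}_{ad}$ open): (1) $Q:\mathcal{U}\times\mathcal{M}\times\mathcal{B}\to\mathbb{R}$ is twice continuously differentiable; (2) there are constants $\kappa_{Q_u},\kappa_{Q_{uz}}>0$ such that for all $u_1,u_2\in\mathcal{U}$, $z\in\mathcal{B}$, $m\in\mathcal{M}$: $\|D_uQ(u_2,m,z)-D_uQ(u_1,m,z)\|_{\mathcal{U}'}\le\kappa_{Q_u}\|u_2-u_1\|_{\mathcal{U}}$ and $\|D_{uz}Q(u_2,m,z)-D_{uz}Q(u_1,m,z)\|_{\mathcal{L}(\mathcal{U},\mathcal{Z}')}\le\kappa_{Q_{uz}}\|u_2-u_1\|_{\mathcal{U}}$;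 (3) there are constants $M_Q,M_{Q_u},M_{Q_z},M_{Q_{uz}}\ge0$ such that for all $z\in\mathcal{B}$, $m\in\mathcal{M}$: $|Q(0,m,z)|\le M_Q$, $\|D_uQ(0,m,z)\|_{\mathcal{U}'}\le M_{Q_u}$, $\|D_zQ(0,m,z)\|_{\mathcal{Z}'}\le M_{Q_z}$, $\|D_{uz}Q(0,m,z)\|_{\mathcal{L}(\mathcal{U},\mathcal{Z}')}\le M_{Q_{uz}}$. Encoding/decoding: $\mathbf{\Phi}_{r}c=\sum_{i=1}^{r}c_i\phi_i$ for $c\in\mathbb{R}^{r}$, and $\mathbf{\Psi}_{r}^*m=(\langle m,\psi_i\rangle_{\mathcal{M}})_{i=1}^{r}\in\mathbb{R}^{r}$. GELU neural network: $\sigma_{\mathrm{GELU}}(x)=x\,\Phi_{\mathrm{Gauss}}(x)$ with $\Phi_{\mathrm{Gauss}}$ the standard Gaussian CDF, applied componentwise to vectors. A GELU neural network with $d_L$ hidden layers is a map $a_0\mapsto a_{d_L+1}$ with $a_i=\sigma_{\mathrm{GELU}}(W_{i-1}a_{i-1}+b_{i-1})$ for $i=1,\dots,d_L$ and $a_{d_L+1}=W_{d_L}a_{d_L}+b_{d_L}$, for real matrices $W_i$ and vectors $b_i$ of compatible (arbitrary finite) sizes. *)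

theory Defs
  imports "HOL-Probability.Probability" "Jordan_Normal_Form.Matrix"
begin

(* Frechet derivative as an element of L('a,'b).  It is only meaningful where f is
   differentiable at x. *)
definition Dfr :: "('a::real_normed_vector \<Rightarrow> 'b::real_normed_vector) \<Rightarrow> 'a \<Rightarrow> 'a \<Rightarrow>\<^sub>L 'b" where
  "Dfr f x = Blinfun (frechet_derivative f (at x))"

(* Used for open S only; continuity of the derivative is in operator norm. *)
definition C1_on :: "('a::real_normed_vector \<Rightarrow> 'b::real_normed_vector) \<Rightarrow> 'a set \<Rightarrow> bool" where
  "C1_on f S \<longleftrightarrow> (\<forall>x\<in>S. f differentiable (at x)) \<and> continuous_on S (Dfr f)"

definition C2_on :: "('a::real_normed_vector \<Rightarrow> 'b::real_normed_vector) \<Rightarrow> 'a set \<Rightarrow> bool" where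
  "C2_on f S \<longleftrightarrow> C1_on f S \<and> C1_on (Dfr f) S"

definition hs_norm :: "('a::euclidean_space \<Rightarrow>\<^sub>L 'b::real_inner) \<Rightarrow> real" where
  "hs_norm A = sqrt (\<Sum>b\<in>Basis. (norm (blinfun_apply A b))\<^sup>2)"

definition strongly_convex_on :: "'a::real_inner set \<Rightarrow> ('a \<Rightarrow> real) \<Rightarrow> bool" where
  "strongly_convex_on B J \<longleftrightarrow>
     (\<exists>l>0. \<forall>z1\<in>B. \<forall>z2\<in>B.
        J z2 \<ge> J z1 + blinfun_apply (Dfr J z1) (z2 - z1) + l / 2 * (norm (z2 - z1))\<^sup>2)"

definition orthonormal_basis :: "(nat \<Rightarrow> 'a::real_inner) \<Rightarrow> bool" where
  "orthonormal_basis e \<longleftrightarrow>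
     (\<forall>i j. inner (e i) (e j) = (if i = j then 1 else 0)) \<and> closure (span (range e)) = UNIV"


(* Maps on M x B and on U x M x B are total functions; only their values at z in B matter,
   since B is open. *)

definition assumption_A ::
  "('m::{real_inner,polish_space} \<Rightarrow> real ^ 'd \<Rightarrow> 'u::{real_inner,polish_space}) \<Rightarrow>
   'm measure \<Rightarrow> (real ^ 'd) set \<Rightarrow> (real ^ 'd) set \<Rightarrow> real \<Rightarrow> bool" where
  "assumption_A u \<mu> Zad B p \<longleftrightarrow>
     prob_space \<mu> \<and> sets \<mu> = sets borel \<and> integrable \<mu> (\<lambda>m. norm m powr p) \<and>
     compact Zad \<and> open B \<and> Zad \<subseteq> B \<and>
     C1_on (\<lambda>(m, z). u m z) (UNIV \<times> B) \<and>
     (\<exists>\<kappa>u>0. \<exists>\<kappa>uz>0. \<forall>z1\<in>B. \<forall>z2\<in>B. \<forall>m1 m2.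
        norm (u m2 z2 - u m1 z1) \<le> \<kappa>u * (norm (m2 - m1) + norm (z2 - z1)) \<and>
        hs_norm (Dfr (u m2) z2 - Dfr (u m1) z1) \<le> \<kappa>uz * (norm (m2 - m1) + norm (z2 - z1)))"

definition Du :: "('u::real_normed_vector \<Rightarrow> 'm \<Rightarrow> 'z \<Rightarrow> real) \<Rightarrow> 'u \<Rightarrow> 'm \<Rightarrow> 'z \<Rightarrow> 'u \<Rightarrow>\<^sub>L real" where
  "Du Q v m z = Dfr (\<lambda>w. Q w m z) v"

definition Dz :: "('u \<Rightarrow> 'm \<Rightarrow> 'z::real_normed_vector \<Rightarrow> real) \<Rightarrow> 'u \<Rightarrow> 'm \<Rightarrow> 'z \<Rightarrow> 'z \<Rightarrow>\<^sub>L real" where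
  "Dz Q v m z = Dfr (Q v m) z"

definition Duz :: "('u::real_normed_vector \<Rightarrow> 'm \<Rightarrow> 'z::real_normed_vector \<Rightarrow> real) \<Rightarrow>
    'u \<Rightarrow> 'm \<Rightarrow> 'z \<Rightarrow> 'u \<Rightarrow>\<^sub>L ('z \<Rightarrow>\<^sub>L real)" where
  "Duz Q v m z = Dfr (\<lambda>w. Dz Q w m z) v"

definition assumption_B ::
  "('u::{real_inner,polish_space} \<Rightarrow> 'm::{real_inner,polish_space} \<Rightarrow> real ^ 'd \<Rightarrow> real) \<Rightarrow>
   (real ^ 'd) set \<Rightarrow> (real ^ 'd) set \<Rightarrow> bool" where
  "assumption_B Q Zad B \<longleftrightarrow>
     compact Zad \<and> open B \<and> Zad \<subseteq> B \<and>
     C2_on (\<lambda>(v, m, z). Q v m z) (UNIV \<times> UNIV \<times> B) \<and>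
     (\<exists>\<kappa>Qu>0. \<exists>\<kappa>Quz>0. \<forall>u1 u2. \<forall>z\<in>B. \<forall>m.
        norm (Du Q u2 m z - Du Q u1 m z) \<le> \<kappa>Qu * norm (u2 - u1) \<and>
        norm (Duz Q u2 m z - Duz Q u1 m z) \<le> \<kappa>Quz * norm (u2 - u1)) \<and>
     (\<exists>MQ\<ge>0. \<exists>MQu\<ge>0. \<exists>MQz\<ge>0. \<exists>MQuz\<ge>0. \<forall>z\<in>B. \<forall>m.
        \<bar>Q 0 m z\<bar> \<le> MQ \<and> norm (Du Q 0 m z) \<le> MQu \<and>
        norm (Dz Q 0 m z) \<le> MQz \<and> norm (Duz Q 0 m z) \<le> MQuz)"

definition objective ::
  "'m measure \<Rightarrow> ('u \<Rightarrow> 'm \<Rightarrow> 'z \<Rightarrow> real) \<Rightarrow> ('z \<Rightarrow> real) \<Rightarrow> ('m \<Rightarrow> 'z \<Rightarrow> 'u) \<Rightarrow> 'z \<Rightarrow> real" where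
  "objective \<mu> Q P v z = (LINT m|\<mu>. Q (v m z) m z) + P z"


definition gelu :: "real \<Rightarrow> real" where
  "gelu x = x * cdf std_normal_distribution x"

primrec gelu_activation ::
  "(nat \<Rightarrow> real mat) \<Rightarrow> (nat \<Rightarrow> real Matrix.vec) \<Rightarrow> real Matrix.vec \<Rightarrow> nat \<Rightarrow> real Matrix.vec" where
  "gelu_activation W b a 0 = a"
| "gelu_activation W b a (Suc i) = map_vec gelu (W i *\<^sub>v gelu_activation W b a i + b i)"

(* L is the number of hidden layers and n i the width of layer i. *)
definition gelu_network :: "nat \<Rightarrow> nat \<Rightarrow> (real Matrix.vec \<Rightarrow> real Matrix.vec) \<Rightarrow> bool" where
  "gelu_network n_in n_out g \<longleftrightarrow>
     (\<exists>L n W b. n 0 = n_in \<and> n (Suc L) = n_out \<and>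
        (\<forall>i\<le>L. W i \<in> carrier_mat (n (Suc i)) (n i) \<and> b i \<in> carrier_vec (n (Suc i))) \<and>
        (\<forall>a\<in>carrier_vec n_in. g a = W L *\<^sub>v gelu_activation W b a L + b L))"

definition decode :: "(nat \<Rightarrow> 'u::real_vector) \<Rightarrow> nat \<Rightarrow> real Matrix.vec \<Rightarrow> 'u" where
  "decode \<phi> r c = (\<Sum>i<r. vec_index c i *\<^sub>R \<phi> i)"

definition encode :: "(nat \<Rightarrow> 'm::real_inner) \<Rightarrow> nat \<Rightarrow> 'm \<Rightarrow> real Matrix.vec" where
  "encode \<psi> r m = Matrix.vec r (\<lambda>i. inner m (\<psi> i))"

(* The coordinates of z, listed in the enumeration of the index type 'd given by
   from_nat_into, which is a bijection from {..<CARD('d)}.  The choice is immaterial: another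
   one permutes columns of the first weight matrix of a network. *)
definition coords :: "real ^ 'd \<Rightarrow> real Matrix.vec" where
  "coords z = Matrix.vec CARD('d) (\<lambda>j. vec_nth z (from_nat_into UNIV j))"

definition surrogate ::
  "(nat \<Rightarrow> 'u::real_inner) \<Rightarrow> (nat \<Rightarrow> 'm::real_inner) \<Rightarrow> 'u \<Rightarrow> 'm \<Rightarrow> nat \<Rightarrow> nat \<Rightarrow>
   (real Matrix.vec \<Rightarrow> real Matrix.vec) \<Rightarrow> 'm \<Rightarrow> real ^ 'd \<Rightarrow> 'u" where
  "surrogate \<phi> \<psi> bu bm rm ru g m z =
     decode \<phi> ru (g (encode \<psi> rm (m - bm) @\<^sub>v coords z)) + bu"

end

theory Submission
  imports Defs
begin

text \<open>
  If the gradients of \<open>J\<close> and of the surrogate objective differ by at most \<open>\<delta>\<close> on \<open>Zad\<close>, strong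
  convexity of \<open>J\<close> puts every stationary point of the surrogate objective within \<open>O(\<delta>)\<close> of the
  minimizer.  Differentiating under the integral, the gradient error is controlled by the
  \<open>L\<^sup>2(\<mu>)\<close>-errors of the surrogate and of its \<open>z\<close>-derivative, uniformly in \<open>z\<close>.

  Since \<open>u\<close> and its \<open>z\<close>-derivative are Lipschitz in \<open>m\<close>, one may first replace \<open>m\<close> by a truncation
  with finitely many coordinates, each clipped to a bounded interval by a difference of two GELU
  units; this costs a term tending to \<open>0\<close> in \<open>L\<^sup>2(\<mu>)\<close>, and only bounded inputs remain.
  There, the functions that networks approximate uniformly together with their \<open>z\<close>-derivatives
  form an algebra: \<open>t\<^sup>2\<close> is a limit of rescaled sums of GELU units, hence products are approximable,
  hence \<open>(max 0 t)\<^sup>2\<close> is, hence \<open>C\<^sup>1\<close> partitions of unity.  Gluing the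
  first-order Taylor polynomials of \<open>u\<close> in \<open>z\<close> on cells of width \<open>h\<close> in \<open>z\<close> and \<open>h\<^sup>2\<close> in the
  coordinates of \<open>m\<close> makes an error \<open>O(h\<^sup>2)\<close> in the values, which compensates the factor \<open>1/h\<close> from the
  derivatives of the partition of unity.
\<close>

section \<open>Gaussian distribution function and GELU\<close>

text \<open>The parameter space is infinite-dimensional and unbounded, and \<open>\<mu>\<close> is
  controlled only by its second moment, while a network may grow outside any compact set. The
  clipping is therefore part of the network itself: the clipped coordinates are bounded on the whole
  space, and the approximation that follows is uniform in every \<open>m\<close>. Only the encoding
  error depends on \<open>m\<close>, and it enters through the Lipschitz constants of
  \<open>u\<close> and its derivative.

  The cells are thin in \<open>m\<close> because there the values are compared by the Lipschitz
  bound alone, without a Taylor expansion. Thin cells are harmless: the cutoffs in \<open>m\<close>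
  do not depend on \<open>z\<close>, so their \<open>z\<close>-derivative vanishes.

  Accuracy is obtained on \<open>Zad\<close>, which may have empty interior, whereas differentiation
  under the integral needs an open set. On a bounded open neighbourhood it suffices to know linear
  growth in \<open>m\<close>, which every GELU network has. The gradient error is then of order (1 +
  |m|) times the pointwise error, plus its square; Young's inequality with a small weight on the
  growing factor separates the two.\<close>

abbreviation Gcdf :: "real \<Rightarrow> real" where
  "Gcdf \<equiv> cdf std_normal_distribution"

lemma real_distribution_std_normal: "real_distribution std_normal_distribution"
  by (rule real_dist_normal_dist)

lemma Gcdf_nonneg: "0 \<le> Gcdf x"
  by (simp add: cdf_def)

lemma Gcdf_le_1: "Gcdf x \<le> 1"
proof -
  interpret real_distribution std_normal_distribution
    by (rule real_distribution_std_normal)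
  show ?thesis by (rule cdf_bounded_prob)
qed

lemma continuous_std_normal_density: "continuous_on A std_normal_density"
  unfolding normal_density_def by (intro continuous_intros) auto

lemma Gcdf_eq: "Gcdf x = (LBINT y:{..x}. std_normal_density y)"
proof -
  have "Gcdf x = (\<integral>y. indicator {..x} y \<partial>std_normal_distribution)"
    by (simp add: cdf_def)
  also have "\<dots> = (LBINT y. std_normal_density y *\<^sub>R indicator {..x} y)"
    by (subst integral_density) auto
  finally show ?thesis
    by (simp add: set_lebesgue_integral_def mult.commute)
qed

lemma set_integrable_std_normal_density:
  "A \<in> sets borel \<Longrightarrow> set_integrable lborel A std_normal_density"
  unfolding set_integrable_def
  using integrable_std_normal_moment[of 0]
  by (intro integrable_mult_indicator) auto

text \<open>The improper integral is cut at a base point below \<open>x\<close>: the tail is a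
  constant, and the fundamental theorem of calculus applies to the rest, on a compact
  interval.\<close>

lemma Gcdf_deriv: "(Gcdf has_real_derivative std_normal_density x) (at x)"
proof -
  let ?a = "x - 1"
  have eq: "Gcdf y = Gcdf ?a + integral {?a..y} std_normal_density" if "?a \<le> y" for y
  proof -
    have "Gcdf y = (LBINT t:{..?a} \<union> {?a<..y}. std_normal_density t)"
      using that by (subst Gcdf_eq, intro arg_cong2[where f="set_lebesgue_integral lborel"]) auto
    also have "\<dots> = (LBINT t:{..?a}. std_normal_density t) + (LBINT t:{?a<..y}. std_normal_density t)"
      by (intro set_integral_Un set_integrable_std_normal_density) auto
    also have "(LBINT t:{?a<..y}. std_normal_density t) = (LBINT t:{?a..y}. std_normal_density t)"
      by (intro set_integral_cong_set)
         (auto simp: set_borel_measurable_def intro!: AE_I[where N="{?a}"])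
    also have "\<dots> = integral {?a..y} std_normal_density"
      by (intro set_borel_integral_eq_integral(2) set_integrable_std_normal_density) auto
    finally show ?thesis by (simp add: Gcdf_eq)
  qed
  have "((\<lambda>y. integral {?a..y} std_normal_density) has_real_derivative std_normal_density x)
      (at x within {?a..x + 1})"
    by (rule integral_has_real_derivative) (auto intro: continuous_std_normal_density)
  hence "((\<lambda>y. Gcdf ?a + integral {?a..y} std_normal_density) has_real_derivative std_normal_density x)
      (at x within {?a..x + 1})"
    by (auto intro!: derivative_eq_intros)
  moreover have "at x within {?a..x + 1} = at x"
    by (rule at_within_interior) auto
  ultimately have *: "((\<lambda>y. Gcdf ?a + integral {?a..y} std_normal_density) has_real_derivative
      std_normal_density x) (at x)"
    by simp
  show ?thesis
    by (rule has_field_derivative_transform_within_open[OF *, where S="{?a<..}"])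
       (simp_all, rule eq[symmetric], simp)
qed

text \<open>\<open>Gcdf x + Gcdf (- x)\<close> has derivative 0 because the density is even; its
  constant value 1 is read off from the limits at infinity.\<close>

lemma Gcdf_uminus: "Gcdf (- x) = 1 - Gcdf x"
proof -
  let ?F = "\<lambda>x. Gcdf x + Gcdf (- x)"
  have der: "(?F has_real_derivative 0) (at x)" for x
    by (rule derivative_eq_intros Gcdf_deriv DERIV_chain2[OF Gcdf_deriv] refl)+
       (simp add: normal_density_def)
  have const: "?F x = ?F y" for x y
    using DERIV_isconst_all[of ?F] der by blast
  interpret real_distribution std_normal_distribution
    by (rule real_distribution_std_normal)
  have "(?F \<longlongrightarrow> 1 + 0) at_top"
    by (intro tendsto_add cdf_lim_at_top_prob filterlim_compose[OF cdf_lim_at_bot filterlim_uminus_at_bot_at_top])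
  moreover have "(?F \<longlongrightarrow> ?F x) at_top"
    by (rule tendsto_eventually) (use const in auto)
  ultimately have "?F x = 1"
    using tendsto_unique[OF trivial_limit_at_top_linorder] by fastforce
  thus ?thesis by simp
qed

lemma Gcdf_0: "Gcdf 0 = 1 / 2"
  using Gcdf_uminus[of 0] by simp

text \<open>Serves to discard the normalising factor \<open>sqrt (2 * pi)\<close> of the
  density.\<close>

lemma divide_le_bound:
  fixes a b c :: real
  assumes "a \<le> b" "1 \<le> c" "0 \<le> b"
  shows "a / c \<le> b"
proof -
  have "b * 1 \<le> b * c" using assms by (intro mult_left_mono) auto
  thus ?thesis using assms by (simp add: divide_le_eq)
qed

text \<open>From \<open>1 + s \<le> exp s\<close> at \<open>s = x^2 / 2\<close>, since
  \<open>\<bar>x\<bar> \<le> 1 + x^2 / 2\<close>.\<close>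

lemma abs_mult_std_normal_density: "\<bar>x * std_normal_density x\<bar> \<le> 1"
proof -
  have "\<bar>x\<bar> \<le> 1 + x\<^sup>2 / 2"
    using zero_le_power2[of "\<bar>x\<bar> - 1"] by (simp add: power2_diff)
  also have "\<dots> \<le> exp (x\<^sup>2 / 2)" by (rule exp_ge_add_one_self)
  finally have "\<bar>x\<bar> * exp (- x\<^sup>2 / 2) \<le> 1"
    by (simp add: exp_minus field_simps)
  hence "\<bar>x\<bar> * exp (- x\<^sup>2 / 2) / sqrt (2 * pi) \<le> 1"
    by (rule divide_le_bound) (use pi_gt3 in auto)
  thus ?thesis by (simp add: std_normal_density_def abs_mult)
qed

lemma sq_mult_std_normal_density: "x\<^sup>2 * std_normal_density x \<le> 2"
proof -
  have "x\<^sup>2 / 2 \<le> exp (x\<^sup>2 / 2)"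
    using exp_ge_add_one_self[of "x\<^sup>2 / 2"] by linarith
  hence "x\<^sup>2 * exp (- x\<^sup>2 / 2) \<le> 2"
    by (simp add: exp_minus field_simps)
  hence "x\<^sup>2 * exp (- x\<^sup>2 / 2) / sqrt (2 * pi) \<le> 2"
    by (rule divide_le_bound) (use pi_gt3 in auto)
  thus ?thesis by (simp add: std_normal_density_def)
qed

text \<open>Chebyshev's inequality with the second moment, which is 1, bounds
  \<open>x^2 * Gcdf (- x)\<close>; for \<open>x \<le> 1\<close> both factors are at most 1.\<close>

lemma Gcdf_tail: assumes "0 \<le> x" shows "x * Gcdf (- x) \<le> 1"
proof (cases "x \<le> 1")
  case True
  thus ?thesis using assms Gcdf_le_1[of "-x"] Gcdf_nonneg[of "-x"] by (simp add: mult_le_one)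
next
  case False
  have sq: "has_bochner_integral lborel (\<lambda>y. std_normal_density y * y ^ (2 * 1)) (fact (2 * 1) / (2 ^ 1 * fact 1))"
    by (rule std_normal_moment_even)
  have "x\<^sup>2 * Gcdf (- x) = (LBINT y. x\<^sup>2 * (indicator {..-x} y * std_normal_density y))"
    by (subst Gcdf_eq) (simp add: set_lebesgue_integral_def)
  also have "\<dots> \<le> (LBINT y. std_normal_density y * y ^ (2 * 1))"
  proof (intro integral_mono integrable_mult_right)
    show "integrable lborel (\<lambda>y. indicator {..-x} y * std_normal_density y)"
      using set_integrable_std_normal_density[of "{..-x}"] by (simp add: set_integrable_def)
    show "integrable lborel (\<lambda>y. std_normal_density y * y ^ (2 * 1))"
      by (rule integrable_std_normal_moment)
    fix y
    have "x\<^sup>2 \<le> y\<^sup>2" if "y \<le> - x" 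
      using that assms by (intro iffD1[OF abs_le_square_iff]) auto
    thus "x\<^sup>2 * (indicator {..- x} y * std_normal_density y) \<le> std_normal_density y * y ^ (2 * 1)"
      by (auto simp: indicator_def mult.commute intro!: mult_left_mono)
  qed
  also have "\<dots> = 1"
    using sq by (subst has_bochner_integral_integral_eq[OF sq]) simp
  finally have "x\<^sup>2 * Gcdf (- x) \<le> 1" .
  moreover have "x * Gcdf (- x) \<le> x\<^sup>2 * Gcdf (- x)"
    using False by (intro mult_right_mono Gcdf_nonneg) (auto simp: power2_eq_square)
  ultimately show ?thesis by linarith
qed

definition dgelu :: "real \<Rightarrow> real" where
  "dgelu x = Gcdf x + x * std_normal_density x"

lemma gelu_deriv: "(gelu has_real_derivative dgelu x) (at x)"
  unfolding gelu_def[abs_def] dgelu_def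
  by (rule derivative_eq_intros Gcdf_deriv refl)+ simp

lemma continuous_gelu: "continuous_on A gelu"
  using gelu_deriv by (intro DERIV_continuous_on) (auto intro: has_field_derivative_at_within)

lemma continuous_dgelu: "continuous_on A dgelu"
proof -
  have "continuous_on A Gcdf"
    using Gcdf_deriv by (intro DERIV_continuous_on) (auto intro: has_field_derivative_at_within)
  thus ?thesis
    unfolding dgelu_def[abs_def] by (intro continuous_intros continuous_std_normal_density)
qed

lemma dgelu_bound: "\<bar>dgelu x\<bar> \<le> 2"
  using Gcdf_nonneg[of x] Gcdf_le_1[of x] abs_mult_std_normal_density[of x]
  unfolding dgelu_def by linarith

lemma gelu_diff: "gelu x - gelu (- x) = x"
  unfolding gelu_def Gcdf_uminus by (simp add: algebra_simps)

lemma gelu_lipschitz: "\<bar>gelu x - gelu y\<bar> \<le> 2 * \<bar>x - y\<bar>"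
proof -
  have "norm (gelu x - gelu y) \<le> 2 * norm (x - y)"
    by (rule field_differentiable_bound[of UNIV gelu dgelu])
       (use gelu_deriv dgelu_bound in \<open>auto intro: has_field_derivative_at_within\<close>)
  thus ?thesis by simp
qed

text \<open>On either side of 0 the error is, up to sign,
  \<open>\<bar>x\<bar> * Gcdf (- \<bar>x\<bar>)\<close>. Since the bound is absolute,
  \<open>gelu (k * x) / k\<close> tends to the positive part of \<open>x\<close> uniformly, at rate
  \<open>1 / k\<close>.\<close>

lemma gelu_relu: "\<bar>gelu x - max 0 x\<bar> \<le> 1"
proof (cases "0 \<le> x")
  case True
  have "gelu x - max 0 x = - (x * Gcdf (- x))"
    unfolding gelu_def Gcdf_uminus using True by (simp add: algebra_simps max_def)
  moreover have "0 \<le> x * Gcdf (- x)"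
    by (intro mult_nonneg_nonneg True Gcdf_nonneg)
  ultimately show ?thesis using Gcdf_tail[OF True] by linarith
next
  case False
  hence "gelu x - max 0 x = - (- x * Gcdf (- (- x)))"
    unfolding gelu_def by (simp add: max_def)
  moreover have "0 \<le> - x * Gcdf (- (- x))"
    using False by (intro mult_nonneg_nonneg Gcdf_nonneg) simp
  moreover have "- x * Gcdf (- (- x)) \<le> 1"
    using False by (intro Gcdf_tail) simp
  ultimately show ?thesis by linarith
qed

section \<open>Finite families of functions as GELU networks\<close>

text \<open>Expressions may join subexpressions of different depths, which a layered network cannot
  do directly. The argument \<open>x\<close> is abstract: later it is a pair \<open>(m, z)\<close>,
  of which a network sees only the finitely many inputs \<open>X i\<close>.\<close>

inductive_set gelu_span :: "(nat \<Rightarrow> 'x \<Rightarrow> real) \<Rightarrow> nat \<Rightarrow> ('x \<Rightarrow> real) set"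
  for X :: "nat \<Rightarrow> 'x \<Rightarrow> real" and n :: nat where
  gen: "i < n \<Longrightarrow> X i \<in> gelu_span X n"
| const: "(\<lambda>x. c) \<in> gelu_span X n"
| add: "f \<in> gelu_span X n \<Longrightarrow> g \<in> gelu_span X n \<Longrightarrow> (\<lambda>x. f x + g x) \<in> gelu_span X n"
| scale: "f \<in> gelu_span X n \<Longrightarrow> (\<lambda>x. c * f x) \<in> gelu_span X n"
| gelu: "f \<in> gelu_span X n \<Longrightarrow> (\<lambda>x. gelu (f x)) \<in> gelu_span X n"

text \<open>The hidden units are indexed by the functions they compute, so that the union of two layers
  is a union of sets.\<close>

fun gelu_layer :: "(nat \<Rightarrow> 'x \<Rightarrow> real) \<Rightarrow> nat \<Rightarrow> nat \<Rightarrow> ('x \<Rightarrow> real) set" where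
  "gelu_layer X n 0 = {f. \<exists>c d. f = (\<lambda>x. (\<Sum>i<n. c i * X i x) + d)}"
| "gelu_layer X n (Suc L) =
     {f. \<exists>A c d. finite A \<and> A \<subseteq> gelu_layer X n L \<and> f = (\<lambda>x. (\<Sum>s\<in>A. c s * gelu (s x)) + d)}"

lemma gelu_layer_scale: "f \<in> gelu_layer X n L \<Longrightarrow> (\<lambda>x. a * f x) \<in> gelu_layer X n L"
proof (cases L)
  case 0
  assume "f \<in> gelu_layer X n L"
  then obtain c d where f: "f = (\<lambda>x. (\<Sum>i<n. c i * X i x) + d)" using 0 by auto
  show ?thesis
    unfolding 0 gelu_layer.simps mem_Collect_eq f
    by (rule exI[of _ "\<lambda>i. a * c i"], rule exI[of _ "a * d"])
       (simp add: algebra_simps sum_distrib_left)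
next
  case (Suc L')
  assume "f \<in> gelu_layer X n L"
  then obtain A c d where A: "finite A" "A \<subseteq> gelu_layer X n L'"
    and f: "f = (\<lambda>x. (\<Sum>s\<in>A. c s * gelu (s x)) + d)" using Suc by auto
  show ?thesis
    unfolding Suc gelu_layer.simps mem_Collect_eq f
    by (rule exI[of _ A], rule exI[of _ "\<lambda>i. a * c i"], rule exI[of _ "a * d"])
       (use A in \<open>simp add: algebra_simps sum_distrib_left\<close>)
qed

lemma gelu_layer_add:
  "f \<in> gelu_layer X n L \<Longrightarrow> g \<in> gelu_layer X n L \<Longrightarrow> (\<lambda>x. f x + g x) \<in> gelu_layer X n L"
proof (cases L)
  case 0
  assume "f \<in> gelu_layer X n L" "g \<in> gelu_layer X n L"
  then obtain c d c' d' where f: "f = (\<lambda>x. (\<Sum>i<n. c i * X i x) + d)"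
    and g: "g = (\<lambda>x. (\<Sum>i<n. c' i * X i x) + d')" using 0 by auto
  show ?thesis
    unfolding 0 gelu_layer.simps mem_Collect_eq f g
    by (rule exI[of _ "\<lambda>i. c i + c' i"], rule exI[of _ "d + d'"])
       (simp add: algebra_simps sum.distrib)
next
  case (Suc L')
  assume "f \<in> gelu_layer X n L" "g \<in> gelu_layer X n L"
  then obtain A c d A' c' d' where A: "finite A" "A \<subseteq> gelu_layer X n L'"
    and f: "f = (\<lambda>x. (\<Sum>s\<in>A. c s * gelu (s x)) + d)"
    and A': "finite A'" "A' \<subseteq> gelu_layer X n L'"
    and g: "g = (\<lambda>x. (\<Sum>s\<in>A'. c' s * gelu (s x)) + d')" using Suc by auto
  \<comment> \<open>A unit occurring in both sums receives the sum of its two weights.\<close>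
  let ?e = "\<lambda>s. (if s \<in> A then c s else 0) + (if s \<in> A' then c' s else 0)"
  have "(\<Sum>s\<in>A \<union> A'. ?e s * gelu (s x)) = (\<Sum>s\<in>A. c s * gelu (s x)) + (\<Sum>s\<in>A'. c' s * gelu (s x))"
    for x
  proof -
    have "(\<Sum>s\<in>A \<union> A'. ?e s * gelu (s x)) =
       (\<Sum>s\<in>A \<union> A'. (if s \<in> A then c s * gelu (s x) else 0)) +
       (\<Sum>s\<in>A \<union> A'. (if s \<in> A' then c' s * gelu (s x) else 0))"
      unfolding sum.distrib[symmetric] by (intro sum.cong) (auto simp: algebra_simps)
    also have "(\<Sum>s\<in>A \<union> A'. (if s \<in> A then c s * gelu (s x) else 0)) = (\<Sum>s\<in>A. c s * gelu (s x))"
      using A(1) A'(1) by (intro sum.mono_neutral_cong_right) auto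
    also have "(\<Sum>s\<in>A \<union> A'. (if s \<in> A' then c' s * gelu (s x) else 0)) = (\<Sum>s\<in>A'. c' s * gelu (s x))"
      using A(1) A'(1) by (intro sum.mono_neutral_cong_right) auto
    finally show ?thesis .
  qed
  thus ?thesis
    unfolding Suc gelu_layer.simps mem_Collect_eq f g
    by (intro exI[of _ "A \<union> A'"] exI[of _ ?e] exI[of _ "d + d'"])
       (use A A' in \<open>auto simp: algebra_simps\<close>)
qed

text \<open>Skipping a layer is exact, since \<open>gelu t - gelu (- t) = t\<close>.\<close>

lemma gelu_layer_Suc: assumes "f \<in> gelu_layer X n L" shows "f \<in> gelu_layer X n (Suc L)"
proof -
  let ?g = "\<lambda>x. (-1) * f x"
  have g: "?g \<in> gelu_layer X n L" using assms by (rule gelu_layer_scale)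
  have single: "(\<lambda>x. gelu (h x)) \<in> gelu_layer X n (Suc L)" if "h \<in> gelu_layer X n L" for h
    unfolding gelu_layer.simps mem_Collect_eq
    by (rule exI[of _ "{h}"], rule exI[of _ "\<lambda>_. 1"], rule exI[of _ 0]) (use that in simp)
  have "(\<lambda>x. gelu (f x) + (-1) * gelu (?g x)) \<in> gelu_layer X n (Suc L)"
    by (rule gelu_layer_add[OF single[OF assms] gelu_layer_scale[OF single[OF g]]])
  also have "(\<lambda>x. gelu (f x) + (-1) * gelu (?g x)) = f"
    using gelu_diff by (auto simp: fun_eq_iff)
  finally show ?thesis .
qed

lemma gelu_layer_mono: "L \<le> L' \<Longrightarrow> gelu_layer X n L \<subseteq> gelu_layer X n L'"
proof (induction rule: dec_induct)
  case (step m)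
  have "gelu_layer X n m \<subseteq> gelu_layer X n (Suc m)" by (intro subsetI gelu_layer_Suc)
  thus ?case using step.IH by (rule order.trans[rotated])
qed simp

lemma gelu_span_layer: "f \<in> gelu_span X n \<Longrightarrow> \<exists>L. f \<in> gelu_layer X n L"
proof (induction rule: gelu_span.induct)
  case (gen i)
  have "X i \<in> gelu_layer X n 0"
    unfolding gelu_layer.simps mem_Collect_eq
    by (rule exI[of _ "\<lambda>j. if j = i then 1 else 0"], rule exI[of _ 0])
       (use gen in \<open>simp add: fun_eq_iff if_distrib[where f="\<lambda>c. c * _"] cong: if_cong\<close>)
  thus ?case by blast
next
  case (const c)
  have "(\<lambda>x. c) \<in> gelu_layer X n 0"
    unfolding gelu_layer.simps mem_Collect_eq by (rule exI[of _ "\<lambda>_. 0"], rule exI[of _ c]) simp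
  thus ?case by blast
next
  case (add f g)
  then obtain L L' where "f \<in> gelu_layer X n L" "g \<in> gelu_layer X n L'" by blast
  hence "f \<in> gelu_layer X n (max L L')" "g \<in> gelu_layer X n (max L L')"
    by (auto elim!: subsetD[OF gelu_layer_mono, rotated])
  from gelu_layer_add[OF this] show ?case by blast
next
  case (scale f c)
  then obtain L where "f \<in> gelu_layer X n L" by blast
  from gelu_layer_scale[OF this] show ?case by blast
next
  case (gelu f)
  then obtain L where L: "f \<in> gelu_layer X n L" by blast
  have "(\<lambda>x. gelu (f x)) \<in> gelu_layer X n (Suc L)"
    unfolding gelu_layer.simps mem_Collect_eq
    by (rule exI[of _ "{f}"], rule exI[of _ "\<lambda>_. 1"], rule exI[of _ 0]) (use L in simp)
  thus ?case by blast
qed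

lemma gelu_activation_cong:
  "(\<And>j. j < i \<Longrightarrow> W j = W' j \<and> b j = b' j) \<Longrightarrow> gelu_activation W b a i = gelu_activation W' b' a i"
  by (induction i) auto

lemma choice3: "\<forall>i. \<exists>a b c. R i a b c \<Longrightarrow> \<exists>A B C. \<forall>i. R i (A i) (B i) (C i)"
  by metis

text \<open>The last weight matrix acts on the finitely many units used by any of the outputs. The
  induction hypothesis is applied with these units as outputs, so that one network computes all of
  them at once.\<close>

lemma gelu_layer_network:
  assumes "\<And>i. i < k \<Longrightarrow> fs i \<in> gelu_layer X n L"
  shows "\<exists>N W b. N 0 = n \<and> N (Suc L) = k \<and>
    (\<forall>i\<le>L. W i \<in> carrier_mat (N (Suc i)) (N i) \<and> b i \<in> carrier_vec (N (Suc i))) \<and>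
    (\<forall>x. W L *\<^sub>v gelu_activation W b (Matrix.vec n (\<lambda>i. X i x)) L + b L = Matrix.vec k (\<lambda>i. fs i x))"
  using assms
proof (induction L arbitrary: k fs)
  case 0
  hence "\<forall>i. \<exists>c d. i < k \<longrightarrow> fs i = (\<lambda>x. (\<Sum>j<n. c j * X j x) + d)" by auto
  then obtain c d where f: "\<And>i. i < k \<Longrightarrow> fs i = (\<lambda>x. (\<Sum>j<n. c i j * X j x) + d i)"
    by metis
  show ?case
    by (rule exI[of _ "\<lambda>i. if i = 0 then n else k"], rule exI[of _ "\<lambda>_. Matrix.mat k n (\<lambda>(i, j). c i j)"],
        rule exI[of _ "\<lambda>_. Matrix.vec k d"])
       (auto simp: f scalar_prod_def lessThan_atLeast0 intro!: eq_vecI)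
next
  case (Suc L)
  hence "\<forall>i. \<exists>A c d. i < k \<longrightarrow> finite A \<and> A \<subseteq> gelu_layer X n L \<and>
      fs i = (\<lambda>x. (\<Sum>s\<in>A. c s * gelu (s x)) + d)" by auto
  from choice3[OF this] obtain A c d where fA: "\<And>i. i < k \<Longrightarrow> finite (A i)"
       "\<And>i. i < k \<Longrightarrow> A i \<subseteq> gelu_layer X n L"
     and f: "\<And>i. i < k \<Longrightarrow> fs i = (\<lambda>x. (\<Sum>s\<in>A i. c i s * gelu (s x)) + d i)"
    by blast
  define U where "U = (\<Union>i<k. A i)"
  define K where "K = card U"
  have finU: "finite U" using fA(1) by (auto simp: U_def)
  then obtain h where h: "bij_betw h {..<K} U"
    using ex_bij_betw_nat_finite unfolding K_def lessThan_atLeast0 by blast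
  have "h j \<in> gelu_layer X n L" if "j < K" for j
    using bij_betwE[OF h] that fA(2) unfolding U_def by blast
  from Suc.IH[of K h, OF this] obtain N W b where N: "N 0 = n" "N (Suc L) = K"
    and dim: "\<And>i. i \<le> L \<Longrightarrow> W i \<in> carrier_mat (N (Suc i)) (N i) \<and> b i \<in> carrier_vec (N (Suc i))"
    and out: "\<And>x. W L *\<^sub>v gelu_activation W b (Matrix.vec n (\<lambda>i. X i x)) L + b L = Matrix.vec K (\<lambda>i. h i x)"
    by blast
  let ?e = "\<lambda>i s. if s \<in> A i then c i s else 0"
  define N' where "N' = N(Suc (Suc L) := k)"
  define W' where "W' = W(Suc L := Matrix.mat k K (\<lambda>(i, j). ?e i (h j)))"
  define b' where "b' = b(Suc L := Matrix.vec k d)"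
  \<comment> \<open>The parameters up to index \<open>L\<close> are unchanged, so the last hidden
    layer is \<open>gelu\<close> applied to the output of the smaller network.\<close>
  have act: "gelu_activation W' b' (Matrix.vec n (\<lambda>i. X i x)) (Suc L) = map_vec gelu (Matrix.vec K (\<lambda>i. h i x))" for x
  proof -
    have "gelu_activation W' b' (Matrix.vec n (\<lambda>i. X i x)) (Suc L) =
          gelu_activation W b (Matrix.vec n (\<lambda>i. X i x)) (Suc L)"
      by (rule gelu_activation_cong) (auto simp: W'_def b'_def)
    thus ?thesis by (simp add: out)
  qed
  have sum: "(\<Sum>j<K. ?e i (h j) * gelu (h j x)) = (\<Sum>s\<in>A i. c i s * gelu (s x))" if "i < k" for i x
  proof -
    have "(\<Sum>j<K. ?e i (h j) * gelu (h j x)) = (\<Sum>s\<in>U. ?e i s * gelu (s x))"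
      by (rule sum.reindex_bij_betw[OF h])
    also have "\<dots> = (\<Sum>s\<in>U. if s \<in> A i then c i s * gelu (s x) else 0)"
      by (rule sum.cong) auto
    also have "\<dots> = (\<Sum>s\<in>U \<inter> A i. c i s * gelu (s x))"
      using finU by (simp add: sum.inter_restrict)
    also have "U \<inter> A i = A i" using that by (auto simp: U_def)
    finally show ?thesis .
  qed
  have "W' (Suc L) *\<^sub>v gelu_activation W' b' (Matrix.vec n (\<lambda>i. X i x)) (Suc L) + b' (Suc L)
      = Matrix.vec k (\<lambda>i. fs i x)" for x
    unfolding act
    by (rule eq_vecI) (auto simp: W'_def b'_def scalar_prod_def lessThan_atLeast0[symmetric] sum f)
  moreover have "W' i \<in> carrier_mat (N' (Suc i)) (N' i) \<and> b' i \<in> carrier_vec (N' (Suc i))" if "i \<le> Suc L" for i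
    using that dim[of i] N by (cases "i = Suc L") (auto simp: W'_def b'_def N'_def)
  moreover have "N' 0 = n" "N' (Suc (Suc L)) = k" using N by (auto simp: N'_def)
  ultimately show ?case by blast
qed

lemma gelu_span_network:
  assumes "\<And>i. i < k \<Longrightarrow> fs i \<in> gelu_span X n"
  shows "\<exists>g. gelu_network n k g \<and>
    (\<forall>x. g (Matrix.vec n (\<lambda>i. X i x)) = Matrix.vec k (\<lambda>i. fs i x))"
proof -
  have "\<forall>i. \<exists>L. i < k \<longrightarrow> fs i \<in> gelu_layer X n L"
    using assms gelu_span_layer by blast
  then obtain l where l: "\<And>i. i < k \<Longrightarrow> fs i \<in> gelu_layer X n (l i)" by metis
  \<comment> \<open>A common bound on the depths; shallower outputs are carried along by the exact
    skipping of layers.\<close>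
  define L where "L = (\<Sum>i<k. l i)"
  have "fs i \<in> gelu_layer X n L" if "i < k" for i
  proof -
    have "l i \<le> L" unfolding L_def using that by (intro member_le_sum) auto
    thus ?thesis using l[OF that] gelu_layer_mono by blast
  qed
  from gelu_layer_network[of k fs X n L, OF this] obtain N W b where N: "N 0 = n" "N (Suc L) = k"
    "\<forall>i\<le>L. W i \<in> carrier_mat (N (Suc i)) (N i) \<and> b i \<in> carrier_vec (N (Suc i))"
    "\<forall>x. W L *\<^sub>v gelu_activation W b (Matrix.vec n (\<lambda>i. X i x)) L + b L = Matrix.vec k (\<lambda>i. fs i x)"
    by blast
  show ?thesis
    by (rule exI[of _ "\<lambda>a. W L *\<^sub>v gelu_activation W b a L + b L"])
       (use N in \<open>auto simp: gelu_network_def\<close>)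
qed

section \<open>Uniform \<open>C\<^sup>1\<close> approximation in the second variable\<close>

text \<open>\<open>F'\<close> and \<open>G'\<close> stand for derivatives in the second variable, which is not assumed here.\<close>

definition C1z_near ::
  "real \<Rightarrow> 'z set \<Rightarrow> ('m \<Rightarrow> 'z \<Rightarrow> 'a::real_normed_vector) \<Rightarrow> ('m \<Rightarrow> 'z \<Rightarrow> 'b::real_normed_vector) \<Rightarrow>
   ('m \<Rightarrow> 'z \<Rightarrow> 'a) \<Rightarrow> ('m \<Rightarrow> 'z \<Rightarrow> 'b) \<Rightarrow> bool" where
  "C1z_near e Z F F' G G' \<longleftrightarrow>
     (\<forall>m. \<forall>z\<in>Z. norm (F m z - G m z) \<le> e \<and> norm (F' m z - G' m z) \<le> e)"

text \<open>The derivative is taken in the whole space and not within \<open>Z\<close>; it is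
  therefore unique even if \<open>Z\<close> has empty interior.\<close>

definition has_zderiv ::
  "('m \<Rightarrow> 'z::real_normed_vector \<Rightarrow> 'a::real_normed_vector) \<Rightarrow> ('m \<Rightarrow> 'z \<Rightarrow> 'z \<Rightarrow>\<^sub>L 'a) \<Rightarrow> 'z set \<Rightarrow> bool" where
  "has_zderiv F F' Z \<longleftrightarrow> (\<forall>m. \<forall>z\<in>Z. (F m has_derivative blinfun_apply (F' m z)) (at z))"

lemma has_zderivD:
  "has_zderiv F F' Z \<Longrightarrow> z \<in> Z \<Longrightarrow> (F m has_derivative blinfun_apply (F' m z)) (at z)"
  by (simp add: has_zderiv_def)

lemma continuous_interval_bound:
  fixes f :: "real \<Rightarrow> real"
  assumes "continuous_on UNIV f"
  obtains c where "0 \<le> c" "\<And>t. t \<in> {l..r} \<Longrightarrow> \<bar>f t\<bar> \<le> c"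
proof -
  have "compact (f ` {l..r})"
    by (intro compact_continuous_image continuous_on_subset[OF assms]) auto
  then obtain c where "\<And>t. t \<in> {l..r} \<Longrightarrow> \<bar>f t\<bar> \<le> c"
    using compact_imp_bounded[of "f ` {l..r}"] unfolding bounded_iff real_norm_def by blast
  thus ?thesis using that[of "max 0 c"] by fastforce
qed

lemma DERIV_continuous_UNIV:
  "(\<And>t. (q has_real_derivative q' t) (at t)) \<Longrightarrow> continuous_on UNIV q"
  by (rule DERIV_continuous_on)

lemma relu_square_deriv: "((\<lambda>t. (max 0 t)\<^sup>2) has_real_derivative 2 * max 0 t) (at (t::real))"
proof (cases t "0 :: real" rule: linorder_cases)
  case less
  have "((\<lambda>t. 0) has_real_derivative 2 * max 0 t) (at t)" using less by simp
  thus ?thesis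
    by (rule has_field_derivative_transform_within_open[where S="{..<0}"]) (use less in auto)
next
  case greater
  have "((\<lambda>t. t\<^sup>2) has_real_derivative 2 * max 0 t) (at t)"
    using greater by (auto intro!: derivative_eq_intros)
  thus ?thesis
    by (rule has_field_derivative_transform_within_open[where S="{0<..}"]) (use greater in auto)
next
  case equal
  have "((\<lambda>h::real. ((max 0 h)\<^sup>2 - (max 0 0)\<^sup>2) / h) \<longlongrightarrow> 0) (at 0)"
  proof (rule Lim_null_comparison[where g="\<lambda>h. \<bar>h\<bar>"])
    show "\<forall>\<^sub>F h in at (0::real). norm (((max 0 h)\<^sup>2 - (max 0 0)\<^sup>2) / h) \<le> \<bar>h\<bar>"
      by (intro always_eventually) (auto simp: max_def power2_eq_square)
    show "((\<lambda>h::real. \<bar>h\<bar>) \<longlongrightarrow> 0) (at 0)" by (rule tendsto_rabs_zero) (rule tendsto_ident_at)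
  qed
  thus ?thesis using equal by (simp add: has_field_derivative_iff)
qed

lemma has_zderiv_comp_real:
  assumes "has_zderiv F F' Z" "\<And>t. (q has_real_derivative q' t) (at t)"
  shows "has_zderiv (\<lambda>m z. q (F m z)) (\<lambda>m z. q' (F m z) *\<^sub>R F' m z) Z"
  unfolding has_zderiv_def
proof (intro allI ballI)
  fix m z assume "z \<in> Z"
  from has_derivative_compose[OF has_zderivD[OF assms(1) this] assms(2)[unfolded has_field_derivative_def]]
  show "((\<lambda>z. q (F m z)) has_derivative blinfun_apply (q' (F m z) *\<^sub>R F' m z)) (at z)"
    by (simp add: scaleR_blinfun.rep_eq fun_eq_iff)
qed

section \<open>Scalar functions approximable by a class closed under affine combinations and
  GELU\<close>

locale zapprox =
  fixes S :: "('m \<times> 'z::real_normed_vector \<Rightarrow> real) set" and Z :: "'z set"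
  assumes S_const: "(\<lambda>x. c) \<in> S"
    and S_add: "f \<in> S \<Longrightarrow> g \<in> S \<Longrightarrow> (\<lambda>x. f x + g x) \<in> S"
    and S_scale: "f \<in> S \<Longrightarrow> (\<lambda>x. c * f x) \<in> S"
    and S_gelu: "f \<in> S \<Longrightarrow> (\<lambda>x. gelu (f x)) \<in> S"
begin

text \<open>Boundedness, uniform in \<open>m\<close>, belongs to the notion: a C^1 function of
  \<open>F\<close> is then only considered on a compact interval, where it is Lipschitz with
  uniformly continuous derivative.\<close>

definition approx :: "('m \<Rightarrow> 'z \<Rightarrow> real) \<Rightarrow> ('m \<Rightarrow> 'z \<Rightarrow> 'z \<Rightarrow>\<^sub>L real) \<Rightarrow> bool" where
  "approx F F' \<longleftrightarrow> has_zderiv F F' Z \<and>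
     (\<exists>b. \<forall>m. \<forall>z\<in>Z. \<bar>F m z\<bar> \<le> b \<and> norm (F' m z) \<le> b) \<and>
     (\<forall>e>0. \<exists>s\<in>S. \<exists>s'. has_zderiv (curry s) s' Z \<and> C1z_near e Z F F' (curry s) s')"

lemma approx_bound:
  assumes "approx F F'"
  obtains b where "b > 0" "\<And>m z. z \<in> Z \<Longrightarrow> \<bar>F m z\<bar> \<le> b" "\<And>m z. z \<in> Z \<Longrightarrow> norm (F' m z) \<le> b"
proof -
  from assms obtain b where "\<forall>m. \<forall>z\<in>Z. \<bar>F m z\<bar> \<le> b \<and> norm (F' m z) \<le> b"
    by (auto simp: approx_def)
  hence "z \<in> Z \<Longrightarrow> \<bar>F m z\<bar> \<le> \<bar>b\<bar> + 1" "z \<in> Z \<Longrightarrow> norm (F' m z) \<le> \<bar>b\<bar> + 1" for m z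
    by (force intro: order_trans)+
  thus ?thesis using that[of "\<bar>b\<bar> + 1"] by force
qed

lemma approx_zderiv: "approx F F' \<Longrightarrow> has_zderiv F F' Z"
  by (simp add: approx_def)

lemma approx_const: "approx (\<lambda>m z. c) (\<lambda>m z. 0)"
  unfolding approx_def
proof (intro conjI allI impI)
  show "has_zderiv (\<lambda>m z. c) (\<lambda>m z. 0) Z"
    by (auto simp: has_zderiv_def zero_blinfun.rep_eq)
  show "\<exists>b. \<forall>m. \<forall>z\<in>Z. \<bar>c\<bar> \<le> b \<and> norm (0 :: 'z \<Rightarrow>\<^sub>L real) \<le> b"
    by (intro exI[of _ "\<bar>c\<bar>"]) auto
  show "\<exists>s\<in>S. \<exists>s'. has_zderiv (curry s) s' Z \<and>
      C1z_near e Z (\<lambda>m z. c) (\<lambda>m z. 0) (curry s) s'" if "e > 0" for e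
    by (intro bexI[of _ "\<lambda>x. c"] S_const exI[of _ "\<lambda>m z. 0"])
       (use that in \<open>auto simp: has_zderiv_def C1z_near_def curry_def zero_blinfun.rep_eq\<close>)
qed

lemma approx_add:
  assumes F: "approx F F'" and G: "approx G G'"
  shows "approx (\<lambda>m z. F m z + G m z) (\<lambda>m z. F' m z + G' m z)"
  unfolding approx_def
proof (intro conjI allI impI)
  show "has_zderiv (\<lambda>m z. F m z + G m z) (\<lambda>m z. F' m z + G' m z) Z"
    using approx_zderiv[OF F] approx_zderiv[OF G]
    by (auto simp: has_zderiv_def plus_blinfun.rep_eq intro!: has_derivative_add)
  obtain b1 where b1: "\<And>m z. z \<in> Z \<Longrightarrow> \<bar>F m z\<bar> \<le> b1" "\<And>m z. z \<in> Z \<Longrightarrow> norm (F' m z) \<le> b1"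
    using approx_bound[OF F] by metis
  obtain b2 where b2: "\<And>m z. z \<in> Z \<Longrightarrow> \<bar>G m z\<bar> \<le> b2" "\<And>m z. z \<in> Z \<Longrightarrow> norm (G' m z) \<le> b2"
    using approx_bound[OF G] by metis
  show "\<exists>b. \<forall>m. \<forall>z\<in>Z. \<bar>F m z + G m z\<bar> \<le> b \<and> norm (F' m z + G' m z) \<le> b"
  proof (intro exI[of _ "b1 + b2"] allI ballI conjI)
    fix m z assume "z \<in> Z"
    thus "\<bar>F m z + G m z\<bar> \<le> b1 + b2" using b1(1)[of z m] b2(1)[of z m] by linarith
    show "norm (F' m z + G' m z) \<le> b1 + b2"
      using b1(2)[of z m] b2(2)[of z m] \<open>z \<in> Z\<close> by (intro norm_triangle_mono)
  qed
  fix e :: real assume "e > 0"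
  hence e: "e / 2 > 0" by simp
  from F e obtain s s' where s: "s \<in> S" "has_zderiv (curry s) s' Z" "C1z_near (e / 2) Z F F' (curry s) s'"
    unfolding approx_def by blast
  from G e obtain t t' where t: "t \<in> S" "has_zderiv (curry t) t' Z" "C1z_near (e / 2) Z G G' (curry t) t'"
    unfolding approx_def by blast
  show "\<exists>s\<in>S. \<exists>s'. has_zderiv (curry s) s' Z \<and>
      C1z_near e Z (\<lambda>m z. F m z + G m z) (\<lambda>m z. F' m z + G' m z) (curry s) s'"
  proof (intro bexI[of _ "\<lambda>x. s x + t x"] S_add s(1) t(1) exI[of _ "\<lambda>m z. s' m z + t' m z"] conjI)
    show "has_zderiv (curry (\<lambda>x. s x + t x)) (\<lambda>m z. s' m z + t' m z) Z"
      using s(2) t(2) by (auto simp: has_zderiv_def curry_def plus_blinfun.rep_eq intro!: has_derivative_add)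
    show "C1z_near e Z (\<lambda>m z. F m z + G m z) (\<lambda>m z. F' m z + G' m z) (curry (\<lambda>x. s x + t x)) (\<lambda>m z. s' m z + t' m z)"
      unfolding C1z_near_def curry_def
    proof (intro allI ballI conjI)
      fix m z assume z: "z \<in> Z"
      have "norm (F m z + G m z - (s (m, z) + t (m, z))) \<le> e / 2 + e / 2"
        unfolding add_diff_add using s(3) t(3) z by (intro norm_triangle_mono) (auto simp: C1z_near_def)
      thus "norm (F m z + G m z - (s (m, z) + t (m, z))) \<le> e" by simp
      have "norm (F' m z + G' m z - (s' m z + t' m z)) \<le> e / 2 + e / 2"
        unfolding add_diff_add using s(3) t(3) z by (intro norm_triangle_mono) (auto simp: C1z_near_def)
      thus "norm (F' m z + G' m z - (s' m z + t' m z)) \<le> e" by simp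
    qed
  qed
qed

lemma approx_limit:
  assumes der: "has_zderiv F F' Z"
    and bd: "\<And>m z. z \<in> Z \<Longrightarrow> \<bar>F m z\<bar> \<le> b" "\<And>m z. z \<in> Z \<Longrightarrow> norm (F' m z) \<le> b"
    and lim: "\<And>e. e > 0 \<Longrightarrow> \<exists>G G'. approx G G' \<and> C1z_near e Z F F' G G'"
  shows "approx F F'"
  unfolding approx_def
proof (intro conjI allI impI)
  show "\<exists>b. \<forall>m. \<forall>z\<in>Z. \<bar>F m z\<bar> \<le> b \<and> norm (F' m z) \<le> b"
    using bd by blast
  fix e :: real assume "e > 0"
  hence e: "e / 2 > 0" by simp
  from lim[OF this] obtain G G' where G: "approx G G'" "C1z_near (e / 2) Z F F' G G'" by blast
  from G(1) e obtain t t' where t: "t \<in> S" "has_zderiv (curry t) t' Z" "C1z_near (e / 2) Z G G' (curry t) t'"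
    unfolding approx_def by blast
  have "C1z_near e Z F F' (curry t) t'"
    unfolding C1z_near_def
  proof (intro allI ballI conjI)
    fix m z assume z: "z \<in> Z"
    have "norm (F m z - G m z + (G m z - curry t m z)) \<le> e / 2 + e / 2"
      using G(2) t(3) z by (intro norm_triangle_mono) (auto simp: C1z_near_def)
    thus "norm (F m z - curry t m z) \<le> e" by simp
    have "norm (F' m z - G' m z + (G' m z - t' m z)) \<le> e / 2 + e / 2"
      using G(2) t(3) z by (intro norm_triangle_mono) (auto simp: C1z_near_def)
    thus "norm (F' m z - t' m z) \<le> e" by simp
  qed
  thus "\<exists>s\<in>S. \<exists>s'. has_zderiv (curry s) s' Z \<and> C1z_near e Z F F' (curry s) s'"
    using t by blast
qed (rule der)

text \<open>Outer functions that may be applied to any approximable function. They turn closure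
  statements into calculus of one real variable.\<close>

definition approx_op :: "(real \<Rightarrow> real) \<Rightarrow> (real \<Rightarrow> real) \<Rightarrow> bool" where
  "approx_op q q' \<longleftrightarrow> (\<forall>F F'. approx F F' \<longrightarrow> approx (\<lambda>m z. q (F m z)) (\<lambda>m z. q' (F m z) *\<^sub>R F' m z))"

lemma approx_opD: "approx_op q q' \<Longrightarrow> approx F F' \<Longrightarrow> approx (\<lambda>m z. q (F m z)) (\<lambda>m z. q' (F m z) *\<^sub>R F' m z)"
  by (simp add: approx_op_def)

text \<open>As \<open>q\<close> acts inside \<open>S\<close>, the approximant of
  \<open>q (F m z)\<close> is \<open>q\<close> of the approximant of \<open>F\<close>. The
  derivative error splits into the change of \<open>q'\<close>, small by uniform continuity, and the
  error of the inner derivative, multiplied by a bound of \<open>q'\<close>.\<close>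

lemma approx_op_of_S:
  assumes q: "\<And>s. s \<in> S \<Longrightarrow> (\<lambda>x. q (s x)) \<in> S"
    and der: "\<And>t. (q has_real_derivative q' t) (at t)" and cont: "continuous_on UNIV q'"
  shows "approx_op q q'"
  unfolding approx_op_def
proof (intro allI impI)
  fix F F' assume F: "approx F F'"
  obtain b where b0: "b > 0" and b: "\<And>m z. z \<in> Z \<Longrightarrow> \<bar>F m z\<bar> \<le> b" "\<And>m z. z \<in> Z \<Longrightarrow> norm (F' m z) \<le> b"
    using approx_bound[OF F] by metis
  \<comment> \<open>The interval is one unit wider than the range of \<open>F\<close> on either
    side, to contain the approximants as well.\<close>
  obtain c where c0: "c \<ge> 0" and c: "\<And>t. t \<in> {-(b+1)..b+1} \<Longrightarrow> \<bar>q' t\<bar> \<le> c"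
    using continuous_interval_bound[OF cont] by metis
  have lip: "\<bar>q x - q y\<bar> \<le> c * \<bar>x - y\<bar>" if "x \<in> {-(b+1)..b+1}" "y \<in> {-(b+1)..b+1}" for x y
  proof -
    have "norm (q x - q y) \<le> c * norm (x - y)"
      by (rule field_differentiable_bound[of "{-(b+1)..b+1}" q q' c x y])
         (use that c der in \<open>auto intro: has_field_derivative_at_within\<close>)
    thus ?thesis by simp
  qed
  have ucont: "uniformly_continuous_on {-(b+1)..b+1} q'"
    by (intro compact_uniformly_continuous continuous_on_subset[OF cont]) auto
  obtain c2 where c2: "\<And>t. t \<in> {-(b+1)..b+1} \<Longrightarrow> \<bar>q t\<bar> \<le> c2"
    using continuous_interval_bound[OF DERIV_continuous_UNIV[OF der]] by metis
  show "approx (\<lambda>m z. q (F m z)) (\<lambda>m z. q' (F m z) *\<^sub>R F' m z)"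
    unfolding approx_def
  proof (intro conjI allI impI)
    show "has_zderiv (\<lambda>m z. q (F m z)) (\<lambda>m z. q' (F m z) *\<^sub>R F' m z) Z"
      by (rule has_zderiv_comp_real[OF approx_zderiv[OF F] der])
    show "\<exists>b. \<forall>m. \<forall>z\<in>Z. \<bar>q (F m z)\<bar> \<le> b \<and> norm (q' (F m z) *\<^sub>R F' m z) \<le> b"
    proof (intro exI[of _ "max c2 (c * b)"] allI ballI conjI)
      fix m z assume z: "z \<in> Z"
      have Fr: "F m z \<in> {-(b+1)..b+1}" using b(1)[OF z, of m] by auto
      show "\<bar>q (F m z)\<bar> \<le> max c2 (c * b)" using c2[OF Fr] by auto
      have "norm (q' (F m z) *\<^sub>R F' m z) \<le> c * b"
        unfolding norm_scaleR using c[OF Fr] b(2)[OF z, of m] c0 by (intro mult_mono) auto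
      thus "norm (q' (F m z) *\<^sub>R F' m z) \<le> max c2 (c * b)" by simp
    qed
    fix e :: real assume e: "e > 0"
    obtain d where d: "d > 0" "\<And>x y. x \<in> {-(b+1)..b+1} \<Longrightarrow> y \<in> {-(b+1)..b+1} \<Longrightarrow> \<bar>x - y\<bar> < d \<Longrightarrow> \<bar>q' x - q' y\<bar> < e / (2 * b)"
    proof -
      have "e / (2 * b) > 0" using e b0 by simp
      with ucont obtain d where "d > 0" "\<forall>x\<in>{-(b+1)..b+1}. \<forall>x'\<in>{-(b+1)..b+1}. dist x' x < d \<longrightarrow> dist (q' x') (q' x) < e / (2 * b)"
        unfolding uniformly_continuous_on_def by blast
      thus ?thesis using that unfolding dist_real_def by blast
    qed
    \<comment> \<open>The bound 1 keeps the approximant in the widened interval,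
      \<open>d / 2\<close> serves the modulus of continuity of \<open>q'\<close>, and the last term
      gives \<open>c * r \<le> e / 2\<close>.\<close>
    define r where "r = min (min 1 (d / 2)) (e / (2 * (c + 1)))"
    have r: "r > 0" "r \<le> 1" "r < d" using d e c0 by (auto simp: r_def)
    have "r \<le> e / (2 * (c + 1))" by (simp add: r_def)
    hence "(c + 1) * r \<le> e / 2" using c0 by (simp add: field_simps)
    hence rc: "c * r \<le> e / 2" using r(1) by (simp add: algebra_simps)
    from F r obtain s s' where s: "s \<in> S" "has_zderiv (curry s) s' Z" "C1z_near r Z F F' (curry s) s'"
      unfolding approx_def by blast
    show "\<exists>s\<in>S. \<exists>s'. has_zderiv (curry s) s' Z \<and>
      C1z_near e Z (\<lambda>m z. q (F m z)) (\<lambda>m z. q' (F m z) *\<^sub>R F' m z) (curry s) s'"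
    proof (intro bexI[of _ "\<lambda>x. q (s x)"] q s(1) exI[of _ "\<lambda>m z. q' (s (m, z)) *\<^sub>R s' m z"] conjI)
      show "has_zderiv (curry (\<lambda>x. q (s x))) (\<lambda>m z. q' (s (m, z)) *\<^sub>R s' m z) Z"
        using has_zderiv_comp_real[OF s(2) der] by (simp add: curry_def)
      show "C1z_near e Z (\<lambda>m z. q (F m z)) (\<lambda>m z. q' (F m z) *\<^sub>R F' m z) (curry (\<lambda>x. q (s x))) (\<lambda>m z. q' (s (m, z)) *\<^sub>R s' m z)"
        unfolding C1z_near_def curry_def
      proof (intro allI ballI conjI)
        fix m z assume z: "z \<in> Z"
        have Fr: "F m z \<in> {-(b+1)..b+1}" using b(1)[OF z, of m] by auto
        have Fs: "\<bar>F m z - s (m, z)\<bar> \<le> r" and Fs': "norm (F' m z - s' m z) \<le> r"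
          using s(3) z by (auto simp: C1z_near_def)
        have sr: "s (m, z) \<in> {-(b+1)..b+1}" using b(1)[OF z, of m] Fs r by auto
        have "norm (q (F m z) - q (s (m, z))) \<le> c * r"
          using order_trans[OF lip[OF Fr sr] mult_left_mono[OF Fs c0]] by simp
        thus "norm (q (F m z) - q (s (m, z))) \<le> e" using rc e by linarith
        have "norm (q' (F m z) *\<^sub>R F' m z - q' (s (m, z)) *\<^sub>R s' m z) =
              norm ((q' (F m z) - q' (s (m, z))) *\<^sub>R F' m z + q' (s (m, z)) *\<^sub>R (F' m z - s' m z))"
          by (simp add: algebra_simps)
        also have "\<dots> \<le> e / (2 * b) * b + c * r"
        proof (intro norm_triangle_mono)
          show "norm ((q' (F m z) - q' (s (m, z))) *\<^sub>R F' m z) \<le> e / (2 * b) * b"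
            unfolding norm_scaleR using d(2)[OF Fr sr] Fs r b(2)[OF z, of m] e b0
            by (intro mult_mono) auto
          show "norm (q' (s (m, z)) *\<^sub>R (F' m z - s' m z)) \<le> c * r"
            unfolding norm_scaleR using c[OF sr] Fs' c0 by (intro mult_mono) auto
        qed
        also have "\<dots> \<le> e" using rc b0 by simp
        finally show "norm (q' (F m z) *\<^sub>R F' m z - q' (s (m, z)) *\<^sub>R s' m z) \<le> e" .
      qed
    qed
  qed
qed

text \<open>Convergence with derivatives on bounded intervals is enough, because approximable
  functions have bounded range.\<close>

lemma approx_op_limit:
  assumes der: "\<And>t. (q has_real_derivative q' t) (at t)" and cont: "continuous_on UNIV q'"
    and lim: "\<And>b e. b > 0 \<Longrightarrow> e > 0 \<Longrightarrow>
       \<exists>p p'. approx_op p p' \<and> (\<forall>t. \<bar>t\<bar> \<le> b \<longrightarrow> \<bar>q t - p t\<bar> \<le> e \<and> \<bar>q' t - p' t\<bar> \<le> e)"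
  shows "approx_op q q'"
  unfolding approx_op_def
proof (intro allI impI)
  fix F F' assume F: "approx F F'"
  obtain b where b0: "b > 0" and b: "\<And>m z. z \<in> Z \<Longrightarrow> \<bar>F m z\<bar> \<le> b" "\<And>m z. z \<in> Z \<Longrightarrow> norm (F' m z) \<le> b"
    using approx_bound[OF F] by metis
  obtain c where c0: "c \<ge> 0" and c: "\<And>t. t \<in> {-b..b} \<Longrightarrow> \<bar>q' t\<bar> \<le> c"
    using continuous_interval_bound[OF cont] by metis
  obtain c2 where c2: "\<And>t. t \<in> {-b..b} \<Longrightarrow> \<bar>q t\<bar> \<le> c2"
    using continuous_interval_bound[OF DERIV_continuous_UNIV[OF der]] by metis
  show "approx (\<lambda>m z. q (F m z)) (\<lambda>m z. q' (F m z) *\<^sub>R F' m z)"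
  proof (rule approx_limit[where b = "max c2 (c * b)"])
    show "has_zderiv (\<lambda>m z. q (F m z)) (\<lambda>m z. q' (F m z) *\<^sub>R F' m z) Z"
      by (rule has_zderiv_comp_real[OF approx_zderiv[OF F] der])
  next
    fix m z assume z: "z \<in> Z"
    have Fr: "F m z \<in> {-b..b}" using b(1)[OF z, of m] by auto
    show "\<bar>q (F m z)\<bar> \<le> max c2 (c * b)" using c2[OF Fr] by auto
    have "norm (q' (F m z) *\<^sub>R F' m z) \<le> c * b"
      unfolding norm_scaleR using c[OF Fr] b(2)[OF z, of m] c0 by (intro mult_mono) auto
    thus "norm (q' (F m z) *\<^sub>R F' m z) \<le> max c2 (c * b)" by simp
  next
    fix e :: real assume "e > 0"
    \<comment> \<open>\<open>e / b\<close> absorbs the factor \<open>F'\<close>, of norm at most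
      \<open>b\<close>, in the derivative.\<close>
    define r where "r = min e (e / b)"
    have r: "r > 0" "r \<le> e" "r * b \<le> e"
      using b0 \<open>e > 0\<close> by (auto simp: r_def min_def field_simps)
    from lim[OF b0 r(1)] obtain p p' where p: "approx_op p p'"
      "\<And>t. \<bar>t\<bar> \<le> b \<Longrightarrow> \<bar>q t - p t\<bar> \<le> r \<and> \<bar>q' t - p' t\<bar> \<le> r" by blast
    show "\<exists>G G'. approx G G' \<and> C1z_near e Z (\<lambda>m z. q (F m z)) (\<lambda>m z. q' (F m z) *\<^sub>R F' m z) G G'"
    proof (intro exI conjI)
      show "approx (\<lambda>m z. p (F m z)) (\<lambda>m z. p' (F m z) *\<^sub>R F' m z)"
        by (rule approx_opD[OF p(1) F])
      show "C1z_near e Z (\<lambda>m z. q (F m z)) (\<lambda>m z. q' (F m z) *\<^sub>R F' m z)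
          (\<lambda>m z. p (F m z)) (\<lambda>m z. p' (F m z) *\<^sub>R F' m z)"
        unfolding C1z_near_def
      proof (intro allI ballI conjI)
        fix m z assume z: "z \<in> Z"
        show "norm (q (F m z) - p (F m z)) \<le> e"
          using p(2)[OF b(1)[OF z, of m]] r by simp
        have "norm ((q' (F m z) - p' (F m z)) *\<^sub>R F' m z) \<le> r * b"
          unfolding norm_scaleR using p(2)[OF b(1)[OF z, of m]] b(2)[OF z, of m] r
          by (intro mult_mono) auto
        thus "norm (q' (F m z) *\<^sub>R F' m z - p' (F m z) *\<^sub>R F' m z) \<le> e"
          using r by (simp add: scaleR_left_diff_distrib)
      qed
    qed
  qed
qed

lemma approx_op_gelu: "approx_op gelu dgelu"
  by (rule approx_op_of_S[OF S_gelu gelu_deriv continuous_dgelu])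

lemma approx_op_scale: "approx_op (\<lambda>t. c * t) (\<lambda>t. c)"
  by (rule approx_op_of_S) (auto intro: S_scale intro!: derivative_eq_intros)

lemma approx_op_const: "approx_op (\<lambda>t. c) (\<lambda>t. 0)"
  using approx_const by (simp add: approx_op_def)

lemma approx_op_add: "approx_op p p' \<Longrightarrow> approx_op q q' \<Longrightarrow> approx_op (\<lambda>t. p t + q t) (\<lambda>t. p' t + q' t)"
  unfolding approx_op_def scaleR_left_distrib by (intro allI impI approx_add) simp_all

lemma approx_op_comp:
  assumes "approx_op p p'" "approx_op q q'"
  shows "approx_op (\<lambda>t. p (q t)) (\<lambda>t. p' (q t) * q' t)"
  unfolding approx_op_def
proof (intro allI impI)
  fix F F' assume "approx F F'"
  from approx_opD[OF assms(1) approx_opD[OF assms(2) this]]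
  show "approx (\<lambda>m z. p (q (F m z))) (\<lambda>m z. (p' (q (F m z)) * q' (F m z)) *\<^sub>R F' m z)" by simp
qed

text \<open>\<open>t\<^sup>2\<close> is the limit as \<open>h \<rightarrow> 0\<close> of
  \<open>(gelu (h t) + gelu (- h t)) / (2 h\<^sup>2 c) = t (2 Gcdf (h t) - 1) / (2 h c)\<close>, where \<open>c\<close> is the
  Gaussian density at \<open>0\<close>.\<close>

lemma approx_op_square: "approx_op (\<lambda>t. t\<^sup>2) (\<lambda>t. 2 * t)"
proof (rule approx_op_limit)
  show "((\<lambda>t. t\<^sup>2) has_real_derivative 2 * t) (at t)" for t :: real
    by (auto intro!: derivative_eq_intros)
  show "continuous_on UNIV (\<lambda>t::real. 2 * t)" by (intro continuous_intros)
next
  fix b e :: real assume b: "b > 0" and e: "e > 0"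
  define c where "c = std_normal_density 0"
  have c: "c > 0" by (simp add: c_def normal_density_def)
  \<comment> \<open>The errors below are at most \<open>r * b^2 / c\<close> in the values and
    \<open>2 * r * b / c\<close> in the derivatives.\<close>
  define r where "r = min (e * c / (2 * b)) (e * c / (2 * b\<^sup>2))"
  have r: "r > 0" "r * b / c \<le> e / 2" "r * b\<^sup>2 / c \<le> e"
  proof -
    show "r > 0" using b c e by (simp add: r_def)
    have "r * b \<le> e * c / (2 * b) * b" using b by (intro mult_right_mono) (auto simp: r_def)
    thus "r * b / c \<le> e / 2" using b c by (simp add: field_simps)
    have "r * b\<^sup>2 \<le> e * c / (2 * b\<^sup>2) * b\<^sup>2" by (intro mult_right_mono) (auto simp: r_def)
    also have "\<dots> \<le> e * c" using b c e by simp
    finally show "r * b\<^sup>2 / c \<le> e" using c by (simp add: field_simps)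
  qed
  obtain d1 where d1: "d1 > 0" "\<And>y. \<bar>y\<bar> < d1 \<Longrightarrow> \<bar>Gcdf y - 1 / 2 - c * y\<bar> \<le> r * \<bar>y\<bar>"
    using Gcdf_deriv[of 0] r(1) unfolding has_field_derivative_def has_derivative_at_alt c_def Gcdf_0
    by (metis diff_0_right real_norm_def)
  have "isCont std_normal_density 0"
    using continuous_std_normal_density[of UNIV] by (simp add: continuous_on_eq_continuous_at)
  then obtain d2 where d2: "d2 > 0" "\<And>y. \<bar>y\<bar> < d2 \<Longrightarrow> \<bar>std_normal_density y - c\<bar> < r"
    using r(1) unfolding continuous_at_eps_delta c_def dist_real_def by (metis diff_0_right)
  \<comment> \<open>All arguments \<open>h * t\<close> with \<open>\<bar>t\<bar> \<le> b\<close>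
    then lie where both estimates near 0 hold.\<close>
  define h where "h = min d1 d2 / (2 * b)"
  have h: "h > 0" using d1 d2 b by (simp add: h_def)
  have hb: "\<bar>h * t\<bar> < d1" "\<bar>h * t\<bar> < d2" if "\<bar>t\<bar> \<le> b" for t
  proof -
    have "\<bar>h * t\<bar> \<le> h * b" unfolding abs_mult using h that by (intro mult_mono) auto
    also have "\<dots> = min d1 d2 / 2" using b by (simp add: h_def)
    finally show "\<bar>h * t\<bar> < d1" "\<bar>h * t\<bar> < d2" using d1 d2 by (auto simp: min_def split: if_splits)
  qed
  define p where "p = (\<lambda>t. 1 / (2 * h\<^sup>2 * c) * (gelu (h * t) + gelu (- h * t)))"
  define p' where "p' = (\<lambda>t. 1 / (2 * h\<^sup>2 * c) * (dgelu (h * t) * h + dgelu (- h * t) * (- h)))"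
  have "approx_op p p'"
    unfolding p_def p'_def
    by (rule approx_op_comp[OF approx_op_scale approx_op_add[OF
            approx_op_comp[OF approx_op_gelu approx_op_scale]
            approx_op_comp[OF approx_op_gelu approx_op_scale]]])
  moreover have "\<bar>t\<^sup>2 - p t\<bar> \<le> e \<and> \<bar>2 * t - p' t\<bar> \<le> e" if t: "\<bar>t\<bar> \<le> b" for t
  proof -
    \<comment> \<open>\<open>D\<close> is the first-order Taylor remainder of \<open>Gcdf\<close> at
      0; it is small relative to \<open>h * \<bar>t\<bar>\<close>, which compensates the division by
      \<open>h\<close> in \<open>p\<close> and \<open>p'\<close>. \<open>E\<close> is the
      oscillation of the density.\<close>
    define D where "D = Gcdf (h * t) - 1 / 2 - c * (h * t)"
    define E where "E = std_normal_density (h * t) - c"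
    have D: "\<bar>D\<bar> \<le> r * (h * \<bar>t\<bar>)" using d1(2)[OF hb(1)[OF t]] h by (simp add: D_def abs_mult)
    have E: "\<bar>E\<bar> \<le> r" using d2(2)[OF hb(2)[OF t]] by (simp add: E_def)
    have pt: "p t = t\<^sup>2 + t * D / (h * c)"
    proof -
      have "gelu (h * t) + gelu (- h * t) = h * t * (2 * D + 2 * (c * (h * t)))"
        unfolding gelu_def D_def mult_minus_left Gcdf_uminus by (simp add: algebra_simps)
      thus ?thesis unfolding p_def using h c by (simp add: field_simps power2_eq_square)
    qed
    have p't: "p' t = 2 * t + D / (h * c) + t * E / c"
    proof -
      have "dgelu (h * t) * h + dgelu (- h * t) * (- h) = h * (2 * D + 2 * (c * (h * t)) + 2 * (h * t) * (E + c))"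
        unfolding dgelu_def D_def E_def mult_minus_left Gcdf_uminus
        by (simp add: normal_density_def algebra_simps)
      thus ?thesis unfolding p'_def using h c by (simp add: field_simps power2_eq_square)
    qed
    have DD: "\<bar>D\<bar> / h \<le> r * b"
    proof -
      have "\<bar>D\<bar> \<le> r * (h * b)" using D t h r(1)
        by (elim order_trans) (intro mult_left_mono, auto)
      thus ?thesis using h by (simp add: field_simps)
    qed
    have "\<bar>t\<^sup>2 - p t\<bar> = \<bar>t\<bar> * (\<bar>D\<bar> / h) / c"
      unfolding pt using h c by (simp add: abs_mult)
    also have "\<dots> \<le> b * (r * b) / c"
      using DD t h c b by (intro divide_right_mono mult_mono) auto
    also have "\<dots> \<le> e" using r(3) by (simp add: power2_eq_square algebra_simps)
    finally have 1: "\<bar>t\<^sup>2 - p t\<bar> \<le> e" .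
    have "\<bar>2 * t - p' t\<bar> = \<bar>D / (h * c) + t * E / c\<bar>"
      unfolding p't by (subst abs_minus_commute) simp
    also have "\<dots> \<le> \<bar>D / (h * c)\<bar> + \<bar>t * E / c\<bar>" by (rule abs_triangle_ineq)
    also have "\<bar>D / (h * c)\<bar> = (\<bar>D\<bar> / h) / c" using h c by (simp add: abs_mult)
    also have "\<bar>t * E / c\<bar> = \<bar>t\<bar> * \<bar>E\<bar> / c" using c by (simp add: abs_mult)
    also have "(\<bar>D\<bar> / h) / c + \<bar>t\<bar> * \<bar>E\<bar> / c \<le> r * b / c + b * r / c"
      using DD t E c b r(1) by (intro add_mono divide_right_mono mult_mono) auto
    also have "\<dots> \<le> e" using r(2) by (simp add: mult.commute)
    finally show ?thesis using 1 by blast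
  qed
  ultimately show "\<exists>p p'. approx_op p p' \<and> (\<forall>t. \<bar>t\<bar> \<le> b \<longrightarrow> \<bar>t\<^sup>2 - p t\<bar> \<le> e \<and> \<bar>2 * t - p' t\<bar> \<le> e)"
    by blast
qed

lemma approx_scale: "approx F F' \<Longrightarrow> approx (\<lambda>m z. c * F m z) (\<lambda>m z. c *\<^sub>R F' m z)"
  using approx_opD[OF approx_op_scale] .

text \<open>Polarisation: the product is a quarter of the difference of two squares.\<close>

lemma approx_mult:
  assumes F: "approx F F'" and G: "approx G G'"
  shows "approx (\<lambda>m z. F m z * G m z) (\<lambda>m z. F m z *\<^sub>R G' m z + G m z *\<^sub>R F' m z)"
proof -
  have "approx (\<lambda>m z. (1/4) * ((F m z + G m z)\<^sup>2 + (- 1) * (F m z + (- 1) * G m z)\<^sup>2))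
     (\<lambda>m z. (1/4) *\<^sub>R ((2 * (F m z + G m z)) *\<^sub>R (F' m z + G' m z) +
       (- 1) *\<^sub>R ((2 * (F m z + (- 1) * G m z)) *\<^sub>R (F' m z + (- 1) *\<^sub>R G' m z))))"
    by (intro approx_scale approx_add approx_opD[OF approx_op_square] F G)
  moreover have "(1/4) * ((F m z + G m z)\<^sup>2 + (- 1) * (F m z + (- 1) * G m z)\<^sup>2) = F m z * G m z" for m z
    by (simp add: power2_eq_square algebra_simps)
  moreover have "(1/4) *\<^sub>R ((2 * (F m z + G m z)) *\<^sub>R (F' m z + G' m z) +
       (- 1) *\<^sub>R ((2 * (F m z + (- 1) * G m z)) *\<^sub>R (F' m z + (- 1) *\<^sub>R G' m z))) =
       F m z *\<^sub>R G' m z + G m z *\<^sub>R F' m z" for m z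
    by (rule blinfun_eqI)
       (simp add: scaleR_blinfun.rep_eq plus_blinfun.rep_eq uminus_blinfun.rep_eq algebra_simps)
  ultimately show ?thesis by simp
qed

lemma approx_op_mult:
  "approx_op p p' \<Longrightarrow> approx_op q q' \<Longrightarrow> approx_op (\<lambda>t. p t * q t) (\<lambda>t. p t * q' t + q t * p' t)"
  unfolding approx_op_def
proof (intro allI impI)
  fix F F'
  assume p: "\<forall>F F'. approx F F' \<longrightarrow> approx (\<lambda>m z. p (F m z)) (\<lambda>m z. p' (F m z) *\<^sub>R F' m z)"
    and q: "\<forall>F F'. approx F F' \<longrightarrow> approx (\<lambda>m z. q (F m z)) (\<lambda>m z. q' (F m z) *\<^sub>R F' m z)"
    and F: "approx F F'"
  from approx_mult[OF p[rule_format, OF F] q[rule_format, OF F]]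
  show "approx (\<lambda>m z. p (F m z) * q (F m z)) (\<lambda>m z. (p (F m z) * q' (F m z) + q (F m z) * p' (F m z)) *\<^sub>R F' m z)"
    by (simp add: scaleR_left_distrib)
qed

text \<open>\<open>(max 0 t)\<^sup>2\<close> is the limit as \<open>k \<rightarrow> \<infinity>\<close> of \<open>t gelu (k t) / k\<close>.\<close>

lemma approx_op_relu_square: "approx_op (\<lambda>t. (max 0 t)\<^sup>2) (\<lambda>t. 2 * max 0 t)"
proof (rule approx_op_limit[OF relu_square_deriv])
  show "continuous_on UNIV (\<lambda>t::real. 2 * max 0 t)" by (intro continuous_intros)
next
  fix b e :: real assume b: "b > 0" and e: "e > 0"
  \<comment> \<open>Values will be within \<open>b / k\<close> and derivatives within
    \<open>4 / k\<close>.\<close>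
  define k where "k = max (b / e) (4 / e)"
  have k: "k > 0" "b / k \<le> e" "4 / k \<le> e"
  proof -
    show k0: "k > 0" using b e by (simp add: k_def less_max_iff_disj)
    have "b / e \<le> k" "4 / e \<le> k" by (auto simp: k_def)
    thus "b / k \<le> e" "4 / k \<le> e" using k0 e by (auto simp: field_simps)
  qed
  \<comment> \<open>The identity is written \<open>1 * t\<close> to be an instance of
    \<open>approx_op_scale\<close>.\<close>
  define p where "p = (\<lambda>t. 1 / k * ((1 * t) * gelu (k * t)))"
  define p' where "p' = (\<lambda>t. 1 / k * ((1 * t) * (dgelu (k * t) * k) + gelu (k * t) * 1))"
  have "approx_op p p'"
    unfolding p_def p'_def
    by (rule approx_op_comp[OF approx_op_scale approx_op_mult[OF approx_op_scale
            approx_op_comp[OF approx_op_gelu approx_op_scale]]])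
  moreover have "\<bar>(max 0 t)\<^sup>2 - p t\<bar> \<le> e \<and> \<bar>2 * max 0 t - p' t\<bar> \<le> e" if t: "\<bar>t\<bar> \<le> b" for t
  proof -
    \<comment> \<open>\<open>D\<close> and \<open>E\<close> are bounded uniformly in
      \<open>k\<close> and \<open>t\<close>, also near the kink; hence both errors are of order
      \<open>1 / k\<close>. The term \<open>E\<close> comes from the density part of
      \<open>dgelu\<close>.\<close>
    define D where "D = gelu (k * t) - max 0 (k * t)"
    define E where "E = (k * t)\<^sup>2 * std_normal_density (k * t)"
    have D: "\<bar>D\<bar> \<le> 1" unfolding D_def by (rule gelu_relu)
    have E: "0 \<le> E" "E \<le> 2" unfolding E_def
      by (simp_all add: sq_mult_std_normal_density)
    have mk: "max 0 (k * t) = k * max 0 t" using k(1) by (auto simp: max_def zero_le_mult_iff)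
    have mt: "t * max 0 t = (max 0 t)\<^sup>2" by (auto simp: max_def power2_eq_square)
    have pt: "p t = (max 0 t)\<^sup>2 + t * D / k"
      unfolding p_def mt[symmetric] using k(1) by (simp add: D_def mk field_simps)
    have gk: "gelu (k * t) = D + k * max 0 t" by (simp add: D_def mk)
    have gk': "k * t * dgelu (k * t) = D + k * max 0 t + E"
      unfolding gk[symmetric] by (simp add: dgelu_def gelu_def E_def power2_eq_square algebra_simps)
    have "p' t = 1 / k * (k * t * dgelu (k * t) + gelu (k * t))"
      by (simp add: p'_def algebra_simps)
    also have "\<dots> = 2 * max 0 t + (2 * D + E) / k"
      unfolding gk' gk using k(1) by (simp add: field_simps)
    finally have p't: "p' t = 2 * max 0 t + (2 * D + E) / k" .
    have "\<bar>(max 0 t)\<^sup>2 - p t\<bar> = \<bar>t\<bar> * \<bar>D\<bar> / k" unfolding pt using k(1) by (simp add: abs_mult)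
    also have "\<dots> \<le> b * 1 / k" using t D k(1) b by (intro divide_right_mono mult_mono) auto
    finally have 1: "\<bar>(max 0 t)\<^sup>2 - p t\<bar> \<le> e" using k(2) by simp
    have "\<bar>2 * max 0 t - p' t\<bar> = \<bar>2 * D + E\<bar> / k" unfolding p't using k(1) by simp
    also have "\<dots> \<le> 4 / k" using D E k(1) by (intro divide_right_mono) auto
    finally show ?thesis using 1 k(3) by linarith
  qed
  ultimately show "\<exists>p p'. approx_op p p' \<and>
      (\<forall>t. \<bar>t\<bar> \<le> b \<longrightarrow> \<bar>(max 0 t)\<^sup>2 - p t\<bar> \<le> e \<and> \<bar>2 * max 0 t - p' t\<bar> \<le> e)"
    by blast
qed

end

section \<open>Partitions of unity and vector-valued functions\<close>

text \<open>The rank-one operator that arises as the derivative of a scalar function with derivative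
  \<open>a\<close> multiplied by the fixed vector \<open>v\<close>.\<close>

definition tens :: "('z::real_normed_vector \<Rightarrow>\<^sub>L real) \<Rightarrow> 'u::real_normed_vector \<Rightarrow> 'z \<Rightarrow>\<^sub>L 'u" where
  "tens a v = blinfun_scaleR_left v o\<^sub>L a"

lemma tens_apply [simp]: "blinfun_apply (tens a v) x = a x *\<^sub>R v"
  by (simp add: tens_def)

lemma tens_0 [simp]: "tens 0 v = 0"
  by (rule blinfun_eqI) simp

lemma norm_tens: "norm (tens a v) \<le> norm a * norm v"
proof (rule norm_blinfun_bound)
  fix x
  have "\<bar>a x\<bar> * norm v \<le> (norm a * norm x) * norm v"
    using norm_blinfun[of a x] by (intro mult_right_mono) auto
  thus "norm (tens a v x) \<le> norm a * norm v * norm x" by (simp add: algebra_simps)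
qed simp

lemma tens_diff_left: "tens a v - tens b v = tens (a - b) v"
  and tens_diff_right: "tens a v - tens a w = tens a (v - w)"
  and tens_add_left: "tens (a + b) v = tens a v + tens b v"
  and tens_scaleR_left: "tens (c *\<^sub>R a) v = c *\<^sub>R tens a v"
  by (auto intro!: blinfun_eqI simp: blinfun.bilinear_simps algebra_simps)

text \<open>The C^1 quadratic spline rising from 0 to 1 on the unit interval, with knots 0, 1/2 and
  1; its derivative is the hat function of height 2. It is written in truncated squares, which are
  known to be approximable.\<close>

definition smoothstep :: "real \<Rightarrow> real" where
  "smoothstep t = 2 * (max 0 t)\<^sup>2 + ((-4) * (max 0 (t + - (1/2)))\<^sup>2 + 2 * (max 0 (t + -1))\<^sup>2)"

definition dsmoothstep :: "real \<Rightarrow> real" where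
  "dsmoothstep t = 4 * max 0 t + ((-8) * max 0 (t + - (1/2)) + 4 * max 0 (t + -1))"

lemma smoothstep_le_0: "t \<le> 0 \<Longrightarrow> smoothstep t = 0" "t \<le> 0 \<Longrightarrow> dsmoothstep t = 0"
  by (auto simp: smoothstep_def dsmoothstep_def max_def)

lemma smoothstep_ge_1: "1 \<le> t \<Longrightarrow> smoothstep t = 1" "1 \<le> t \<Longrightarrow> dsmoothstep t = 0"
  by (auto simp: smoothstep_def dsmoothstep_def max_def power2_eq_square algebra_simps)

lemma dsmoothstep_bounds: "0 \<le> dsmoothstep t" "dsmoothstep t \<le> 2"
  by (auto simp: dsmoothstep_def max_def)

text \<open>The difference of two consecutive steps, centred at the node \<open>i - n\<close> and
  vanishing from distance 1 on. The indices \<open>i\<close> up to \<open>2 * n\<close> give the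
  integer nodes from \<open>-n\<close> to \<open>n\<close>.\<close>

definition bump :: "nat \<Rightarrow> nat \<Rightarrow> real \<Rightarrow> real" where
  "bump n i t = smoothstep (t + (real n + 1 - real i)) + (-1) * smoothstep (t + (real n - real i))"

definition dbump :: "nat \<Rightarrow> nat \<Rightarrow> real \<Rightarrow> real" where
  "dbump n i t = dsmoothstep (t + (real n + 1 - real i)) + (-1) * dsmoothstep (t + (real n - real i))"

lemma bump_support: "1 \<le> \<bar>t + real n - real i\<bar> \<Longrightarrow> bump n i t = 0 \<and> dbump n i t = 0"
proof -
  assume "1 \<le> \<bar>t + real n - real i\<bar>"
  then consider "t + (real n - real i) \<le> 0" "t + (real n + 1 - real i) \<le> 0"
    | "1 \<le> t + (real n - real i)" "1 \<le> t + (real n + 1 - real i)" by linarith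
  thus ?thesis
    unfolding bump_def dbump_def by cases (simp_all only: smoothstep_le_0 smoothstep_ge_1, simp_all)
qed

lemma telescope_down:
  fixes f :: "real \<Rightarrow> real"
  shows "(\<Sum>i<M. f (x + 1 - real i) + (-1) * f (x - real i)) = f (x + 1) - f (x + 1 - real M)"
  by (induction M) (simp_all add: algebra_simps)

text \<open>Telescoping leaves two steps, and \<open>\<bar>t\<bar> \<le> n\<close> puts the first
  where the step is constantly 1 and the last where it is constantly 0.\<close>

lemma bump_sum: assumes "\<bar>t\<bar> \<le> real n"
  shows "(\<Sum>i<2*n+1. bump n i t) = 1" "(\<Sum>i<2*n+1. dbump n i t) = 0"
proof -
  have 1: "(\<Sum>i<2*n+1. bump n i t) = smoothstep (t + n + 1) - smoothstep (t + n + 1 - real (2*n+1))"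
    unfolding bump_def using telescope_down[of smoothstep "t + n" "2*n+1"] by (simp add: algebra_simps)
  have 2: "(\<Sum>i<2*n+1. dbump n i t) = dsmoothstep (t + n + 1) - dsmoothstep (t + n + 1 - real (2*n+1))"
    unfolding dbump_def using telescope_down[of dsmoothstep "t + n" "2*n+1"] by (simp add: algebra_simps)
  have "1 \<le> t + n + 1" "t + n + 1 - real (2*n+1) \<le> 0" using assms by auto
  thus "(\<Sum>i<2*n+1. bump n i t) = 1" "(\<Sum>i<2*n+1. dbump n i t) = 0"
    unfolding 1 2 by (simp_all only: smoothstep_le_0 smoothstep_ge_1)
qed

text \<open>Hats at different integer shifts are nowhere nonzero together, so at most one term
  survives. The bound thus does not depend on the number of cells.\<close>

lemma dsmoothstep_sum: "(\<Sum>i<M. dsmoothstep (x - real i)) \<le> 2"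
proof (cases "\<exists>i0<M. dsmoothstep (x - real i0) \<noteq> 0")
  case True
  then obtain i0 where i0: "i0 < M" "dsmoothstep (x - real i0) \<noteq> 0" by blast
  hence r: "0 < x - real i0" "x - real i0 < 1"
    using smoothstep_le_0(2)[of "x - real i0"] smoothstep_ge_1(2)[of "x - real i0"] by fastforce+
  have "dsmoothstep (x - real i) = 0" if "i \<noteq> i0" for i
  proof (cases "i < i0")
    case True
    hence "real i + 1 \<le> real i0" by linarith
    thus ?thesis using r by (intro smoothstep_ge_1) linarith
  next
    case False
    hence "real i0 + 1 \<le> real i" using that by linarith
    thus ?thesis using r by (intro smoothstep_le_0) linarith
  qed
  hence "(\<Sum>i<M. dsmoothstep (x - real i)) = (\<Sum>i\<in>{i0}. dsmoothstep (x - real i))"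
    using i0 by (intro sum.mono_neutral_right) auto
  thus ?thesis using dsmoothstep_bounds by simp
next
  case False
  hence "(\<Sum>i<M. dsmoothstep (x - real i)) = 0" by (intro sum.neutral) blast
  thus ?thesis by simp
qed

text \<open>Each bump is a difference of two steps, and either family of hats contributes at most 2.
  This is the source of the constant 4 in the gluing.\<close>

lemma dbump_sum_abs: "(\<Sum>i<M. \<bar>dbump n i t\<bar>) \<le> 4"
proof -
  have "(\<Sum>i<M. \<bar>dbump n i t\<bar>) \<le>
      (\<Sum>i<M. dsmoothstep ((t + n + 1) - real i) + dsmoothstep ((t + n) - real i))"
  proof (rule sum_mono)
    fix i
    show "\<bar>dbump n i t\<bar> \<le> dsmoothstep ((t + n + 1) - real i) + dsmoothstep ((t + n) - real i)"
      using dsmoothstep_bounds(1)[of "(t + n + 1) - real i"] dsmoothstep_bounds(1)[of "(t + n) - real i"]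
      by (simp add: dbump_def algebra_simps)
  qed
  also have "\<dots> \<le> 2 + 2"
    unfolding sum.distrib by (intro add_mono dsmoothstep_sum)
  finally show ?thesis by simp
qed

context zapprox
begin

lemma approx_op_shift: "approx_op (\<lambda>t. t + c) (\<lambda>t. 1)"
  using approx_op_add[OF approx_op_scale[of 1] approx_op_const[of c]] by simp

lemma approx_op_smoothstep: "approx_op smoothstep dsmoothstep"
proof -
  have shifted: "approx_op (\<lambda>t. a * (max 0 (t + c))\<^sup>2) (\<lambda>t. a * (2 * max 0 (t + c) * 1))" for a c
    by (rule approx_op_comp[OF approx_op_scale approx_op_comp[OF approx_op_relu_square approx_op_shift]])
  from approx_op_add[OF shifted[of 2 0] approx_op_add[OF shifted[of "-4" "-(1/2)"] shifted[of 2 "-1"]]]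
  show ?thesis unfolding smoothstep_def[abs_def] dsmoothstep_def[abs_def] by simp
qed

lemma approx_op_bump: "approx_op (bump n i) (dbump n i)"
proof -
  have shifted: "approx_op (\<lambda>t. a * smoothstep (t + c)) (\<lambda>t. a * (dsmoothstep (t + c) * 1))" for a c
    by (rule approx_op_comp[OF approx_op_scale approx_op_comp[OF approx_op_smoothstep approx_op_shift]])
  from approx_op_add[OF shifted[of 1 "real n + 1 - real i"] shifted[of "-1" "real n - real i"]]
  show ?thesis unfolding bump_def[abs_def] dbump_def[abs_def] by simp
qed

lemma approx_bump:
  assumes "approx F F'"
  shows "approx (\<lambda>m z. bump n i (F m z / h)) (\<lambda>m z. dbump n i (F m z / h) *\<^sub>R ((1 / h) *\<^sub>R F' m z))"
  using approx_opD[OF approx_op_bump approx_scale[OF assms, of "1 / h"]] by simp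

end

text \<open>For the nonnegativity of the bumps, which makes the gluing a convex combination.\<close>

lemma smoothstep_mono: assumes "x \<le> y" shows "smoothstep x \<le> smoothstep y"
proof -
  have sq: "((\<lambda>t::real. (max 0 (t + c))\<^sup>2) has_real_derivative 2 * max 0 (t + c)) (at t)" for c t
    by (rule DERIV_chain2[OF relu_square_deriv, THEN DERIV_cong]) (auto intro!: derivative_eq_intros)
  have der: "(smoothstep has_real_derivative dsmoothstep t) (at t)" for t
    unfolding smoothstep_def[abs_def] dsmoothstep_def
    by (rule derivative_eq_intros relu_square_deriv sq refl)+ simp
  show ?thesis
    by (rule DERIV_nonneg_imp_nondecreasing[OF assms]) (use der dsmoothstep_bounds(1) in blast)
qed

lemma bump_nonneg: "0 \<le> bump n i t"
  unfolding bump_def using smoothstep_mono[of "t + (real n - real i)" "t + (real n + 1 - real i)"] by simp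

lemma span_range_nat:
  fixes \<phi> :: "nat \<Rightarrow> 'a::real_vector"
  assumes "y \<in> span (range \<phi>)"
  shows "\<exists>k w. y = (\<Sum>i<k. w i *\<^sub>R \<phi> i)"
  using assms
proof (induction rule: span_induct_alt)
  case base
  show ?case by (rule exI[of _ 0]) simp
next
  case (step c x y)
  then obtain j k w where x: "x = \<phi> j" and y: "y = (\<Sum>i<k. w i *\<^sub>R \<phi> i)" by blast
  have "(\<Sum>i<max k (Suc j). ((if i < k then w i else 0) + (if i = j then c else 0)) *\<^sub>R \<phi> i)
      = (\<Sum>i<max k (Suc j). (if i < k then w i else 0) *\<^sub>R \<phi> i) + (\<Sum>i<max k (Suc j). (if i = j then c else 0) *\<^sub>R \<phi> i)"
    by (simp add: scaleR_left_distrib sum.distrib)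
  also have "(\<Sum>i<max k (Suc j). (if i < k then w i else 0) *\<^sub>R \<phi> i) = (\<Sum>i<k. w i *\<^sub>R \<phi> i)"
    by (auto intro!: sum.mono_neutral_cong_right split: if_splits)
  also have "(\<Sum>i<max k (Suc j). (if i = j then c else 0) *\<^sub>R \<phi> i) = (\<Sum>i\<in>{j}. c *\<^sub>R \<phi> i)"
    by (intro sum.mono_neutral_cong_right) (auto split: if_splits)
  finally have "c *\<^sub>R x + y = (\<Sum>i<max k (Suc j). ((if i < k then w i else 0) + (if i = j then c else 0)) *\<^sub>R \<phi> i)"
    unfolding x y by simp
  thus ?case by (intro exI)
qed

section \<open>Approximation of vector-valued maps in a dense span\<close>

locale zapprox_dense = zapprox S Z for S :: "('m \<times> 'z::euclidean_space \<Rightarrow> real) set" and Z +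
  fixes \<phi> :: "nat \<Rightarrow> 'u::real_normed_vector"
  assumes dense: "closure (span (range \<phi>)) = UNIV"
begin

text \<open>Finitely many vectors of the sequence are used and all dependence on \<open>m\<close>
  and \<open>z\<close> sits in scalar coefficients, which is the form of a decoded network.\<close>

definition vapprox :: "('m \<Rightarrow> 'z \<Rightarrow> 'u) \<Rightarrow> ('m \<Rightarrow> 'z \<Rightarrow> 'z \<Rightarrow>\<^sub>L 'u) \<Rightarrow> bool" where
  "vapprox F F' \<longleftrightarrow> (\<forall>e>0. \<exists>k a a'. (\<forall>i. approx (a i) (a' i)) \<and>
     C1z_near e Z F F' (\<lambda>m z. \<Sum>i<k. a i m z *\<^sub>R \<phi> i) (\<lambda>m z. \<Sum>i<k. tens (a' i m z) (\<phi> i)))"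

lemma vapprox_add:
  assumes F: "vapprox F F'" and G: "vapprox G G'"
  shows "vapprox (\<lambda>m z. F m z + G m z) (\<lambda>m z. F' m z + G' m z)"
  unfolding vapprox_def
proof (intro allI impI)
  fix e :: real assume "e > 0"
  hence e: "e / 2 > 0" by simp
  from F e obtain k a a' where a: "\<And>i. approx (a i) (a' i)" "C1z_near (e/2) Z F F' (\<lambda>m z. \<Sum>i<k. a i m z *\<^sub>R \<phi> i) (\<lambda>m z. \<Sum>i<k. tens (a' i m z) (\<phi> i))"
    unfolding vapprox_def by blast
  from G e obtain l b b' where b: "\<And>i. approx (b i) (b' i)" "C1z_near (e/2) Z G G' (\<lambda>m z. \<Sum>i<l. b i m z *\<^sub>R \<phi> i) (\<lambda>m z. \<Sum>i<l. tens (b' i m z) (\<phi> i))"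
    unfolding vapprox_def by blast
  define A where "A = (\<lambda>i. if i < k then a i else (\<lambda>m z. 0))"
  define A' where "A' = (\<lambda>i. if i < k then a' i else (\<lambda>m z. 0))"
  define D where "D = (\<lambda>i. if i < l then b i else (\<lambda>m z. 0))"
  define D' where "D' = (\<lambda>i. if i < l then b' i else (\<lambda>m z. 0))"
  have AD: "approx (\<lambda>m z. A i m z + D i m z) (\<lambda>m z. A' i m z + D' i m z)" for i
    using a(1) b(1) by (intro approx_add) (auto simp: A_def A'_def D_def D'_def approx_const)
  have 1: "(\<Sum>i<max k l. A i m z *\<^sub>R \<phi> i) = (\<Sum>i<k. a i m z *\<^sub>R \<phi> i)"
    and 2: "(\<Sum>i<max k l. D i m z *\<^sub>R \<phi> i) = (\<Sum>i<l. b i m z *\<^sub>R \<phi> i)" for m z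
    by (auto simp: A_def D_def intro!: sum.mono_neutral_cong_right split: if_splits)
  have 3: "(\<Sum>i<max k l. tens (A' i m z) (\<phi> i)) = (\<Sum>i<k. tens (a' i m z) (\<phi> i))"
    and 4: "(\<Sum>i<max k l. tens (D' i m z) (\<phi> i)) = (\<Sum>i<l. tens (b' i m z) (\<phi> i))" for m z
    by (auto simp: A'_def D'_def intro!: sum.mono_neutral_cong_right split: if_splits)
  show "\<exists>k a a'. (\<forall>i. approx (a i) (a' i)) \<and>
     C1z_near e Z (\<lambda>m z. F m z + G m z) (\<lambda>m z. F' m z + G' m z) (\<lambda>m z. \<Sum>i<k. a i m z *\<^sub>R \<phi> i) (\<lambda>m z. \<Sum>i<k. tens (a' i m z) (\<phi> i))"
  proof (intro exI[of _ "max k l"] exI[of _ "\<lambda>i m z. A i m z + D i m z"] exI[of _ "\<lambda>i m z. A' i m z + D' i m z"] conjI allI AD)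
    show "C1z_near e Z (\<lambda>m z. F m z + G m z) (\<lambda>m z. F' m z + G' m z)
       (\<lambda>m z. \<Sum>i<max k l. (A i m z + D i m z) *\<^sub>R \<phi> i) (\<lambda>m z. \<Sum>i<max k l. tens (A' i m z + D' i m z) (\<phi> i))"
      unfolding C1z_near_def scaleR_left_distrib tens_add_left sum.distrib 1 2 3 4 add_diff_add
    proof (intro allI ballI conjI)
      fix m z assume z: "z \<in> Z"
      have "norm (F m z - (\<Sum>i<k. a i m z *\<^sub>R \<phi> i) + (G m z - (\<Sum>i<l. b i m z *\<^sub>R \<phi> i))) \<le> e / 2 + e / 2"
        using a(2) b(2) z by (intro norm_triangle_mono) (auto simp: C1z_near_def)
      thus "norm (F m z - (\<Sum>i<k. a i m z *\<^sub>R \<phi> i) + (G m z - (\<Sum>i<l. b i m z *\<^sub>R \<phi> i))) \<le> e" by simp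
      have "norm (F' m z - (\<Sum>i<k. tens (a' i m z) (\<phi> i)) + (G' m z - (\<Sum>i<l. tens (b' i m z) (\<phi> i)))) \<le> e / 2 + e / 2"
        using a(2) b(2) z by (intro norm_triangle_mono) (auto simp: C1z_near_def)
      thus "norm (F' m z - (\<Sum>i<k. tens (a' i m z) (\<phi> i)) + (G' m z - (\<Sum>i<l. tens (b' i m z) (\<phi> i)))) \<le> e" by simp
    qed
  qed
qed

lemma vapprox_const: "vapprox (\<lambda>m z. c) (\<lambda>m z. 0)"
  unfolding vapprox_def
proof (intro allI impI)
  fix e :: real assume "e > 0"
  moreover have "c \<in> closure (span (range \<phi>))" by (simp add: dense)
  ultimately obtain y where y: "y \<in> span (range \<phi>)" "dist y c < e"
    by (auto simp: closure_approachable)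
  from span_range_nat[OF y(1)] obtain k w where w: "y = (\<Sum>i<k. w i *\<^sub>R \<phi> i)"
    by blast
  show "\<exists>k a a'. (\<forall>i. approx (a i) (a' i)) \<and>
     C1z_near e Z (\<lambda>m z. c) (\<lambda>m z. 0) (\<lambda>m z. \<Sum>i<k. a i m z *\<^sub>R \<phi> i) (\<lambda>m z. \<Sum>i<k. tens (a' i m z) (\<phi> i))"
  proof (intro exI[of _ k] exI[of _ "\<lambda>i m z. w i"] exI[of _ "\<lambda>i m z. 0"] conjI allI approx_const)
    show "C1z_near e Z (\<lambda>m z. c) (\<lambda>m z. 0) (\<lambda>m z. \<Sum>i<k. w i *\<^sub>R \<phi> i) (\<lambda>m z. \<Sum>i<k. tens 0 (\<phi> i))"
      using y(2) \<open>e > 0\<close> by (auto simp: C1z_near_def w[symmetric] dist_norm norm_minus_commute)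
  qed
qed

text \<open>The scalar \<open>a\<close> is kept exact and only \<open>F\<close> is replaced. Every
  error is then an error of \<open>F\<close> or \<open>F'\<close> times the bound of
  \<open>a\<close> or \<open>a'\<close>.\<close>

lemma vapprox_mult:
  assumes a: "approx a a'" and F: "vapprox F F'"
  shows "vapprox (\<lambda>m z. a m z *\<^sub>R F m z) (\<lambda>m z. a m z *\<^sub>R F' m z + tens (a' m z) (F m z))"
  unfolding vapprox_def
proof (intro allI impI)
  fix e :: real assume e: "e > 0"
  obtain b where b0: "b > 0" and b: "\<And>m z. z \<in> Z \<Longrightarrow> \<bar>a m z\<bar> \<le> b" "\<And>m z. z \<in> Z \<Longrightarrow> norm (a' m z) \<le> b"
    using approx_bound[OF a] by metis
  have "e / (2 * b) > 0" using e b0 by simp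
  with F obtain k c c' where c: "\<And>i. approx (c i) (c' i)"
    and near: "C1z_near (e / (2 * b)) Z F F' (\<lambda>m z. \<Sum>i<k. c i m z *\<^sub>R \<phi> i) (\<lambda>m z. \<Sum>i<k. tens (c' i m z) (\<phi> i))"
    unfolding vapprox_def by blast
  show "\<exists>k d d'. (\<forall>i. approx (d i) (d' i)) \<and>
     C1z_near e Z (\<lambda>m z. a m z *\<^sub>R F m z) (\<lambda>m z. a m z *\<^sub>R F' m z + tens (a' m z) (F m z))
        (\<lambda>m z. \<Sum>i<k. d i m z *\<^sub>R \<phi> i) (\<lambda>m z. \<Sum>i<k. tens (d' i m z) (\<phi> i))"
  proof (intro exI[of _ k] exI[of _ "\<lambda>i m z. a m z * c i m z"] exI[of _ "\<lambda>i m z. a m z *\<^sub>R c' i m z + c i m z *\<^sub>R a' m z"]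
      conjI allI approx_mult a c)
    have 1: "(\<Sum>i<k. (a m z * c i m z) *\<^sub>R \<phi> i) = a m z *\<^sub>R (\<Sum>i<k. c i m z *\<^sub>R \<phi> i)" for m z
      by (simp add: scaleR_sum_right)
    have 2: "(\<Sum>i<k. tens (a m z *\<^sub>R c' i m z + c i m z *\<^sub>R a' m z) (\<phi> i)) =
        a m z *\<^sub>R (\<Sum>i<k. tens (c' i m z) (\<phi> i)) + tens (a' m z) (\<Sum>i<k. c i m z *\<^sub>R \<phi> i)" for m z
      by (rule blinfun_eqI)
         (simp add: blinfun.bilinear_simps scaleR_sum_right sum.distrib scaleR_left_distrib mult.commute)
    show "C1z_near e Z (\<lambda>m z. a m z *\<^sub>R F m z) (\<lambda>m z. a m z *\<^sub>R F' m z + tens (a' m z) (F m z))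
        (\<lambda>m z. \<Sum>i<k. (a m z * c i m z) *\<^sub>R \<phi> i) (\<lambda>m z. \<Sum>i<k. tens (a m z *\<^sub>R c' i m z + c i m z *\<^sub>R a' m z) (\<phi> i))"
      unfolding C1z_near_def 1 2 scaleR_diff_right[symmetric]  add_diff_add tens_diff_right
    proof (intro allI ballI conjI)
      fix m z assume z: "z \<in> Z"
      have n: "norm (F m z - (\<Sum>i<k. c i m z *\<^sub>R \<phi> i)) \<le> e / (2 * b)"
          "norm (F' m z - (\<Sum>i<k. tens (c' i m z) (\<phi> i))) \<le> e / (2 * b)"
        using near z by (auto simp: C1z_near_def)
      have half: "b * (e / (2 * b)) = e / 2" using b0 by simp
      have 3: "norm (a m z *\<^sub>R (F m z - (\<Sum>i<k. c i m z *\<^sub>R \<phi> i))) \<le> b * (e / (2 * b))"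
        unfolding norm_scaleR using b(1)[OF z] n(1) b0 by (intro mult_mono) auto
      thus "norm (a m z *\<^sub>R (F m z - (\<Sum>i<k. c i m z *\<^sub>R \<phi> i))) \<le> e"
        unfolding half using e by linarith
      have 4: "norm (a m z *\<^sub>R (F' m z - (\<Sum>i<k. tens (c' i m z) (\<phi> i)))) \<le> b * (e / (2 * b))"
        unfolding norm_scaleR using b(1)[OF z] n(2) b0 by (intro mult_mono) auto
      have 5: "norm (tens (a' m z) (F m z - (\<Sum>i<k. c i m z *\<^sub>R \<phi> i))) \<le> b * (e / (2 * b))"
        using b(2)[OF z] n(1) b0 by (intro order_trans[OF norm_tens] mult_mono) auto
      show "norm (a m z *\<^sub>R (F' m z - (\<Sum>i<k. tens (c' i m z) (\<phi> i))) +
          tens (a' m z) (F m z - (\<Sum>i<k. c i m z *\<^sub>R \<phi> i))) \<le> e"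
        using norm_triangle_mono[OF 4 5] unfolding half by simp
    qed
  qed
qed

lemma vapprox_sum:
  "finite I \<Longrightarrow> (\<And>i. i \<in> I \<Longrightarrow> vapprox (F i) (F' i)) \<Longrightarrow> vapprox (\<lambda>m z. \<Sum>i\<in>I. F i m z) (\<lambda>m z. \<Sum>i\<in>I. F' i m z)"
  by (induction rule: finite_induct) (simp_all add: vapprox_const vapprox_add)

lemma vapprox_affine:
  fixes L :: "'z \<Rightarrow>\<^sub>L 'u"
  assumes coord: "\<And>b. b \<in> Basis \<Longrightarrow> approx (\<lambda>m z. z \<bullet> b) (\<lambda>m z. blinfun_inner_left b)"
  shows "vapprox (\<lambda>m z. c + L (z - z0)) (\<lambda>m z. L)"
proof -
  have "vapprox (\<lambda>m z. (c - L z0) + (\<Sum>b\<in>Basis. (z \<bullet> b) *\<^sub>R L b))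
     (\<lambda>m z. 0 + (\<Sum>b\<in>Basis. (z \<bullet> b) *\<^sub>R 0 + tens (blinfun_inner_left b) (L b)))"
    by (intro vapprox_add vapprox_const vapprox_sum vapprox_mult coord) auto
  moreover have "(\<Sum>b\<in>Basis. (z \<bullet> b) *\<^sub>R L b) = L z" for z
    by (subst (2) euclidean_representation[of z, symmetric], subst blinfun.sum_right) (simp add: blinfun.scaleR_right)
  moreover from this have "0 + (\<Sum>b\<in>Basis. (z \<bullet> b) *\<^sub>R 0 + tens (blinfun_inner_left b) (L b)) = L" for z :: 'z
    by (intro blinfun_eqI) (simp add: blinfun.bilinear_simps)
  ultimately show ?thesis by (simp add: blinfun.diff_right algebra_simps)
qed

end

section \<open>Local Taylor models and their gluing\<close>

lemma C1_taylor_segment: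
  fixes f :: "'z::real_normed_vector \<Rightarrow> 'u::real_normed_vector"
  assumes "convex Z" "z \<in> Z" "z' \<in> Z"
    and der: "\<And>x. x \<in> Z \<Longrightarrow> (f has_derivative blinfun_apply (f' x)) (at x)"
    and lip: "\<And>x. x \<in> Z \<Longrightarrow> norm (f' x - f' z') \<le> K * norm (x - z')" and K: "0 \<le> K"
  shows "norm (f z - f z' - f' z' (z - z')) \<le> K * (norm (z - z'))\<^sup>2"
proof -
  \<comment> \<open>The mean value inequality is applied to \<open>f\<close> minus its linear part
    at \<open>z'\<close>, whose derivative along the segment is at most \<open>K\<close> times the
    length of the segment.\<close>
  let ?g = "\<lambda>x. f x - f' z' x"
  have sub: "closed_segment z' z \<subseteq> Z" by (rule closed_segment_subset[OF assms(3,2,1)])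
  have "norm (?g z - ?g z') \<le> (K * norm (z - z')) * norm (z - z')"
  proof (rule differentiable_bound[where S="closed_segment z' z" and f'="\<lambda>x. blinfun_apply (f' x - f' z')"])
    fix x assume x: "x \<in> closed_segment z' z"
    hence xZ: "x \<in> Z" using sub by blast
    have "(?g has_derivative (\<lambda>h. f' x h - f' z' h)) (at x within closed_segment z' z)"
      by (intro has_derivative_diff has_derivative_at_withinI[OF der[OF xZ]]
          bounded_linear_imp_has_derivative blinfun.bounded_linear_right)
    thus "(?g has_derivative blinfun_apply (f' x - f' z')) (at x within closed_segment z' z)"
      by (rule has_derivative_eq_rhs) (simp add: fun_eq_iff blinfun.diff_left)
    have "norm (x - z') \<le> norm (z - z')"
      using segment_bound(1)[OF x] by (simp add: norm_minus_commute)
    thus "onorm (blinfun_apply (f' x - f' z')) \<le> K * norm (z - z')"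
      using lip[OF xZ] K by (simp add: norm_blinfun.rep_eq[symmetric] mult_left_mono order_trans)
  qed auto
  thus ?thesis by (simp add: blinfun.diff_right power2_eq_square algebra_simps)
qed

context zapprox_dense
begin

lemma vapprox_limit:
  assumes "\<And>e. e > 0 \<Longrightarrow> \<exists>G G'. vapprox G G' \<and> C1z_near e Z F F' G G'"
  shows "vapprox F F'"
  unfolding vapprox_def
proof (intro allI impI)
  fix e :: real assume "e > 0"
  hence e: "e / 2 > 0" by simp
  from assms[OF this] obtain G G' where G: "vapprox G G'" "C1z_near (e / 2) Z F F' G G'" by blast
  from G(1) e obtain k a a' where a: "\<forall>i. approx (a i) (a' i)"
    "C1z_near (e/2) Z G G' (\<lambda>m z. \<Sum>i<k. a i m z *\<^sub>R \<phi> i) (\<lambda>m z. \<Sum>i<k. tens (a' i m z) (\<phi> i))"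
    unfolding vapprox_def by blast
  have "C1z_near e Z F F' (\<lambda>m z. \<Sum>i<k. a i m z *\<^sub>R \<phi> i) (\<lambda>m z. \<Sum>i<k. tens (a' i m z) (\<phi> i))"
    unfolding C1z_near_def
  proof (intro allI ballI conjI)
    fix m z assume z: "z \<in> Z"
    have "norm (F m z - G m z + (G m z - (\<Sum>i<k. a i m z *\<^sub>R \<phi> i))) \<le> e / 2 + e / 2"
      using G(2) a(2) z by (intro norm_triangle_mono) (auto simp: C1z_near_def)
    thus "norm (F m z - (\<Sum>i<k. a i m z *\<^sub>R \<phi> i)) \<le> e" by simp
    have "norm (F' m z - G' m z + (G' m z - (\<Sum>i<k. tens (a' i m z) (\<phi> i)))) \<le> e / 2 + e / 2"
      using G(2) a(2) z by (intro norm_triangle_mono) (auto simp: C1z_near_def)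
    thus "norm (F' m z - (\<Sum>i<k. tens (a' i m z) (\<phi> i))) \<le> e" by simp
  qed
  with a(1) show "\<exists>k a a'. (\<forall>i. approx (a i) (a' i)) \<and>
     C1z_near e Z F F' (\<lambda>m z. \<Sum>i<k. a i m z *\<^sub>R \<phi> i) (\<lambda>m z. \<Sum>i<k. tens (a' i m z) (\<phi> i))" by blast
qed

text \<open>The cells are cut one coordinate at a time.  Since the values of the local models are
  combined convexly, the error \<open>e\<close> of the values does not grow with the number of cuts, and each
  cut adds only \<open>4 e l\<^sub>i / h\<^sub>i\<close> to the error of the derivatives.\<close>

lemma vapprox_cells:
  fixes f :: "'m \<Rightarrow> 'z \<Rightarrow> 'u" and f' :: "'m \<Rightarrow> 'z \<Rightarrow> 'z \<Rightarrow>\<^sub>L 'u" and N k :: nat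
  assumes coord: "\<And>b. b \<in> Basis \<Longrightarrow> approx (\<lambda>m z. z \<bullet> b) (\<lambda>m z. blinfun_inner_left b)"
    and X: "\<And>i. i < N \<Longrightarrow> approx (X i) (X' i)"
    and l: "\<And>i m z. i < N \<Longrightarrow> z \<in> Z \<Longrightarrow> norm (X' i m z) \<le> l i"
    and h: "\<And>i. i < N \<Longrightarrow> 0 < h i"
    and e: "0 \<le> e" "0 \<le> e'"
    and model: "\<And>m z m' z'. z \<in> Z \<Longrightarrow> z' \<in> Z \<Longrightarrow> (\<And>i. i < N \<Longrightarrow> \<bar>X i m z - X i m' z'\<bar> \<le> 2 * h i) \<Longrightarrow>
       norm (f m z - f m' z' - f' m' z' (z - z')) \<le> e \<and> norm (f' m z - f' m' z') \<le> e'"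
    and "k \<le> N" "R \<subseteq> UNIV \<times> Z"
    and "\<And>m z m' z' i. (m, z) \<in> R \<Longrightarrow> (m', z') \<in> R \<Longrightarrow> k \<le> i \<Longrightarrow> i < N \<Longrightarrow> \<bar>X i m z - X i m' z'\<bar> \<le> 2 * h i"
  shows "\<exists>F F'. vapprox F F' \<and> (\<forall>(m, z)\<in>R. norm (f m z - F m z) \<le> e \<and>
     norm (f' m z - F' m z) \<le> e' + (\<Sum>i<k. 4 * e * l i / h i))"
  using assms(8-10)
\<comment> \<open>\<open>k\<close> counts the coordinates still to be cut; in \<open>R\<close> those
  from \<open>k\<close> on already vary by at most \<open>2 * h i\<close>.\<close>
proof (induction k arbitrary: R)
  case 0
  show ?case
  proof (cases "R = {}")
    case True
    thus ?thesis using vapprox_const by (intro exI conjI) auto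
  next
    case False
    then obtain m0 z0 where 0: "(m0, z0) \<in> R" by auto
    show ?thesis
    proof (intro exI conjI)
      \<comment> \<open>No cut is left: the Taylor polynomial at an arbitrary point of
        \<open>R\<close> serves the whole of \<open>R\<close>.\<close>
      show "vapprox (\<lambda>m z. f m0 z0 + f' m0 z0 (z - z0)) (\<lambda>m z. f' m0 z0)"
        by (rule vapprox_affine[OF coord])
      show "\<forall>(m, z)\<in>R. norm (f m z - (f m0 z0 + f' m0 z0 (z - z0))) \<le> e \<and>
         norm (f' m z - f' m0 z0) \<le> e' + (\<Sum>i<0. 4 * e * l i / h i)"
      proof (intro ballI, clarify)
        fix m z assume mz: "(m, z) \<in> R"
        have "z \<in> Z" "z0 \<in> Z" using mz 0 "0.prems"(2) by auto
        from model[OF this "0.prems"(3)[OF mz 0]]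
        show "norm (f m z - (f m0 z0 + f' m0 z0 (z - z0))) \<le> e \<and>
         norm (f' m z - f' m0 z0) \<le> e' + (\<Sum>i<0. 4 * e * l i / h i)"
          by (simp add: diff_diff_eq)
      qed
    qed
  qed
next
  case (Suc k)
  hence k: "k < N" by simp
  have hk: "0 < h k" using h[OF k] .
  obtain b where b0: "b > 0" and b: "\<And>m z. z \<in> Z \<Longrightarrow> \<bar>X k m z\<bar> \<le> b"
    using approx_bound[OF X[OF k]] by metis
  define T where "T = (\<lambda>m z. X k m z / h k)"
  obtain n :: nat where n: "b / h k \<le> real n" using real_arch_simple by blast
  have T: "\<bar>T m z\<bar> \<le> real n" if "z \<in> Z" for m z
  proof -
    have "\<bar>T m z\<bar> \<le> b / h k" unfolding T_def using b[OF that] hk by (simp add: divide_right_mono)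
    thus ?thesis using n by linarith
  qed
  \<comment> \<open>The slab of the \<open>j\<close>-th bump: outside it the bump vanishes within
    \<open>R\<close>, and it has width 2 in \<open>T\<close>, hence \<open>2 * h k\<close> in the
    coordinate.\<close>
  define C where "C = (\<lambda>j. {(m, z). (m, z) \<in> R \<and> \<bar>T m z + real n - real j\<bar> \<le> 1})"
  have "\<exists>F F'. vapprox F F' \<and> (\<forall>(m, z)\<in>C j. norm (f m z - F m z) \<le> e \<and>
     norm (f' m z - F' m z) \<le> e' + (\<Sum>i<k. 4 * e * l i / h i))" for j
  proof (rule Suc.IH)
    show "k \<le> N" using k by simp
    show "C j \<subseteq> UNIV \<times> Z" using Suc.prems(2) by (auto simp: C_def)
    fix m z m' z' i assume mz: "(m, z) \<in> C j" "(m', z') \<in> C j" and i: "k \<le> i" "i < N"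
    show "\<bar>X i m z - X i m' z'\<bar> \<le> 2 * h i"
    proof (cases "i = k")
      case True
      have "\<bar>T m z - T m' z'\<bar> \<le> 2" using mz unfolding C_def by auto
      hence "\<bar>X k m z - X k m' z'\<bar> / h k \<le> 2"
        using hk by (simp add: T_def diff_divide_distrib[symmetric])
      thus ?thesis using hk True by (simp add: field_simps)
    next
      case False
      thus ?thesis using Suc.prems(3)[of m z m' z' i] mz i by (auto simp: C_def)
    qed
  qed
  then obtain F F' where F: "\<And>j. vapprox (F j) (F' j)"
    and near: "\<And>j m z. (m, z) \<in> C j \<Longrightarrow> norm (f m z - F j m z) \<le> e \<and>
     norm (f' m z - F' j m z) \<le> e' + (\<Sum>i<k. 4 * e * l i / h i)"
    by (metis (no_types, lifting) case_prodD)
  define w where "w = (\<lambda>j m z. bump n j (T m z))"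
  define w' where "w' = (\<lambda>j m z. dbump n j (T m z) *\<^sub>R ((1 / h k) *\<^sub>R X' k m z))"
  have w: "approx (w j) (w' j)" for j
    unfolding w_def w'_def T_def by (rule approx_bump[OF X[OF k]])
  define M where "M = 2 * n + 1"
  define G where "G = (\<lambda>m z. \<Sum>j<M. w j m z *\<^sub>R F j m z)"
  define G' where "G' = (\<lambda>m z. \<Sum>j<M. w j m z *\<^sub>R F' j m z + tens (w' j m z) (F j m z))"
  have "vapprox G G'"
    unfolding G_def G'_def by (intro vapprox_sum vapprox_mult w F) auto
  moreover have "norm (f m z - G m z) \<le> e \<and> norm (f' m z - G' m z) \<le> e' + (\<Sum>i<Suc k. 4 * e * l i / h i)"
    if mz: "(m, z) \<in> R" for m z
  proof -
    have z: "z \<in> Z" using mz Suc.prems(2) by auto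
    have w1: "(\<Sum>j<M. w j m z) = 1" and w0: "(\<Sum>j<M. dbump n j (T m z)) = 0"
      unfolding w_def M_def by (rule bump_sum[OF T[OF z]])+
    have wpos: "0 \<le> w j m z" for j unfolding w_def by (rule bump_nonneg)
    have supp: "w j m z = 0 \<and> dbump n j (T m z) = 0" if "(m, z) \<notin> C j" for j
      unfolding w_def by (rule bump_support) (use that mz in \<open>auto simp: C_def\<close>)
    let ?e' = "e' + (\<Sum>i<k. 4 * e * l i / h i)"
    have "f m z - G m z = (\<Sum>j<M. w j m z *\<^sub>R (f m z - F j m z))"
      using w1 by (simp add: G_def scaleR_diff_right sum_subtractf scaleR_sum_left[symmetric])
    also have "norm \<dots> \<le> (\<Sum>j<M. w j m z * e)"
    proof (rule sum_norm_le)
      fix j show "norm (w j m z *\<^sub>R (f m z - F j m z)) \<le> w j m z * e"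
        using near[of m z j] supp[of j] wpos[of j] by (cases "(m, z) \<in> C j") (auto intro: mult_left_mono)
    qed
    also have "\<dots> = e" using w1 by (simp add: sum_distrib_right[symmetric])
    finally have 1: "norm (f m z - G m z) \<le> e" .
    \<comment> \<open>The derivatives of the bumps sum to 0, so \<open>f m z\<close> may be
      subtracted inside the sum. They then multiply only the differences
      \<open>f m z - F j m z\<close>, of size \<open>e\<close>.\<close>
    have t0: "(\<Sum>j<M. tens (w' j m z) (f m z)) = 0"
    proof -
      have "(\<Sum>j<M. tens (w' j m z) (f m z)) = (\<Sum>j<M. dbump n j (T m z)) *\<^sub>R tens ((1 / h k) *\<^sub>R X' k m z) (f m z)"
        unfolding w'_def tens_scaleR_left scaleR_sum_left ..
      thus ?thesis using w0 by simp
    qed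
    have "f' m z - G' m z = (\<Sum>j<M. w j m z *\<^sub>R f' m z) + (\<Sum>j<M. tens (w' j m z) (f m z)) - G' m z"
      using w1 t0 by (simp add: scaleR_sum_left[symmetric])
    also have "\<dots> = (\<Sum>j<M. w j m z *\<^sub>R (f' m z - F' j m z)) + (\<Sum>j<M. tens (w' j m z) (f m z - F j m z))"
      by (simp add: G'_def sum.distrib scaleR_diff_right sum_subtractf tens_diff_right[symmetric])
    finally have eq: "f' m z - G' m z = \<dots>" .
    have "norm (\<Sum>j<M. w j m z *\<^sub>R (f' m z - F' j m z)) \<le> (\<Sum>j<M. w j m z * ?e')"
    proof (rule sum_norm_le)
      fix j show "norm (w j m z *\<^sub>R (f' m z - F' j m z)) \<le> w j m z * ?e'"
        using near[of m z j] supp[of j] wpos[of j] by (cases "(m, z) \<in> C j") (auto intro: mult_left_mono)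
    qed
    also have "\<dots> = ?e'" using w1 by (simp add: sum_distrib_right[symmetric])
    finally have 2: "norm (\<Sum>j<M. w j m z *\<^sub>R (f' m z - F' j m z)) \<le> ?e'" .
    have l0: "0 \<le> l k" using l[OF k z, of m] norm_ge_zero order_trans by blast
    have "norm (\<Sum>j<M. tens (w' j m z) (f m z - F j m z)) \<le> (\<Sum>j<M. \<bar>dbump n j (T m z)\<bar> * (l k / h k * e))"
    proof (rule sum_norm_le)
      fix j
      show "norm (tens (w' j m z) (f m z - F j m z)) \<le> \<bar>dbump n j (T m z)\<bar> * (l k / h k * e)"
      proof (cases "(m, z) \<in> C j")
        case True
        have "norm (w' j m z) = \<bar>dbump n j (T m z)\<bar> * (norm (X' k m z) / h k)"
          using hk by (simp add: w'_def)
        also have "\<dots> \<le> \<bar>dbump n j (T m z)\<bar> * (l k / h k)"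
          using l[OF k z] hk by (intro mult_left_mono divide_right_mono) auto
        finally have "norm (w' j m z) \<le> \<bar>dbump n j (T m z)\<bar> * (l k / h k)" .
        hence "norm (tens (w' j m z) (f m z - F j m z)) \<le> (\<bar>dbump n j (T m z)\<bar> * (l k / h k)) * e"
          using near[OF True] l0 hk by (intro order_trans[OF norm_tens] mult_mono) auto
        thus ?thesis by (simp add: mult.assoc)
      next
        case False
        thus ?thesis using supp[of j] by (simp add: w'_def)
      qed
    qed
    also have "\<dots> = (\<Sum>j<M. \<bar>dbump n j (T m z)\<bar>) * (l k / h k * e)"
      by (rule sum_distrib_right[symmetric])
    also have "\<dots> \<le> 4 * (l k / h k * e)"
      using l0 hk e by (intro mult_right_mono dbump_sum_abs) auto
    finally have 3: "norm (\<Sum>j<M. tens (w' j m z) (f m z - F j m z)) \<le> 4 * (l k / h k * e)" .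
    have "norm (f' m z - G' m z) \<le> ?e' + 4 * (l k / h k * e)"
      unfolding eq by (rule norm_triangle_mono[OF 2 3])
    thus ?thesis using 1 by (simp add: algebra_simps)
  qed
  ultimately show ?case by blast
qed

text \<open>The first \<open>n\<close> cuts are in the coordinates \<open>y\<close>, which do not
  depend on \<open>z\<close>: their \<open>l\<close> is 0, so the width \<open>h^2\<close> costs
  nothing in the derivatives. Only the cuts in \<open>z\<close> contribute, each by
  \<open>4 * v / h\<close> with \<open>v\<close> of order \<open>h^2\<close>.\<close>

lemma vapprox_lipschitz:
  fixes f :: "'m \<Rightarrow> 'z \<Rightarrow> 'u" and f' :: "'m \<Rightarrow> 'z \<Rightarrow> 'z \<Rightarrow>\<^sub>L 'u" and n :: nat
  assumes convex: "convex Z"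
    and coord: "\<And>b. b \<in> Basis \<Longrightarrow> approx (\<lambda>m z. z \<bullet> b) (\<lambda>m z. blinfun_inner_left b)"
    and Y: "\<And>i. i < n \<Longrightarrow> approx (\<lambda>m z. y i m) (\<lambda>m z. 0)"
    and der: "has_zderiv f f' Z"
    and lip: "\<And>m m' z. z \<in> Z \<Longrightarrow> norm (f m z - f m' z) \<le> K * (\<Sum>i<n. \<bar>y i m - y i m'\<bar>)"
    and lip': "\<And>m m' z z'. z \<in> Z \<Longrightarrow> z' \<in> Z \<Longrightarrow>
       norm (f' m z - f' m' z') \<le> K * ((\<Sum>i<n. \<bar>y i m - y i m'\<bar>) + norm (z - z'))"
    and K: "0 \<le> K"
  shows "vapprox f f'"
proof (rule vapprox_limit)
  fix e :: real assume e: "e > 0"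
  define D where "D = DIM('z)"
  \<comment> \<open>The three summands are the coefficients of \<open>h\<close> in the bounds for
    \<open>v'\<close>, for the gluing terms and for \<open>v\<close>.\<close>
  define C where "C = K * (2 * real n + 2 * real D) + real D * (8 * K * real n + 16 * K * (real D)\<^sup>2) + (2 * K * real n + 4 * K * (real D)\<^sup>2)"
  have C: "0 \<le> C" using K by (simp add: C_def)
  define h where "h = min 1 (e / (C + 1))"
  have h: "0 < h" "h \<le> 1" using e C by (auto simp: h_def)
  have "h * (C + 1) \<le> e / (C + 1) * (C + 1)" using C by (intro mult_right_mono) (auto simp: h_def)
  also have "\<dots> = e" using C by simp
  finally have hC: "h * C \<le> e" using h unfolding distrib_left by linarith
  obtain b :: "nat \<Rightarrow> 'z" where b: "bij_betw b {..<D} Basis"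
    using ex_bij_betw_nat_finite[OF finite_Basis] unfolding D_def lessThan_atLeast0 by blast
  define X where "X = (\<lambda>i m z. if i < n then y i m else z \<bullet> b (i - n))"
  define X' where "X' = (\<lambda>i (m::'m) (z::'z). if i < n then 0 else blinfun_inner_left (b (i - n)) :: 'z \<Rightarrow>\<^sub>L real)"
  define l where "l = (\<lambda>i. if i < n then 0 else 1 :: real)"
  define hh where "hh = (\<lambda>i. if i < n then h\<^sup>2 else h)"
  \<comment> \<open>Within one cell the \<open>y\<close>-distance is at most
    \<open>2 * n * h^2\<close> and the \<open>z\<close>-distance at most \<open>2 * D * h\<close>.
    \<open>v\<close> adds the Lipschitz error of the former to the quadratic Taylor error of the
    latter.\<close>
  define v where "v = 2 * K * real n * h\<^sup>2 + 4 * K * (real D)\<^sup>2 * h\<^sup>2"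
  define v' where "v' = K * (2 * real n * h\<^sup>2 + 2 * real D * h)"
  have bB: "b (i - n) \<in> Basis" if "i < n + D" "\<not> i < n" for i
    using bij_betwE[OF b] that by auto
  have "\<exists>F F'. vapprox F F' \<and> (\<forall>(m, z)\<in>UNIV \<times> Z. norm (f m z - F m z) \<le> v \<and>
     norm (f' m z - F' m z) \<le> v' + (\<Sum>i<n + D. 4 * v * l i / hh i))"
  proof (rule vapprox_cells[where N="n + D" and X=X and X'=X'])
    show "approx (X i) (X' i)" if "i < n + D" for i
      using that Y[of i] coord[OF bB[of i]] by (auto simp: X_def X'_def)
    show "norm (X' i m z) \<le> l i" if "i < n + D" for i m z
    proof (cases "i < n")
      case False
      have "norm (blinfun_inner_left (b (i - n))) \<le> 1"
      proof (rule norm_blinfun_bound)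
        fix x
        have "norm (b (i - n)) = 1" using bB[OF that False] by simp
        thus "norm (blinfun_inner_left (b (i - n)) x) \<le> 1 * norm x"
          using Cauchy_Schwarz_ineq2[of x "b (i - n)"] by (simp add: inner_commute)
      qed simp
      thus ?thesis using False by (simp add: X'_def l_def)
    qed (simp add: X'_def l_def)
    show "0 < hh i" for i using h by (simp add: hh_def)
    show "0 \<le> v" "0 \<le> v'" using K h by (auto simp: v_def v'_def)
    fix m z m' z' assume z: "z \<in> Z" "z' \<in> Z"
      and d: "\<And>i. i < n + D \<Longrightarrow> \<bar>X i m z - X i m' z'\<bar> \<le> 2 * hh i"
    have "\<bar>y i m - y i m'\<bar> \<le> 2 * h\<^sup>2" if "i < n" for i
      using d[of i] that by (simp add: X_def hh_def)
    hence "(\<Sum>i<n. \<bar>y i m - y i m'\<bar>) \<le> (\<Sum>i<n. 2 * h\<^sup>2)" by (intro sum_mono) auto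
    hence y: "(\<Sum>i<n. \<bar>y i m - y i m'\<bar>) \<le> 2 * real n * h\<^sup>2" by (simp add: mult.commute mult.left_commute)
    have "norm (z - z') \<le> (\<Sum>b\<in>Basis. \<bar>(z - z') \<bullet> b\<bar>)" by (rule norm_le_l1)
    also have "\<dots> \<le> (\<Sum>b\<in>(Basis::'z set). 2 * h)"
    proof (rule sum_mono)
      fix c :: 'z assume "c \<in> Basis"
      then obtain j where j: "j < D" "c = b j" using b by (auto simp: bij_betw_def)
      show "\<bar>(z - z') \<bullet> c\<bar> \<le> 2 * h" using d[of "n + j"] j by (simp add: X_def hh_def inner_diff_left)
    qed
    finally have zz: "norm (z - z') \<le> 2 * real D * h" by (simp add: D_def mult.commute mult.left_commute)
    have "norm (f m z - f m' z) \<le> K * (2 * real n * h\<^sup>2)"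
      using lip[OF z(1), of m m'] y K by (meson mult_left_mono order_trans)
    moreover have "norm (f m' z - f m' z' - f' m' z' (z - z')) \<le> K * (norm (z - z'))\<^sup>2"
    proof (rule C1_taylor_segment[OF convex z has_zderivD[OF der] _ K])
      fix x assume "x \<in> Z"
      from lip'[OF this z(2), of m' m'] show "norm (f' m' x - f' m' z') \<le> K * norm (x - z')" by simp
    qed
    moreover have "K * (norm (z - z'))\<^sup>2 \<le> K * (2 * real D * h)\<^sup>2"
      using zz K by (intro mult_left_mono power_mono) auto
    ultimately have "norm ((f m z - f m' z) + (f m' z - f m' z' - f' m' z' (z - z'))) \<le>
        K * (2 * real n * h\<^sup>2) + K * (2 * real D * h)\<^sup>2"
      by (intro norm_triangle_mono) auto
    hence "norm (f m z - f m' z' - f' m' z' (z - z')) \<le> v"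
      by (simp add: v_def power_mult_distrib algebra_simps)
    moreover have "norm (f' m z - f' m' z') \<le> v'"
      unfolding v'_def using lip'[OF z, of m m'] y zz K
      by (meson add_mono mult_left_mono order_trans)
    ultimately show "norm (f m z - f m' z' - f' m' z' (z - z')) \<le> v \<and> norm (f' m z - f' m' z') \<le> v'" ..
  qed (auto intro: coord)
  then obtain F F' where F: "vapprox F F'" and near: "\<And>m z. z \<in> Z \<Longrightarrow> norm (f m z - F m z) \<le> v \<and>
     norm (f' m z - F' m z) \<le> v' + (\<Sum>i<n + D. 4 * v * l i / hh i)" by blast
  have hsq: "h\<^sup>2 \<le> h" using h by (simp add: power2_eq_square mult_left_le)
  have Cv: "(2 * K * real n + 4 * K * (real D)\<^sup>2) * h \<le> C * h"
    unfolding C_def using K h by (intro mult_right_mono) auto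
  have "v = (2 * K * real n + 4 * K * (real D)\<^sup>2) * h\<^sup>2" by (simp add: v_def algebra_simps)
  also have "\<dots> \<le> (2 * K * real n + 4 * K * (real D)\<^sup>2) * h" using hsq K by (intro mult_left_mono) auto
  finally have v: "v \<le> e" using Cv hC by (simp add: mult.commute)
  have "(\<Sum>i<n + D. 4 * v * l i / hh i) = (\<Sum>i\<in>{n..<n + D}. 4 * v / h)"
    by (intro sum.mono_neutral_cong_right) (auto simp: l_def hh_def)
  also have "\<dots> = real D * (8 * K * real n + 16 * K * (real D)\<^sup>2) * h"
    using h by (simp add: v_def power2_eq_square field_simps)
  finally have s: "(\<Sum>i<n + D. 4 * v * l i / hh i) = real D * (8 * K * real n + 16 * K * (real D)\<^sup>2) * h" .
  have "v' \<le> K * (2 * real n * h + 2 * real D * h)"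
    unfolding v'_def using hsq K by (intro mult_left_mono add_mono) auto
  hence "v' + (\<Sum>i<n + D. 4 * v * l i / hh i) \<le> (K * (2 * real n + 2 * real D) + real D * (8 * K * real n + 16 * K * (real D)\<^sup>2)) * h"
    unfolding s by (simp add: algebra_simps)
  also have "\<dots> \<le> C * h" unfolding C_def using K h by (intro mult_right_mono) auto
  also have "\<dots> \<le> e" using hC by (simp add: mult.commute)
  finally have v': "v' + (\<Sum>i<n + D. 4 * v * l i / hh i) \<le> e" .
  have "C1z_near e Z f f' F F'"
    unfolding C1z_near_def
  proof (intro allI ballI conjI)
    fix m z assume "z \<in> Z"
    from near[OF this, of m] v v'
    show "norm (f m z - F m z) \<le> e" "norm (f' m z - F' m z) \<le> e" by (auto elim: order_trans)
  qed
  with F show "\<exists>G G'. vapprox G G' \<and> C1z_near e Z f f' G G'" by blast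
qed

lemma vapprox_S:
  assumes F: "vapprox F F'" and e: "e > 0"
  obtains k s s' where "k \<ge> 1" "\<And>i. s i \<in> S" "\<And>i. has_zderiv (curry (s i)) (s' i) Z"
    "C1z_near e Z F F' (\<lambda>m z. \<Sum>i<k. s i (m, z) *\<^sub>R \<phi> i) (\<lambda>m z. \<Sum>i<k. tens (s' i m z) (\<phi> i))"
proof -
  have e2: "e / 2 > 0" using e by simp
  with F obtain k a a' where a: "\<And>i. approx (a i) (a' i)"
    and near: "C1z_near (e/2) Z F F' (\<lambda>m z. \<Sum>i<k. a i m z *\<^sub>R \<phi> i) (\<lambda>m z. \<Sum>i<k. tens (a' i m z) (\<phi> i))"
    unfolding vapprox_def by blast
  \<comment> \<open>Chosen so that \<open>r\<close> times the sum of the norms of the vectors is at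
    most \<open>e / 2\<close>; the other half covers the passage from \<open>F\<close> to the
    coefficients.\<close>
  define r where "r = e / (2 * (k + 1) * ((\<Sum>i<k. norm (\<phi> i)) + 1))"
  have p: "0 \<le> (\<Sum>i<k. norm (\<phi> i))" by (intro sum_nonneg) auto
  have r: "r > 0" unfolding r_def using e p by (intro divide_pos_pos mult_pos_pos) auto
  have rk: "(\<Sum>i<k. r * norm (\<phi> i)) \<le> e / 2"
  proof -
    have "(\<Sum>i<k. r * norm (\<phi> i)) \<le> r * ((\<Sum>i<k. norm (\<phi> i)) + 1)"
      using r by (simp add: sum_distrib_left distrib_left)
    also have "\<dots> = e / (2 * (k + 1))" unfolding r_def using p by simp
    also have "\<dots> \<le> e / 2" using e by (simp add: field_simps)
    finally show ?thesis .
  qed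
  have "\<exists>s s'. s \<in> S \<and> has_zderiv (curry s) s' Z \<and> C1z_near r Z (a i) (a' i) (curry s) s'" for i
    using a[of i] r unfolding approx_def by blast
  then obtain t t' where t: "\<And>i. t i \<in> S" "\<And>i. has_zderiv (curry (t i)) (t' i) Z"
    "\<And>i. C1z_near r Z (a i) (a' i) (curry (t i)) (t' i)" by metis
  define s where "s = (\<lambda>i. if i < k then t i else (\<lambda>x. 0))"
  define s' where "s' = (\<lambda>i. if i < k then t' i else (\<lambda>m z. 0))"
  show ?thesis
  \<comment> \<open>A zero coefficient is appended, so that the rank is at least 1.\<close>
  proof (rule that[of "Suc k" s s'])
    show "s i \<in> S" for i using t(1) S_const by (simp add: s_def)
    show "has_zderiv (curry (s i)) (s' i) Z" for i
      using t(2) by (simp add: s_def s'_def) (simp add: has_zderiv_def curry_def zero_blinfun.rep_eq)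
    show "C1z_near e Z F F' (\<lambda>m z. \<Sum>i<Suc k. s i (m, z) *\<^sub>R \<phi> i) (\<lambda>m z. \<Sum>i<Suc k. tens (s' i m z) (\<phi> i))"
      unfolding C1z_near_def
    proof (intro allI ballI conjI)
      fix m z assume z: "z \<in> Z"
      have tn: "norm (a i m z - t i (m, z)) \<le> r" "norm (a' i m z - t' i m z) \<le> r" for i
        using t(3)[of i] z by (auto simp: C1z_near_def)
      have "norm (\<Sum>i<k. (a i m z - t i (m, z)) *\<^sub>R \<phi> i) \<le> (\<Sum>i<k. r * norm (\<phi> i))"
        using tn by (intro sum_norm_le) (auto intro: mult_right_mono)
      hence 1: "norm ((\<Sum>i<k. a i m z *\<^sub>R \<phi> i) - (\<Sum>i<k. t i (m, z) *\<^sub>R \<phi> i)) \<le> e / 2"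
        using rk by (simp add: scaleR_left_diff_distrib sum_subtractf)
      have "norm (\<Sum>i<k. tens (a' i m z - t' i m z) (\<phi> i)) \<le> (\<Sum>i<k. r * norm (\<phi> i))"
        using tn by (intro sum_norm_le order_trans[OF norm_tens]) (auto intro: mult_right_mono)
      hence 2: "norm ((\<Sum>i<k. tens (a' i m z) (\<phi> i)) - (\<Sum>i<k. tens (t' i m z) (\<phi> i))) \<le> e / 2"
        using rk by (simp add: tens_diff_left[symmetric] sum_subtractf)
      have 3: "norm (F m z - (\<Sum>i<k. a i m z *\<^sub>R \<phi> i)) \<le> e / 2"
        "norm (F' m z - (\<Sum>i<k. tens (a' i m z) (\<phi> i))) \<le> e / 2"
        using near z by (auto simp: C1z_near_def)
      show "norm (F m z - (\<Sum>i<Suc k. s i (m, z) *\<^sub>R \<phi> i)) \<le> e"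
        using norm_triangle_mono[OF 3(1) 1] by (simp add: s_def)
      show "norm (F' m z - (\<Sum>i<Suc k. tens (s' i m z) (\<phi> i))) \<le> e"
        using norm_triangle_mono[OF 3(2) 2] by (simp add: s'_def)
    qed
  qed simp
qed

end

section \<open>Encoding error\<close>

text \<open>Truncation to \<open>[-N, N]\<close> by two GELU units in place of two ReLU units. The
  scaling by \<open>N\<close> makes the deviation at most \<open>2 / N\<close>, so one parameter
  governs both the level and the accuracy.\<close>

definition gelu_clip :: "real \<Rightarrow> real \<Rightarrow> real" where
  "gelu_clip N t = (1 / N) * (gelu (N * (t + N)) + (-1) * gelu (N * (t + - N))) + - N"

definition clip :: "real \<Rightarrow> real \<Rightarrow> real" where
  "clip N t = max 0 (t + N) - max 0 (t - N) - N"

lemma gelu_clip_near: assumes "1 \<le> N" shows "\<bar>gelu_clip N t - clip N t\<bar> \<le> 2 / N"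
proof -
  have r: "max 0 (N * x) = N * max 0 x" for x using assms by (auto simp: max_def zero_le_mult_iff)
  let ?a = "gelu (N * (t + N)) - max 0 (N * (t + N))" and ?b = "gelu (N * (t + - N)) - max 0 (N * (t + - N))"
  have "gelu_clip N t - clip N t = (?a - ?b) / N"
    unfolding gelu_clip_def clip_def r using assms by (simp add: field_simps)
  moreover have "\<bar>?a - ?b\<bar> \<le> 2"
    using gelu_relu[of "N * (t + N)"] gelu_relu[of "N * (t + - N)"] by linarith
  ultimately show ?thesis using assms by (simp add: divide_right_mono)
qed

lemma clip_bound: "1 \<le> N \<Longrightarrow> \<bar>clip N t\<bar> \<le> N"
  and clip_id: "\<bar>t\<bar> \<le> N \<Longrightarrow> clip N t = t"
  and clip_diff: "1 \<le> N \<Longrightarrow> \<bar>clip N t - t\<bar> \<le> \<bar>t\<bar>"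
  by (auto simp: clip_def max_def abs_if split: if_splits)

lemma gelu_clip_bound: assumes "1 \<le> N" shows "\<bar>gelu_clip N t\<bar> \<le> N + 2"
proof -
  have "2 / N \<le> 2" using assms by (simp add: field_simps)
  thus ?thesis using gelu_clip_near[OF assms, of t] clip_bound[OF assms, of t] by linarith
qed

lemma gelu_clip_diff: assumes "1 \<le> N" shows "\<bar>gelu_clip N t - t\<bar> \<le> \<bar>t\<bar> + 2"
proof -
  have "2 / N \<le> 2" using assms by (simp add: field_simps)
  thus ?thesis using gelu_clip_near[OF assms, of t] clip_diff[OF assms, of t] by linarith
qed

lemma continuous_gelu_clip: "continuous_on A (gelu_clip N)"
  unfolding gelu_clip_def[abs_def]
  by (intro continuous_intros continuous_on_compose2[OF continuous_gelu[of UNIV]]) auto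

lemma gelu_clip_tendsto: "(\<lambda>N. gelu_clip (real (Suc N)) t) \<longlonglongrightarrow> t"
proof (rule LIM_zero_cancel, rule Lim_null_comparison)
  obtain n :: nat where n: "\<bar>t\<bar> \<le> real n" using real_arch_simple by blast
  show "\<forall>\<^sub>F N in sequentially. norm (gelu_clip (real (Suc N)) t - t) \<le> 2 / real (Suc N)"
    using eventually_ge_at_top[of n]
  proof eventually_elim
    case (elim N)
    hence "\<bar>t\<bar> \<le> real (Suc N)" using n by simp
    from clip_id[OF this] gelu_clip_near[of "real (Suc N)" t] show ?case by simp
  qed
  show "(\<lambda>N. 2 / real (Suc N)) \<longlonglongrightarrow> 0"
    using LIMSEQ_Suc[OF lim_const_over_n[of 2]] by simp
qed

section \<open>Projection and truncation in an orthonormal basis\<close>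

definition onproj :: "(nat \<Rightarrow> 'a::real_inner) \<Rightarrow> nat \<Rightarrow> 'a \<Rightarrow> 'a" where
  "onproj e k x = (\<Sum>i<k. inner x (e i) *\<^sub>R e i)"

context
  fixes e :: "nat \<Rightarrow> 'a::real_inner"
  assumes e: "orthonormal_basis e"
begin

lemma onb_inner: "inner (e i) (e j) = (if i = j then 1 else 0)"
  using e by (simp add: orthonormal_basis_def)

lemma onb_norm: "norm (e i) = 1"
  by (simp add: norm_eq_sqrt_inner onb_inner)

lemma onb_distance:
  "(norm (x - (\<Sum>i<k. c i *\<^sub>R e i)))\<^sup>2 = (norm x)\<^sup>2 - 2 * (\<Sum>i<k. c i * inner x (e i)) + (\<Sum>i<k. (c i)\<^sup>2)"
proof -
  have "inner (\<Sum>i<k. c i *\<^sub>R e i) (\<Sum>i<k. c i *\<^sub>R e i) = (\<Sum>i<k. (c i)\<^sup>2)"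
    by (simp add: inner_sum_left inner_sum_right onb_inner power2_eq_square if_distrib sum.delta cong: if_cong)
  moreover have "inner x (\<Sum>i<k. c i *\<^sub>R e i) = (\<Sum>i<k. c i * inner x (e i))"
    by (simp add: inner_sum_right)
  moreover have "(norm (x - y))\<^sup>2 = (norm x)\<^sup>2 - 2 * inner x y + inner y y" for y
    by (simp add: power2_norm_eq_inner inner_diff_left inner_diff_right inner_commute[of y x])
  ultimately show ?thesis by simp
qed

text \<open>Completing the square: the excess of the squared distance is the sum of the
  \<open>(c i - inner x (e i))^2\<close>.\<close>

lemma onproj_best: "norm (x - onproj e k x) \<le> norm (x - (\<Sum>i<k. c i *\<^sub>R e i))"
proof (rule power2_le_imp_le)
  have "(norm (x - (\<Sum>i<k. c i *\<^sub>R e i)))\<^sup>2 - (norm (x - onproj e k x))\<^sup>2 = (\<Sum>i<k. (c i - inner x (e i))\<^sup>2)"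
    unfolding onproj_def onb_distance
    by (simp add: power2_eq_square algebra_simps sum.distrib sum_subtractf sum_distrib_left)
  also have "\<dots> \<ge> 0" by (intro sum_nonneg) auto
  finally show "(norm (x - onproj e k x))\<^sup>2 \<le> (norm (x - (\<Sum>i<k. c i *\<^sub>R e i)))\<^sup>2" by simp
qed simp

lemma onproj_norm: "norm (x - onproj e k x) \<le> norm x"
  using onproj_best[of x k "\<lambda>_. 0"] by simp

text \<open>The dense span has points arbitrarily close to \<open>x\<close>, and each of them is a
  combination of the first \<open>k\<close> vectors for some \<open>k\<close>; from there on the
  projection is at least as close.\<close>

lemma onproj_tendsto: "(\<lambda>k. onproj e k x) \<longlonglongrightarrow> x"
proof (rule LIMSEQ_I)
  fix r :: real assume "r > 0"
  moreover have "x \<in> closure (span (range e))" using e by (simp add: orthonormal_basis_def)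
  ultimately obtain y where y: "y \<in> span (range e)" "dist y x < r" by (auto simp: closure_approachable)
  from span_range_nat[OF y(1)] obtain k c where c: "y = (\<Sum>i<k. c i *\<^sub>R e i)" by blast
  have "norm (onproj e n x - x) < r" if "n \<ge> k" for n
  proof -
    have "(\<Sum>i<n. (if i < k then c i else 0) *\<^sub>R e i) = y"
      unfolding c using that by (auto intro!: sum.mono_neutral_cong_right split: if_splits)
    hence "norm (x - onproj e n x) \<le> norm (x - y)"
      using onproj_best[of x n "\<lambda>i. if i < k then c i else 0"] by simp
    thus ?thesis using y(2) by (simp add: dist_norm norm_minus_commute)
  qed
  thus "\<exists>no. \<forall>n\<ge>no. norm (onproj e n x - x) < r" by blast
qed

definition clip_onproj :: "nat \<Rightarrow> real \<Rightarrow> 'a \<Rightarrow> 'a" where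
  "clip_onproj k N x = (\<Sum>i<k. gelu_clip N (inner x (e i)) *\<^sub>R e i)"

text \<open>A crude bound, but uniform in \<open>N\<close>: it supplies the dominating function for
  the limit in \<open>N\<close>.\<close>

lemma clip_onproj_error:
  assumes "1 \<le> N"
  shows "norm (clip_onproj k N x - x) \<le> (1 + real k) * norm x + 2 * real k"
proof -
  have "clip_onproj k N x - x = (\<Sum>i<k. (gelu_clip N (inner x (e i)) - inner x (e i)) *\<^sub>R e i) - (x - onproj e k x)"
    by (simp add: clip_onproj_def onproj_def scaleR_left_diff_distrib sum_subtractf)
  also have "norm \<dots> \<le> (\<Sum>i<k. norm x + 2) + norm x"
  proof (rule order_trans[OF norm_triangle_ineq4], intro add_mono onproj_norm sum_norm_le)
    fix i
    have "\<bar>gelu_clip N (inner x (e i)) - inner x (e i)\<bar> \<le> \<bar>inner x (e i)\<bar> + 2"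
      by (rule gelu_clip_diff[OF assms])
    also have "\<bar>inner x (e i)\<bar> \<le> norm x"
      using Cauchy_Schwarz_ineq2[of x "e i"] by (simp add: onb_norm)
    finally show "norm ((gelu_clip N (inner x (e i)) - inner x (e i)) *\<^sub>R e i) \<le> norm x + 2"
      by (simp add: onb_norm)
  qed
  finally show ?thesis by (simp add: algebra_simps)
qed

lemma continuous_clip_onproj: "continuous_on A (clip_onproj k N)"
  unfolding clip_onproj_def
  by (intro continuous_intros continuous_on_compose2[OF continuous_gelu_clip[of UNIV]]) auto

text \<open>Two dominated limits in succession, first in the number \<open>k\<close> of coordinates
  and then, for fixed \<open>k\<close>, in the clipping level \<open>N\<close>. The order matters,
  since the majorant of the second limit grows with \<open>k\<close>.\<close>

lemma clip_onproj_L2: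
  fixes \<mu> :: "'a measure"
  assumes "prob_space \<mu>" and sets: "sets \<mu> = sets borel" and sq: "integrable \<mu> (\<lambda>m. (norm m)\<^sup>2)"
    and d: "d > 0"
  shows "\<exists>k N. 1 \<le> k \<and> 1 \<le> N \<and> integrable \<mu> (\<lambda>m. (norm (clip_onproj k N (m - b) - (m - b)))\<^sup>2) \<and>
    (LINT m|\<mu>. (norm (clip_onproj k N (m - b) - (m - b)))\<^sup>2) \<le> d"
proof -
  interpret prob_space \<mu> by fact
  have meas: "f \<in> borel_measurable \<mu>" if "continuous_on UNIV f" for f :: "'a \<Rightarrow> real"
    using borel_measurable_continuous_onI[OF that] sets by (simp cong: measurable_cong_sets)
  have sqb: "(a * norm (m - b) + c)\<^sup>2 \<le> 4 * a\<^sup>2 * (norm m)\<^sup>2 + (4 * a\<^sup>2 * (norm b)\<^sup>2 + 2 * c\<^sup>2)"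
    if "0 \<le> a" "0 \<le> c" for a c m
  proof -
    have s2: "(x + y)\<^sup>2 \<le> 2 * x\<^sup>2 + 2 * y\<^sup>2" for x y :: real
      using zero_le_power2[of "x - y"] by (simp add: power2_eq_square algebra_simps)
    have "(norm (m - b))\<^sup>2 \<le> (norm m + norm b)\<^sup>2" by (intro power_mono norm_triangle_ineq4) auto
    also have "\<dots> \<le> 2 * (norm m)\<^sup>2 + 2 * (norm b)\<^sup>2" by (rule s2)
    finally have "2 * a\<^sup>2 * (norm (m - b))\<^sup>2 \<le> 2 * a\<^sup>2 * (2 * (norm m)\<^sup>2 + 2 * (norm b)\<^sup>2)"
      by (intro mult_left_mono) auto
    moreover have "(a * norm (m - b) + c)\<^sup>2 \<le> 2 * (a * norm (m - b))\<^sup>2 + 2 * c\<^sup>2" by (rule s2)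
    ultimately show ?thesis by (simp add: power_mult_distrib algebra_simps)
  qed
  have dom: "integrable \<mu> (\<lambda>m. 4 * a\<^sup>2 * (norm m)\<^sup>2 + (4 * a\<^sup>2 * (norm b)\<^sup>2 + 2 * c\<^sup>2))" for a c
    using sq by (intro Bochner_Integration.integrable_add integrable_mult_right) auto
  have "(\<lambda>k. LINT m|\<mu>. (norm ((m - b) - onproj e k (m - b)))\<^sup>2) \<longlonglongrightarrow> (LINT m|\<mu>. 0)"
  proof (rule integral_dominated_convergence[OF _ _ dom[of 1 0]])
    show "AE m in \<mu>. (\<lambda>k. (norm ((m - b) - onproj e k (m - b)))\<^sup>2) \<longlonglongrightarrow> 0"
    proof (rule AE_I2)
      fix m
      have "(\<lambda>k. (norm ((m - b) - onproj e k (m - b)))\<^sup>2) \<longlonglongrightarrow> (norm ((m - b) - (m - b)))\<^sup>2"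
        by (intro tendsto_intros onproj_tendsto)
      thus "(\<lambda>k. (norm ((m - b) - onproj e k (m - b)))\<^sup>2) \<longlonglongrightarrow> 0" by simp
    qed
    show "AE m in \<mu>. norm ((norm ((m - b) - onproj e k (m - b)))\<^sup>2) \<le>
        4 * 1\<^sup>2 * (norm m)\<^sup>2 + (4 * 1\<^sup>2 * (norm b)\<^sup>2 + 2 * 0\<^sup>2)" for k
    proof (rule AE_I2)
      fix m
      have "(norm ((m - b) - onproj e k (m - b)))\<^sup>2 \<le> (1 * norm (m - b) + 0)\<^sup>2"
        using onproj_norm by (intro power_mono) auto
      also note sqb
      finally show "norm ((norm ((m - b) - onproj e k (m - b)))\<^sup>2) \<le>
        4 * 1\<^sup>2 * (norm m)\<^sup>2 + (4 * 1\<^sup>2 * (norm b)\<^sup>2 + 2 * 0\<^sup>2)" by simp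
    qed
    show "(\<lambda>m. (norm ((m - b) - onproj e k (m - b)))\<^sup>2) \<in> borel_measurable \<mu>" for k
      unfolding onproj_def by (intro meas continuous_intros)
  qed simp
  hence "\<forall>\<^sub>F k in sequentially. (LINT m|\<mu>. (norm ((m - b) - onproj e k (m - b)))\<^sup>2) < d"
    using d by (auto dest: order_tendstoD(2))
  \<comment> \<open>The condition \<open>1 \<le> k\<close> anticipates that ranks are
    positive.\<close>
  with eventually_ge_at_top[of 1] have "\<forall>\<^sub>F k in sequentially. 1 \<le> k \<and> (LINT m|\<mu>. (norm ((m - b) - onproj e k (m - b)))\<^sup>2) < d"
    by eventually_elim auto
  then obtain k where k: "1 \<le> k" "(LINT m|\<mu>. (norm ((m - b) - onproj e k (m - b)))\<^sup>2) < d"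
    using eventually_happens'[OF sequentially_bot] by blast
  let ?D = "\<lambda>m. 4 * (1 + real k)\<^sup>2 * (norm m)\<^sup>2 + (4 * (1 + real k)\<^sup>2 * (norm b)\<^sup>2 + 2 * (2 * real k)\<^sup>2)"
  have bound: "norm ((norm (clip_onproj k N (m - b) - (m - b)))\<^sup>2) \<le> ?D m" if "1 \<le> N" for N m
  proof -
    have "(norm (clip_onproj k N (m - b) - (m - b)))\<^sup>2 \<le> ((1 + real k) * norm (m - b) + 2 * real k)\<^sup>2"
      by (intro power_mono clip_onproj_error[OF that]) auto
    also have "\<dots> \<le> ?D m" by (rule sqb) auto
    finally show ?thesis by simp
  qed
  have m: "(\<lambda>m. (norm (clip_onproj k N (m - b) - (m - b)))\<^sup>2) \<in> borel_measurable \<mu>" for N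
    by (intro meas continuous_intros continuous_on_compose2[OF continuous_clip_onproj[of UNIV]]) auto
  have "(\<lambda>N. LINT m|\<mu>. (norm (clip_onproj k (real (Suc N)) (m - b) - (m - b)))\<^sup>2) \<longlonglongrightarrow>
      (LINT m|\<mu>. (norm (onproj e k (m - b) - (m - b)))\<^sup>2)"
  proof (rule integral_dominated_convergence[OF _ m dom])
    show "AE m in \<mu>. (\<lambda>N. (norm (clip_onproj k (real (Suc N)) (m - b) - (m - b)))\<^sup>2) \<longlonglongrightarrow>
      (norm (onproj e k (m - b) - (m - b)))\<^sup>2"
      unfolding clip_onproj_def onproj_def
      by (intro AE_I2 tendsto_intros gelu_clip_tendsto)
    show "AE m in \<mu>. norm ((norm (clip_onproj k (real (Suc N)) (m - b) - (m - b)))\<^sup>2) \<le> ?D m" for N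
      by (intro AE_I2 bound) simp
    show "(\<lambda>m. (norm (onproj e k (m - b) - (m - b)))\<^sup>2) \<in> borel_measurable \<mu>"
      unfolding onproj_def by (intro meas continuous_intros)
  qed
  moreover have "(LINT m|\<mu>. (norm (onproj e k (m - b) - (m - b)))\<^sup>2) < d"
    using k(2) by (simp add: norm_minus_commute)
  ultimately have "\<forall>\<^sub>F N in sequentially. (LINT m|\<mu>. (norm (clip_onproj k (real (Suc N)) (m - b) - (m - b)))\<^sup>2) < d"
    by (rule order_tendstoD(2))
  then obtain N where N: "(LINT m|\<mu>. (norm (clip_onproj k (real (Suc N)) (m - b) - (m - b)))\<^sup>2) < d"
    using eventually_happens'[OF sequentially_bot] by blast
  have "integrable \<mu> (\<lambda>m. (norm (clip_onproj k (real (Suc N)) (m - b) - (m - b)))\<^sup>2)"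
  proof (rule Bochner_Integration.integrable_bound[OF dom m])
    show "AE m in \<mu>. norm ((norm (clip_onproj k (real (Suc N)) (m - b) - (m - b)))\<^sup>2) \<le> norm (?D m)"
      by (intro AE_I2 order_trans[OF bound]) auto
  qed
  thus ?thesis using k(1) N by (intro exI[of _ k] exI[of _ "real (Suc N)"]) auto
qed

end

section \<open>Admissible maps\<close>

lemma Dfr_has_derivative: "f differentiable (at x) \<Longrightarrow> (f has_derivative blinfun_apply (Dfr f x)) (at x)"
  unfolding frechet_derivative_works Dfr_def
  by (subst bounded_linear_Blinfun_apply) (auto dest: has_derivative_bounded_linear)

lemma Dfr_eq: "(f has_derivative blinfun_apply L) (at x) \<Longrightarrow> Dfr f x = L"
  unfolding Dfr_def by (simp add: frechet_derivative_at[symmetric] blinfun_apply_inverse)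

text \<open>Cauchy-Schwarz in the coordinates. Assumption A bounds Hilbert-Schmidt norms, whereas
  the chain rule uses operator norms.\<close>

lemma norm_le_hs_norm: "norm A \<le> hs_norm (A :: 'z::euclidean_space \<Rightarrow>\<^sub>L 'u::real_inner)"
proof (rule norm_blinfun_bound)
  show "0 \<le> hs_norm A" unfolding hs_norm_def by (intro real_sqrt_ge_zero sum_nonneg) auto
  fix x
  have "norm (A x) = norm (\<Sum>b\<in>Basis. (x \<bullet> b) *\<^sub>R A b)"
    by (subst euclidean_representation[of x, symmetric])
       (simp only: blinfun.sum_right blinfun.scaleR_right)
  also have "\<dots> \<le> (\<Sum>b\<in>Basis. \<bar>x \<bullet> b\<bar> * \<bar>norm (A b)\<bar>)"
    by (intro sum_norm_le) simp
  also have "\<dots> \<le> L2_set (\<lambda>b. x \<bullet> b) Basis * L2_set (\<lambda>b. norm (A b)) Basis"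
    by (rule L2_set_mult_ineq)
  also have "L2_set (\<lambda>b. x \<bullet> b) Basis = norm x"
    using euclidean_dist_l2[of x 0] by (simp add: L2_set_def dist_real_def)
  finally show "norm (A x) \<le> hs_norm A * norm x" by (simp add: hs_norm_def L2_set_def mult.commute)
qed

text \<open>The properties of \<open>v\<close> needed to differentiate \<open>E Q(v(m, z), m, z)\<close> under the integral.\<close>

definition admissible ::
  "('m::real_normed_vector \<Rightarrow> 'z::real_normed_vector \<Rightarrow> 'u::real_normed_vector) \<Rightarrow> ('m \<Rightarrow> 'z \<Rightarrow> 'z \<Rightarrow>\<^sub>L 'u) \<Rightarrow> 'z set \<Rightarrow> bool" where
  "admissible v v' W \<longleftrightarrow> has_zderiv v v' W \<and>
     (\<forall>z\<in>W. continuous_on UNIV (\<lambda>m. v m z)) \<and> (\<forall>z\<in>W. \<forall>w. continuous_on UNIV (\<lambda>m. v' m z w)) \<and>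
     (\<exists>C\<ge>0. \<forall>m. \<forall>z\<in>W. norm (v m z) \<le> C * (1 + norm m) \<and> norm (v' m z) \<le> C * (1 + norm m))"

lemma admissible_const: "admissible (\<lambda>m z. c) (\<lambda>m z. 0) W"
  unfolding admissible_def
proof (intro conjI)
  show "\<exists>C\<ge>0. \<forall>m. \<forall>z\<in>W. norm c \<le> C * (1 + norm (m::'a)) \<and> norm (0 :: 'b \<Rightarrow>\<^sub>L 'c) \<le> C * (1 + norm m)"
    by (intro exI[of _ "norm c"]) (auto simp: algebra_simps)
qed (auto simp: has_zderiv_def zero_blinfun.rep_eq)

lemma admissible_add:
  assumes "admissible f f' W" "admissible g g' W"
  shows "admissible (\<lambda>m z. f m z + g m z) (\<lambda>m z. f' m z + g' m z) W"
proof -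
  from assms obtain C D where C: "0 \<le> C" "\<And>m z. z \<in> W \<Longrightarrow> norm (f m z) \<le> C * (1 + norm m) \<and> norm (f' m z) \<le> C * (1 + norm m)"
    and D: "0 \<le> D" "\<And>m z. z \<in> W \<Longrightarrow> norm (g m z) \<le> D * (1 + norm m) \<and> norm (g' m z) \<le> D * (1 + norm m)"
    unfolding admissible_def by blast
  have "norm (f m z + g m z) \<le> (C + D) * (1 + norm m) \<and> norm (f' m z + g' m z) \<le> (C + D) * (1 + norm m)" if "z \<in> W" for m z
    unfolding distrib_right using C(2)[OF that, of m] D(2)[OF that, of m] by (intro conjI norm_triangle_mono) auto
  with C(1) D(1) have "\<exists>C\<ge>0. \<forall>m. \<forall>z\<in>W. norm (f m z + g m z) \<le> C * (1 + norm m) \<and> norm (f' m z + g' m z) \<le> C * (1 + norm m)"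
    by (intro exI[of _ "C + D"]) auto
  with assms show ?thesis
    by (auto simp: admissible_def has_zderiv_def plus_blinfun.rep_eq intro!: has_derivative_add continuous_on_add)
qed

lemma admissible_scale:
  assumes "admissible f f' W"
  shows "admissible (\<lambda>m z. c *\<^sub>R f m z) (\<lambda>m z. c *\<^sub>R f' m z) W"
proof -
  from assms obtain C where C: "0 \<le> C" "\<And>m z. z \<in> W \<Longrightarrow> norm (f m z) \<le> C * (1 + norm m) \<and> norm (f' m z) \<le> C * (1 + norm m)"
    unfolding admissible_def by blast
  have "norm (c *\<^sub>R f m z) \<le> (\<bar>c\<bar> * C) * (1 + norm m) \<and> norm (c *\<^sub>R f' m z) \<le> (\<bar>c\<bar> * C) * (1 + norm m)" if "z \<in> W" for m z
    using C(2)[OF that, of m] by (auto simp: mult.assoc intro: mult_left_mono)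
  with C(1) have "\<exists>C\<ge>0. \<forall>m. \<forall>z\<in>W. norm (c *\<^sub>R f m z) \<le> C * (1 + norm m) \<and> norm (c *\<^sub>R f' m z) \<le> C * (1 + norm m)"
    by (intro exI[of _ "\<bar>c\<bar> * C"]) auto
  with assms show ?thesis
    by (auto simp: admissible_def has_zderiv_def scaleR_blinfun.rep_eq intro!: has_derivative_scaleR_right
        continuous_on_scaleR continuous_on_const)
qed

lemma admissible_tens:
  assumes "admissible f f' W"
  shows "admissible (\<lambda>m z. f m z *\<^sub>R e) (\<lambda>m z. tens (f' m z) e) W"
proof -
  from assms obtain C where C: "0 \<le> C" "\<And>m z. z \<in> W \<Longrightarrow> norm (f m z) \<le> C * (1 + norm m) \<and> norm (f' m z) \<le> C * (1 + norm m)"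
    unfolding admissible_def by blast
  have "norm (f m z *\<^sub>R e) \<le> (C * norm e) * (1 + norm m) \<and> norm (tens (f' m z) e) \<le> (C * norm e) * (1 + norm m)" if "z \<in> W" for m z
  proof -
    have "norm (f m z) * norm e \<le> C * (1 + norm m) * norm e" "norm (f' m z) * norm e \<le> C * (1 + norm m) * norm e"
      using C(2)[OF that, of m] by (auto intro: mult_right_mono)
    thus ?thesis using norm_tens[of "f' m z" e] by (auto simp: algebra_simps)
  qed
  with C(1) have "\<exists>C\<ge>0. \<forall>m. \<forall>z\<in>W. norm (f m z *\<^sub>R e) \<le> C * (1 + norm m) \<and> norm (tens (f' m z) e) \<le> C * (1 + norm m)"
    by (intro exI[of _ "C * norm e"]) auto
  moreover have "has_zderiv (\<lambda>m z. f m z *\<^sub>R e) (\<lambda>m z. tens (f' m z) e) W"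
    unfolding has_zderiv_def
  proof (intro allI ballI)
    fix m z assume "z \<in> W"
    hence "(f m has_derivative f' m z) (at z)" using assms by (auto simp: admissible_def has_zderiv_def)
    from has_derivative_scaleR_left[OF this] show "((\<lambda>z. f m z *\<^sub>R e) has_derivative tens (f' m z) e) (at z)"
      by (rule has_derivative_eq_rhs) (simp add: fun_eq_iff)
  qed
  ultimately show ?thesis using assms
    by (auto simp: admissible_def intro!: continuous_on_scaleR continuous_on_const)
qed

text \<open>Linear growth is preserved because \<open>gelu\<close> vanishes at 0 and has Lipschitz
  constant 2.\<close>

lemma admissible_gelu:
  assumes "admissible f f' W"
  shows "admissible (\<lambda>m z. gelu (f m z)) (\<lambda>m z. dgelu (f m z) *\<^sub>R f' m z) W"
proof -
  from assms obtain C where C: "0 \<le> C" "\<And>m z. z \<in> W \<Longrightarrow> norm (f m z) \<le> C * (1 + norm m) \<and> norm (f' m z) \<le> C * (1 + norm m)"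
    unfolding admissible_def by blast
  have "norm (gelu (f m z)) \<le> (2 * C) * (1 + norm m) \<and> norm (dgelu (f m z) *\<^sub>R f' m z) \<le> (2 * C) * (1 + norm m)" if "z \<in> W" for m z
  proof
    have "\<bar>gelu (f m z)\<bar> \<le> 2 * \<bar>f m z\<bar>"
      using gelu_lipschitz[of "f m z" 0] by (simp add: gelu_def)
    thus "norm (gelu (f m z)) \<le> (2 * C) * (1 + norm m)" using C(2)[OF that, of m] by simp
    have "\<bar>dgelu (f m z)\<bar> * norm (f' m z) \<le> 2 * (C * (1 + norm m))"
      using C(2)[OF that, of m] dgelu_bound by (intro mult_mono) auto
    thus "norm (dgelu (f m z) *\<^sub>R f' m z) \<le> (2 * C) * (1 + norm m)" by simp
  qed
  with C(1) have "\<exists>C\<ge>0. \<forall>m. \<forall>z\<in>W. norm (gelu (f m z)) \<le> C * (1 + norm m) \<and> norm (dgelu (f m z) *\<^sub>R f' m z) \<le> C * (1 + norm m)"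
    by (intro exI[of _ "2 * C"]) auto
  moreover have "has_zderiv (\<lambda>m z. gelu (f m z)) (\<lambda>m z. dgelu (f m z) *\<^sub>R f' m z) W"
    using assms by (intro has_zderiv_comp_real gelu_deriv) (simp add: admissible_def)
  ultimately show ?thesis using assms
    by (auto simp: admissible_def scaleR_blinfun.rep_eq intro!: continuous_on_mult
        continuous_on_compose2[OF continuous_gelu[of UNIV]] continuous_on_compose2[OF continuous_dgelu[of UNIV]])
qed

text \<open>Gives every network function a derivative and linear growth in \<open>m\<close> on the
  whole of \<open>W\<close>, also where nothing is known about its accuracy.\<close>

lemma gelu_span_admissible:
  assumes gens: "\<And>i. i < n \<Longrightarrow> \<exists>X'. admissible (curry (X i)) X' W"
  shows "s \<in> gelu_span X n \<Longrightarrow> \<exists>s'. admissible (curry s) s' W"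
proof (induction rule: gelu_span.induct)
  case (gen i)
  thus ?case by (rule gens)
next
  case (const c)
  show ?case using admissible_const[of c] by (auto simp: curry_def)
next
  case (add f g)
  thus ?case using admissible_add by (fastforce simp: curry_def)
next
  case (scale f c)
  then obtain f' where "admissible (curry f) f' W" by blast
  from admissible_scale[OF this, of c] show ?case by (auto simp: curry_def)
next
  case (gelu f)
  then obtain f' where "admissible (curry f) f' W" by blast
  from admissible_gelu[OF this] show ?case by (auto simp: curry_def)
qed

lemma admissible_sum:
  "finite I \<Longrightarrow> (\<And>i. i \<in> I \<Longrightarrow> admissible (f i) (f' i) W) \<Longrightarrow> admissible (\<lambda>m z. \<Sum>i\<in>I. f i m z) (\<lambda>m z. \<Sum>i\<in>I. f' i m z) W"
  by (induction rule: finite_induct) (simp_all add: admissible_const admissible_add)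

lemma assumption_A_D:
  fixes u :: "'m::{real_inner,polish_space} \<Rightarrow> real ^ 'd \<Rightarrow> 'u::{real_inner,polish_space}"
  assumes A: "assumption_A u \<mu> Zad B p" and p: "2 \<le> p"
  shows "prob_space \<mu>" "sets \<mu> = sets borel" "integrable \<mu> (\<lambda>m. (norm m)\<^sup>2)"
    "has_zderiv u (\<lambda>m z. Dfr (u m) z) B"
    "\<exists>K>0. \<forall>z1\<in>B. \<forall>z2\<in>B. \<forall>m1 m2.
        norm (u m2 z2 - u m1 z1) \<le> K * (norm (m2 - m1) + norm (z2 - z1)) \<and>
        norm (Dfr (u m2) z2 - Dfr (u m1) z1) \<le> K * (norm (m2 - m1) + norm (z2 - z1))"
proof -
  show "prob_space \<mu>" and sets: "sets \<mu> = sets borel" using A by (auto simp: assumption_A_def)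
  then interpret prob_space \<mu> by simp
  have int: "integrable \<mu> (\<lambda>m. norm m powr p)" using A by (auto simp: assumption_A_def)
  show "integrable \<mu> (\<lambda>m. (norm m)\<^sup>2)"
  proof (rule Bochner_Integration.integrable_bound)
    show "integrable \<mu> (\<lambda>m. 1 + norm m powr p)" using int by (intro Bochner_Integration.integrable_add) auto
    show "(\<lambda>m. (norm m)\<^sup>2) \<in> borel_measurable \<mu>"
      using borel_measurable_continuous_onI[of "\<lambda>m::'m. (norm m)\<^sup>2"] sets
      by (simp add: continuous_intros cong: measurable_cong_sets)
    have "(norm m)\<^sup>2 \<le> 1 + norm m powr p" for m :: 'm
    proof (cases "norm m \<le> 1")
      case True
      hence "(norm m)\<^sup>2 \<le> 1" by (simp add: power_le_one)
      thus ?thesis by (smt (verit) powr_ge_zero)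
    next
      case False
      hence "(norm m)\<^sup>2 = norm m powr 2" by (simp add: powr_numeral)
      also have "\<dots> \<le> norm m powr p" using False p by (intro powr_mono) auto
      finally show ?thesis by simp
    qed
    thus "AE m in \<mu>. norm ((norm m)\<^sup>2) \<le> norm (1 + norm m powr p)" by (intro AE_I2) simp
  qed
  have "(\<lambda>(m, z). u m z) differentiable (at (m, z))" if "z \<in> B" for m z
    using A that by (auto simp: assumption_A_def C1_on_def)
  hence "u m differentiable (at z)" if "z \<in> B" for m z
    using differentiable_compose[of "\<lambda>(m, z). u m z" "\<lambda>z. (m, z)" z UNIV] that
    by (auto intro!: derivative_intros)
  thus "has_zderiv u (\<lambda>m z. Dfr (u m) z) B"
    unfolding has_zderiv_def by (intro allI ballI Dfr_has_derivative) auto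
  from A obtain k1 k2 where k: "k1 > 0" "k2 > 0" "\<And>z1 z2 m1 m2. z1 \<in> B \<Longrightarrow> z2 \<in> B \<Longrightarrow>
        norm (u m2 z2 - u m1 z1) \<le> k1 * (norm (m2 - m1) + norm (z2 - z1)) \<and>
        hs_norm (Dfr (u m2) z2 - Dfr (u m1) z1) \<le> k2 * (norm (m2 - m1) + norm (z2 - z1))"
    unfolding assumption_A_def by blast
  show "\<exists>K>0. \<forall>z1\<in>B. \<forall>z2\<in>B. \<forall>m1 m2.
        norm (u m2 z2 - u m1 z1) \<le> K * (norm (m2 - m1) + norm (z2 - z1)) \<and>
        norm (Dfr (u m2) z2 - Dfr (u m1) z1) \<le> K * (norm (m2 - m1) + norm (z2 - z1))"
  proof (intro exI[of _ "k1 + k2"] conjI ballI allI)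
    fix z1 z2 and m1 m2 :: 'm assume z: "z1 \<in> B" "z2 \<in> B"
    let ?d = "norm (m2 - m1) + norm (z2 - z1)"
    have "0 \<le> k1 * ?d" "0 \<le> k2 * ?d" using k by auto
    thus "norm (u m2 z2 - u m1 z1) \<le> (k1 + k2) * ?d"
      "norm (Dfr (u m2) z2 - Dfr (u m1) z1) \<le> (k1 + k2) * ?d"
      using k(3)[OF z, of m2 m1] norm_le_hs_norm[of "Dfr (u m2) z2 - Dfr (u m1) z1"]
      unfolding distrib_right[of k1 k2] by linarith+
  qed (use k in auto)
qed

text \<open>Linear growth follows by comparison with one base point \<open>(0, z0)\<close>; the
  boundedness of \<open>W\<close> turns the distance in \<open>z\<close> into a constant.\<close>

lemma lipschitz_admissible:
  fixes u :: "'m::real_normed_vector \<Rightarrow> 'z::real_normed_vector \<Rightarrow> 'u::real_normed_vector"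
  assumes der: "has_zderiv u u' W" and K: "0 \<le> K" and W: "bounded W"
    and lip: "\<And>m1 m2 z1 z2. z1 \<in> W \<Longrightarrow> z2 \<in> W \<Longrightarrow>
        norm (u m2 z2 - u m1 z1) \<le> K * (norm (m2 - m1) + norm (z2 - z1)) \<and>
        norm (u' m2 z2 - u' m1 z1) \<le> K * (norm (m2 - m1) + norm (z2 - z1))"
  shows "admissible u u' W"
proof -
  have lipschitz_cont: "continuous_on UNIV f" if "\<And>x y. norm (f x - f y) \<le> L * norm (x - y)" "0 \<le> L" for f :: "'m \<Rightarrow> 'u" and L
    by (rule lipschitz_on_continuous_on[of L], rule lipschitz_onI) (use that in \<open>auto simp: dist_norm\<close>)
  have c1: "continuous_on UNIV (\<lambda>m. u m z)" if "z \<in> W" for z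
    by (rule lipschitz_cont[of _ K]) (use lip[OF that that] K in auto)
  have c2: "continuous_on UNIV (\<lambda>m. u' m z w)" if "z \<in> W" for z w
  proof (rule lipschitz_cont[of _ "K * norm w"])
    fix x y
    have "norm (u' x z w - u' y z w) \<le> norm (u' x z - u' y z) * norm w"
      unfolding blinfun.diff_left[symmetric] by (rule norm_blinfun)
    also have "\<dots> \<le> (K * norm (x - y)) * norm w"
      using lip[OF that that, of x y] by (intro mult_right_mono) auto
    finally show "norm (u' x z w - u' y z w) \<le> K * norm w * norm (x - y)" by (simp add: algebra_simps)
  qed (use K in auto)
  have "\<exists>C\<ge>0. \<forall>m. \<forall>z\<in>W. norm (u m z) \<le> C * (1 + norm m) \<and> norm (u' m z) \<le> C * (1 + norm m)"
  proof (cases "W = {}")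
    case False
    then obtain z0 where z0: "z0 \<in> W" by blast
    obtain r where r: "\<And>z. z \<in> W \<Longrightarrow> norm z \<le> r" using W by (auto simp: bounded_iff)
    define c where "c = norm (u 0 z0) + norm (u' 0 z0) + K * (2 * r)"
    have r0: "0 \<le> r" using r[OF z0] norm_ge_zero order_trans by blast
    have c: "0 \<le> c" using K r0 by (simp add: c_def)
    have "norm (u m z) \<le> (c + K) * (1 + norm m) \<and> norm (u' m z) \<le> (c + K) * (1 + norm m)" if "z \<in> W" for m z
    proof -
      have "norm (z - z0) \<le> 2 * r" using norm_triangle_ineq4[of z z0] r[OF that] r[OF z0] by linarith
      hence "K * (norm (m - 0) + norm (z - z0)) \<le> K * (norm m + 2 * r)" using K by (intro mult_left_mono) auto
      moreover have "norm (u m z) \<le> norm (u 0 z0) + norm (u m z - u 0 z0)"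
        "norm (u' m z) \<le> norm (u' 0 z0) + norm (u' m z - u' 0 z0)" by (rule norm_triangle_sub)+
      ultimately have "norm (u m z) \<le> c + K * norm m" "norm (u' m z) \<le> c + K * norm m"
        using lip[OF z0 that, of m 0] norm_ge_zero[of "u 0 z0"] norm_ge_zero[of "u' 0 z0"]
        unfolding c_def distrib_left by linarith+
      moreover have "c + K * norm m \<le> (c + K) * (1 + norm m)" using c K by (simp add: algebra_simps)
      ultimately show ?thesis by linarith
    qed
    thus ?thesis using c K by (intro exI[of _ "c + K"]) auto
  qed auto
  with der c1 c2 show ?thesis by (auto simp: admissible_def)
qed

section \<open>Differentiation under the integral\<close>

text \<open>The mean value inequality on a ball bounds the difference quotients by
  \<open>h m\<close>, so dominated convergence applies, along each sequence tending to
  \<open>z\<close>.\<close>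

lemma has_derivative_integral:
  fixes q :: "'m \<Rightarrow> 'z::real_normed_vector \<Rightarrow> real" and G :: "'m \<Rightarrow> 'z \<Rightarrow> 'z \<Rightarrow>\<^sub>L real"
  assumes W: "open W" "z \<in> W"
    and der: "\<And>m x. x \<in> W \<Longrightarrow> (q m has_derivative blinfun_apply (G m x)) (at x)"
    and mq: "\<And>x. x \<in> W \<Longrightarrow> (\<lambda>m. q m x) \<in> borel_measurable \<mu>"
    and mG: "\<And>w. (\<lambda>m. G m z w) \<in> borel_measurable \<mu>"
    and h: "integrable \<mu> h"
    and bq: "\<And>m x. x \<in> W \<Longrightarrow> \<bar>q m x\<bar> \<le> h m" and bG: "\<And>m x. x \<in> W \<Longrightarrow> norm (G m x) \<le> h m"
  shows "((\<lambda>x. LINT m|\<mu>. q m x) has_derivative (\<lambda>w. LINT m|\<mu>. G m z w)) (at z)"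
    and "\<And>w. integrable \<mu> (\<lambda>m. G m z w)"
proof -
  have h0: "0 \<le> h m" for m using bG[OF W(2), of m] norm_ge_zero order_trans by blast
  have iq: "integrable \<mu> (\<lambda>m. q m x)" if "x \<in> W" for x
    by (rule Bochner_Integration.integrable_bound[OF h mq[OF that]]) (use bq[OF that] h0 in auto)
  have bGw: "\<bar>G m z w\<bar> \<le> h m * norm w" for m w
    using norm_blinfun[of "G m z" w] bG[OF W(2), of m] 
    by (metis mult_right_mono norm_ge_zero order_trans real_norm_def)
  show iG: "integrable \<mu> (\<lambda>m. G m z w)" for w
    by (rule Bochner_Integration.integrable_bound[OF integrable_mult_left[OF h, of "norm w"] mG])
       (use bGw h0 in auto)
  have bl: "bounded_linear (\<lambda>w. LINT m|\<mu>. G m z w)"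
  proof (rule bounded_linear_intro)
    show "(LINT m|\<mu>. G m z (x + y)) = (LINT m|\<mu>. G m z x) + (LINT m|\<mu>. G m z y)" for x y
      unfolding blinfun.add_right by (rule Bochner_Integration.integral_add[OF iG iG])
    show "(LINT m|\<mu>. G m z (r *\<^sub>R x)) = r *\<^sub>R (LINT m|\<mu>. G m z x)" for r x
      unfolding blinfun.scaleR_right by simp
    show "norm (LINT m|\<mu>. G m z x) \<le> norm x * (LINT m|\<mu>. h m)" for x
    proof -
      have "norm (LINT m|\<mu>. G m z x) \<le> (LINT m|\<mu>. h m * norm x)"
        by (rule order_trans[OF Bochner_Integration.integral_norm_bound], rule integral_mono)
           (use bGw iG in \<open>auto intro!: integrable_mult_left h integrable_norm\<close>)
      thus ?thesis by (simp add: mult.commute)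
    qed
  qed
  obtain r where r: "r > 0" "ball z r \<subseteq> W" using W by (auto simp: open_contains_ball)
  have lipq: "\<bar>q m x - q m z\<bar> \<le> h m * norm (x - z)" if "x \<in> ball z r" for m x
  proof -
    have "norm (q m x - q m z) \<le> h m * norm (x - z)"
    proof (rule differentiable_bound[where S="ball z r" and f'="\<lambda>x. blinfun_apply (G m x)"])
      show "(q m has_derivative blinfun_apply (G m y)) (at y within ball z r)" if "y \<in> ball z r" for y
        by (rule has_derivative_at_withinI, rule der) (use that r(2) in blast)
      show "onorm (blinfun_apply (G m y)) \<le> h m" if "y \<in> ball z r" for y
        using bG[of y m] that r(2) by (auto simp: norm_blinfun.rep_eq)
    qed (use that r in auto)
    thus ?thesis by simp
  qed
  let ?F = "\<lambda>x. LINT m|\<mu>. q m x"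
  let ?E = "\<lambda>y. norm ((?F y - ?F z) - (LINT m|\<mu>. G m z (y - z))) / norm (y - z)"
  have "(?E \<longlongrightarrow> 0) (at z)"
    unfolding tendsto_at_iff_sequentially comp_def
  proof (intro allI impI)
    fix X assume Xne: "\<forall>i. X i \<in> UNIV - {z}" and X: "X \<longlonglongrightarrow> z"
    \<comment> \<open>Dropping finitely many terms leaves a sequence that stays inside the
      ball.\<close>
    obtain n where n: "\<And>i. i \<ge> n \<Longrightarrow> X i \<in> ball z r"
      using X r(1) unfolding lim_sequentially by (metis dist_commute mem_ball)
    define Y where "Y = (\<lambda>i. X (i + n))"
    have Y: "Y i \<in> ball z r" "Y i \<in> W" "Y i \<noteq> z" for i using n[of "i + n"] r Xne by (auto simp: Y_def)
    have Yz: "Y \<longlonglongrightarrow> z" unfolding Y_def using X by (rule LIMSEQ_ignore_initial_segment)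
    let ?e = "\<lambda>i m. \<bar>(q m (Y i) - q m z) - G m z (Y i - z)\<bar> / norm (Y i - z)"
    \<comment> \<open>One \<open>h m\<close> comes from the difference quotient, the other from the
      linear term.\<close>
    have be: "?e i m \<le> 2 * h m" for i m
    proof -
      have "\<bar>(q m (Y i) - q m z) - G m z (Y i - z)\<bar> \<le> 2 * h m * norm (Y i - z)"
        using lipq[OF Y(1)[of i], of m] bGw[of m "Y i - z"] by linarith
      thus ?thesis using Y(3)[of i] by (simp add: divide_le_eq)
    qed
    have me: "?e i \<in> borel_measurable \<mu>" for i
      using mq[OF Y(2)[of i]] mq[OF W(2)] mG by measurable
    have ie: "integrable \<mu> (?e i)" for i
      by (rule Bochner_Integration.integrable_bound[OF integrable_mult_right[OF h, of 2] me])
         (use be h0 in auto)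
    have "(\<lambda>i. LINT m|\<mu>. ?e i m) \<longlonglongrightarrow> (LINT m|\<mu>. 0)"
    proof (rule integral_dominated_convergence[OF _ me integrable_mult_right[OF h, of 2]])
      show "AE m in \<mu>. (\<lambda>i. ?e i m) \<longlonglongrightarrow> 0"
      proof (rule AE_I2)
        fix m
        have "((\<lambda>y. norm ((q m y - q m z) - G m z (y - z)) / norm (y - z)) \<longlongrightarrow> 0) (at z)"
          using der[OF W(2), of m] by (simp add: has_derivative_iff_norm)
        thus "(\<lambda>i. ?e i m) \<longlonglongrightarrow> 0"
          using Yz Y(3) unfolding tendsto_at_iff_sequentially comp_def by (auto dest!: spec[of _ Y])
      qed
      show "AE m in \<mu>. norm (?e i m) \<le> 2 * h m" for i
        using be by (intro AE_I2) simp
    qed simp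
    hence lim: "(\<lambda>i. LINT m|\<mu>. ?e i m) \<longlonglongrightarrow> 0" by simp
    have "(\<lambda>i. ?E (Y i)) \<longlonglongrightarrow> 0"
    proof (rule Lim_null_comparison[OF always_eventually lim], rule allI)
      fix i
      have "(?F (Y i) - ?F z) - (LINT m|\<mu>. G m z (Y i - z)) = (LINT m|\<mu>. (q m (Y i) - q m z) - G m z (Y i - z))"
        using iq[OF Y(2)[of i]] iq[OF W(2)] iG by simp
      also have "norm \<dots> \<le> (LINT m|\<mu>. norm ((q m (Y i) - q m z) - G m z (Y i - z)))"
        by (rule Bochner_Integration.integral_norm_bound)
      finally have "?E (Y i) \<le> (LINT m|\<mu>. norm ((q m (Y i) - q m z) - G m z (Y i - z))) / norm (Y i - z)"
        by (rule divide_right_mono) simp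
      thus "norm (?E (Y i)) \<le> (LINT m|\<mu>. ?e i m)" by simp
    qed
    thus "(\<lambda>i. ?E (X i)) \<longlonglongrightarrow> 0" unfolding Y_def by (rule LIMSEQ_offset)
  qed
  with bl show "(?F has_derivative (\<lambda>w. LINT m|\<mu>. G m z w)) (at z)"
    by (simp add: has_derivative_iff_norm)
qed

text \<open>On the segment the norm is at most \<open>norm x + norm y\<close>, so a linearly growing
  derivative gives a linearly growing Lipschitz constant. This serves for \<open>Q\<close> and for
  \<open>Dz Q\<close> as functions of their first argument.\<close>

lemma blinfun_lipschitz_in_first:
  fixes g :: "'u::real_inner \<Rightarrow> 'b::real_normed_vector" and g' :: "'u \<Rightarrow> 'u \<Rightarrow>\<^sub>L 'b"
  assumes der: "\<And>x. (g has_derivative blinfun_apply (g' x)) (at x)"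
    and bd: "\<And>x. norm (g' x) \<le> M + K * norm x" and K: "0 \<le> K"
  shows "norm (g y - g x) \<le> (M + K * (norm x + norm y)) * norm (y - x)"
proof (rule differentiable_bound[where S="closed_segment x y" and f'="\<lambda>x. blinfun_apply (g' x)"])
  fix w assume "w \<in> closed_segment x y"
  then obtain t where t: "0 \<le> t" "t \<le> 1" "w = (1 - t) *\<^sub>R x + t *\<^sub>R y" by (auto simp: in_segment)
  have "norm w \<le> (1 - t) * norm x + t * norm y"
    unfolding t(3) using t(1,2) by (intro order_trans[OF norm_triangle_ineq]) simp
  also have "\<dots> \<le> norm x + norm y" using t(1,2) by (intro add_mono mult_left_le_one_le) auto
  finally have "K * norm w \<le> K * (norm x + norm y)" using K by (intro mult_left_mono)
  thus "onorm (blinfun_apply (g' w)) \<le> M + K * (norm x + norm y)"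
    using bd[of w] by (simp add: norm_blinfun.rep_eq)
qed (auto intro: has_derivative_at_withinI der)

section \<open>Growth of the integrand and derivative of the expectation\<close>

definition integrand_deriv ::
  "('u::real_normed_vector \<Rightarrow> 'm \<Rightarrow> 'z::real_normed_vector \<Rightarrow> real) \<Rightarrow> ('m \<Rightarrow> 'z \<Rightarrow> 'u) \<Rightarrow> ('m \<Rightarrow> 'z \<Rightarrow> 'z \<Rightarrow>\<^sub>L 'u) \<Rightarrow>
   'm \<Rightarrow> 'z \<Rightarrow> 'z \<Rightarrow>\<^sub>L real" where
  "integrand_deriv Q v v' m z = (Du Q (v m z) m z o\<^sub>L v' m z) + Dz Q (v m z) m z"

context
  fixes Q :: "'u::{real_inner,polish_space} \<Rightarrow> 'm::{real_inner,polish_space} \<Rightarrow> real ^ 'd \<Rightarrow> real"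
    and Zad B :: "(real ^ 'd) set"
  assumes AB: "assumption_B Q Zad B"
begin

abbreviation "Qt \<equiv> \<lambda>(v, m, z). Q v m z"

lemma Qt_deriv: "z \<in> B \<Longrightarrow> (Qt has_derivative blinfun_apply (Dfr Qt (v, m, z))) (at (v, m, z))"
  using AB by (intro Dfr_has_derivative) (auto simp: assumption_B_def C2_on_def C1_on_def)

lemma Qt_cont: "continuous_on (UNIV \<times> UNIV \<times> B) Qt"
proof (rule differentiable_imp_continuous_on, unfold differentiable_on_def, intro ballI)
  fix x assume "x \<in> (UNIV \<times> UNIV \<times> B :: ('u \<times> 'm \<times> (real ^ 'd)) set)"
  thus "Qt differentiable (at x within UNIV \<times> UNIV \<times> B)"
    using AB by (rule_tac differentiable_at_withinI) (auto simp: assumption_B_def C2_on_def C1_on_def)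
qed

lemma DQt_cont: "continuous_on (UNIV \<times> UNIV \<times> B) (Dfr Qt)"
  using AB by (auto simp: assumption_B_def C2_on_def C1_on_def)

lemma DQt_diff: "z \<in> B \<Longrightarrow> Dfr Qt differentiable (at (v, m, z))"
  using AB by (auto simp: assumption_B_def C2_on_def C1_on_def)

lemma bounded_linear_emb: "bounded_linear (\<lambda>a::'u. (a, 0::'m, 0::real ^ 'd))"
  "bounded_linear (\<lambda>w::real ^ 'd. (0::'u, 0::'m, w))"
  by (intro bounded_linear_Pair bounded_linear_ident bounded_linear_zero)+

lemma Du_deriv:
  assumes "z \<in> B"
  shows "((\<lambda>w. Q w m z) has_derivative (\<lambda>a. Dfr Qt (v, m, z) (a, 0, 0))) (at v)"
proof -
  have "((\<lambda>w. (w, m, z)) has_derivative (\<lambda>a. (a, 0, 0))) (at v)"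
    by (intro has_derivative_Pair has_derivative_ident has_derivative_const)
  from has_derivative_compose[OF this, of Qt "blinfun_apply (Dfr Qt (v, m, z))"] Qt_deriv[OF assms]
  show ?thesis by simp
qed

lemma Dz_deriv:
  assumes "z \<in> B"
  shows "(Q v m has_derivative (\<lambda>w. Dfr Qt (v, m, z) (0, 0, w))) (at z)"
proof -
  have "((\<lambda>x. (v, m, x)) has_derivative (\<lambda>w. (0, 0, w))) (at z)"
    by (intro has_derivative_Pair has_derivative_ident has_derivative_const)
  from has_derivative_compose[OF this, of Qt "blinfun_apply (Dfr Qt (v, m, z))"] Qt_deriv[OF assms]
  show ?thesis by simp
qed

lemma Du_eq: "z \<in> B \<Longrightarrow> Du Q v m z = Dfr Qt (v, m, z) o\<^sub>L Blinfun (\<lambda>a. (a, 0, 0))"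
  unfolding Du_def
  by (rule Dfr_eq, rule has_derivative_eq_rhs[OF Du_deriv])
     (auto simp: fun_eq_iff bounded_linear_Blinfun_apply[OF bounded_linear_emb(1)])

lemma Dz_eq: "z \<in> B \<Longrightarrow> Dz Q v m z = Dfr Qt (v, m, z) o\<^sub>L Blinfun (\<lambda>w. (0, 0, w))"
  unfolding Dz_def
  by (rule Dfr_eq, rule has_derivative_eq_rhs[OF Dz_deriv])
     (auto simp: fun_eq_iff bounded_linear_Blinfun_apply[OF bounded_linear_emb(2)])

lemma Du_apply: "z \<in> B \<Longrightarrow> Du Q v m z a = Dfr Qt (v, m, z) (a, 0, 0)"
  by (simp add: Du_eq bounded_linear_Blinfun_apply[OF bounded_linear_emb(1)])

lemma Dz_apply: "z \<in> B \<Longrightarrow> Dz Q v m z w = Dfr Qt (v, m, z) (0, 0, w)"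
  by (simp add: Dz_eq bounded_linear_Blinfun_apply[OF bounded_linear_emb(2)])

lemma Duz_deriv:
  assumes z: "z \<in> B"
  shows "((\<lambda>w. Dz Q w m z) has_derivative blinfun_apply (Duz Q v m z)) (at v)"
  unfolding Duz_def
proof (rule Dfr_has_derivative)
  have "((\<lambda>w. (w, m, z)) has_derivative (\<lambda>a. (a, 0, 0))) (at v)"
    by (intro has_derivative_Pair has_derivative_ident has_derivative_const)
  from has_derivative_compose[OF this Dfr_has_derivative[OF DQt_diff[OF z]]]
  have "(\<lambda>w. Dfr Qt (w, m, z)) differentiable (at v)" by (auto simp: differentiable_def)
  then obtain D where "((\<lambda>w. Dfr Qt (w, m, z)) has_derivative D) (at v)" by (auto simp: differentiable_def)
  \<comment> \<open>The partial derivative is the full one composed with a fixed embedding, and this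
    composition is bounded linear in the full derivative.\<close>
  from bounded_linear.has_derivative[OF bounded_bilinear.bounded_linear_left[OF bounded_bilinear_blinfun_compose] this]
  show "(\<lambda>w. Dz Q w m z) differentiable (at v)"
    unfolding Dz_eq[OF z] differentiable_def by blast
qed

text \<open>Bounds at 0 and Lipschitz continuity give linear growth of \<open>Du Q\<close> and
  \<open>Duz Q\<close>; integrating once more in the first argument gives quadratic growth of
  \<open>Q\<close> and \<open>Dz Q\<close>. This growth is matched by the second moment of
  \<open>\<mu>\<close>.\<close>

lemma Q_bounds:
  obtains K M where "0 \<le> K" "0 \<le> M"
    "\<And>v w m z. z \<in> B \<Longrightarrow> norm (Du Q w m z - Du Q v m z) \<le> K * norm (w - v)"
    "\<And>v w m z. z \<in> B \<Longrightarrow> norm (Dz Q w m z - Dz Q v m z) \<le> (M + K * (norm v + norm w)) * norm (w - v)"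
    "\<And>v m z. z \<in> B \<Longrightarrow> norm (Du Q v m z) \<le> M + K * norm v"
    "\<And>v m z. z \<in> B \<Longrightarrow> norm (Dz Q v m z) \<le> M + (M + K * norm v) * norm v"
    "\<And>v m z. z \<in> B \<Longrightarrow> \<bar>Q v m z\<bar> \<le> M + (M + K * norm v) * norm v"
proof -
  from AB obtain k1 k2 where k: "0 < k1" "0 < k2"
    "\<And>u1 u2 z m. z \<in> B \<Longrightarrow> norm (Du Q u2 m z - Du Q u1 m z) \<le> k1 * norm (u2 - u1) \<and>
        norm (Duz Q u2 m z - Duz Q u1 m z) \<le> k2 * norm (u2 - u1)"
    unfolding assumption_B_def by blast
  from AB obtain m1 m2 m3 m4 where m: "0 \<le> m1" "0 \<le> m2" "0 \<le> m3" "0 \<le> m4"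
    "\<And>z m. z \<in> B \<Longrightarrow> \<bar>Q 0 m z\<bar> \<le> m1 \<and> norm (Du Q 0 m z) \<le> m2 \<and>
        norm (Dz Q 0 m z) \<le> m3 \<and> norm (Duz Q 0 m z) \<le> m4"
    unfolding assumption_B_def by blast
  define K where "K = k1 + k2"
  define M where "M = m1 + m2 + m3 + m4"
  have K: "0 \<le> K" and M: "0 \<le> M" using k m by (auto simp: K_def M_def)
  have Klip: "k1 * norm x \<le> K * norm x" "k2 * norm x \<le> K * norm x" for x :: 'u
    using k by (auto simp: K_def intro!: mult_right_mono)
  have du: "norm (Du Q w m z - Du Q v m z) \<le> K * norm (w - v)" if "z \<in> B" for v w m z
    using k(3)[OF that, of w m v] Klip(1)[of "w - v"] by linarith
  have duz: "norm (Duz Q w m z - Duz Q v m z) \<le> K * norm (w - v)" if "z \<in> B" for v w m z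
    using k(3)[OF that, of w m v] Klip(2)[of "w - v"] by linarith
  have 0: "\<bar>Q 0 m z\<bar> \<le> M" "norm (Du Q 0 m z) \<le> M" "norm (Dz Q 0 m z) \<le> M" "norm (Duz Q 0 m z) \<le> M"
    if "z \<in> B" for m z
    using m(5)[OF that, of m] m(1-4) by (auto simp: M_def)
  have Du: "norm (Du Q v m z) \<le> M + K * norm v" if "z \<in> B" for v m z
    using norm_triangle_sub[of "Du Q v m z" "Du Q 0 m z"] du[OF that, of v m 0] 0(2)[OF that, of m] by simp
  have Duz: "norm (Duz Q v m z) \<le> M + K * norm v" if "z \<in> B" for v m z
    using norm_triangle_sub[of "Duz Q v m z" "Duz Q 0 m z"] duz[OF that, of v m 0] 0(4)[OF that, of m] by simp
  have dz: "norm (Dz Q w m z - Dz Q v m z) \<le> (M + K * (norm v + norm w)) * norm (w - v)" if "z \<in> B" for v w m z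
    by (rule blinfun_lipschitz_in_first[OF Duz_deriv[OF that] Duz[OF that] K])
  have q: "norm (Q w m z - Q v m z) \<le> (M + K * (norm v + norm w)) * norm (w - v)" if "z \<in> B" for v w m z
  proof (rule blinfun_lipschitz_in_first[OF _ Du[OF that] K])
    show "((\<lambda>v. Q v m z) has_derivative blinfun_apply (Du Q x m z)) (at x)" for x
      by (rule has_derivative_eq_rhs[OF Du_deriv[OF that]]) (simp add: fun_eq_iff Du_apply[OF that])
  qed
  have Dz: "norm (Dz Q v m z) \<le> M + (M + K * norm v) * norm v" if "z \<in> B" for v m z
    using norm_triangle_sub[of "Dz Q v m z" "Dz Q 0 m z"] dz[OF that, of v m 0] 0(3)[OF that, of m] by simp
  have Q: "\<bar>Q v m z\<bar> \<le> M + (M + K * norm v) * norm v" if "z \<in> B" for v m z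
    using norm_triangle_sub[of "Q v m z" "Q 0 m z"] q[OF that, of v m 0] 0(1)[OF that, of m] by simp
  show ?thesis by (rule that[OF K M du dz Du Dz Q])
qed

lemma integrand_has_derivative:
  assumes z: "z \<in> B" and v: "(v m has_derivative blinfun_apply (v' m z)) (at z)"
  shows "((\<lambda>z. Q (v m z) m z) has_derivative blinfun_apply (integrand_deriv Q v v' m z)) (at z)"
    and "integrand_deriv Q v v' m z w = Dfr Qt (v m z, m, z) (v' m z w, 0, w)"
proof -
  have eq: "integrand_deriv Q v v' m z w = Dfr Qt (v m z, m, z) (v' m z w, 0, w)" for w
    unfolding integrand_deriv_def
    by (simp add: plus_blinfun.rep_eq Du_apply[OF z] Dz_apply[OF z] blinfun.add_right[symmetric])
  thus "integrand_deriv Q v v' m z w = Dfr Qt (v m z, m, z) (v' m z w, 0, w)" .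
  have "((\<lambda>z. (v m z, m, z)) has_derivative (\<lambda>w. (v' m z w, 0, w))) (at z)"
    by (intro has_derivative_Pair has_derivative_ident has_derivative_const v)
  from has_derivative_compose[OF this, of Qt "blinfun_apply (Dfr Qt (v m z, m, z))"] Qt_deriv[OF z]
  show "((\<lambda>z. Q (v m z) m z) has_derivative blinfun_apply (integrand_deriv Q v v' m z)) (at z)"
    by (subst has_derivative_eq_rhs[of _ "\<lambda>w. Dfr Qt (v m z, m, z) (v' m z w, 0, w)"]) (simp_all add: fun_eq_iff eq)
qed

lemma objective_has_derivative:
  fixes \<mu> :: "'m measure"
  assumes ad: "admissible v v' W" and W: "open W" "W \<subseteq> B" "z \<in> W"
    and "prob_space \<mu>" and sets: "sets \<mu> = sets borel" and sq: "integrable \<mu> (\<lambda>m. (norm m)\<^sup>2)"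
  shows "((\<lambda>z. LINT m|\<mu>. Q (v m z) m z) has_derivative (\<lambda>w. LINT m|\<mu>. integrand_deriv Q v v' m z w)) (at z)"
    and "\<And>w. integrable \<mu> (\<lambda>m. integrand_deriv Q v v' m z w)"
proof -
  interpret prob_space \<mu> by fact
  have meas: "f \<in> borel_measurable \<mu>" if "continuous_on UNIV f" for f :: "'m \<Rightarrow> real"
    using borel_measurable_continuous_onI[OF that] sets by (simp cong: measurable_cong_sets)
  obtain K M where KM: "0 \<le> K" "0 \<le> M" and
    Du: "\<And>v m z. z \<in> B \<Longrightarrow> norm (Du Q v m z) \<le> M + K * norm v" and
    Dz: "\<And>v m z. z \<in> B \<Longrightarrow> norm (Dz Q v m z) \<le> M + (M + K * norm v) * norm v" and
    Qb: "\<And>v m z. z \<in> B \<Longrightarrow> \<bar>Q v m z\<bar> \<le> M + (M + K * norm v) * norm v"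
    using Q_bounds by metis
  from ad obtain C where C: "0 \<le> C" "\<And>m z. z \<in> W \<Longrightarrow> norm (v m z) \<le> C * (1 + norm m)"
     "\<And>m z. z \<in> W \<Longrightarrow> norm (v' m z) \<le> C * (1 + norm m)" unfolding admissible_def by blast
  \<comment> \<open>\<open>M\<close> stands for the values at 0; one of the two equal terms bounds
    the growth of \<open>Q\<close> and \<open>Dz Q\<close>, the other the composition of
    \<open>Du Q\<close> with \<open>v'\<close>.\<close>
  define D where "D = M + (M + K * C) * C + (M + K * C) * C"
  define h where "h = (\<lambda>m::'m. D * (1 + norm m)\<^sup>2)"
  have int: "integrable \<mu> h"
  proof -
    have "integrable \<mu> (\<lambda>m. norm m)"
    proof (rule Bochner_Integration.integrable_bound)
      show "integrable \<mu> (\<lambda>m. 1 + (norm m)\<^sup>2)" using sq by (intro Bochner_Integration.integrable_add) auto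
      show "(\<lambda>m. norm m) \<in> borel_measurable \<mu>" by (intro meas continuous_intros)
      have "\<bar>norm m\<bar> \<le> 1 + (norm m)\<^sup>2" for m :: 'm
        using zero_le_power2[of "norm m - 1"] by (simp add: power2_diff) (smt (verit) zero_le_power2)
      thus "AE m in \<mu>. norm (norm m) \<le> norm (1 + (norm m)\<^sup>2)" by (intro AE_I2) simp
    qed
    hence "integrable \<mu> (\<lambda>m. D * (1 + (2 * norm m + (norm m)\<^sup>2)))"
      using sq by (intro integrable_mult_right Bochner_Integration.integrable_add) auto
    thus ?thesis unfolding h_def by (simp add: power2_sum algebra_simps)
  qed
  \<comment> \<open>\<open>a\<close> will be \<open>1 + norm m\<close>; by \<open>1 \<le> a\<close>
    the constant \<open>M\<close> is absorbed into \<open>M * a\<close>.\<close>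
  have main: "(M + K * x) * y \<le> ((M + K * C) * C) * a\<^sup>2" if "0 \<le> x" "0 \<le> y" "x \<le> C * a" "y \<le> C * a" "1 \<le> a" for x y a
  proof -
    have "M * 1 \<le> M * a" "K * x \<le> K * (C * a)" using that KM by (intro mult_left_mono; simp)+
    hence "M + K * x \<le> (M + K * C) * a" by (simp add: algebra_simps)
    hence "(M + K * x) * y \<le> ((M + K * C) * a) * (C * a)"
      using that KM C(1) by (intro mult_mono) auto
    thus ?thesis by (simp add: power2_eq_square algebra_simps)
  qed
  have one: "M \<le> M * a\<^sup>2" if "1 \<le> a" for a
    using mult_left_mono[of 1 "a\<^sup>2" M] that KM by simp
  have pos: "0 \<le> (M + K * C) * C * a\<^sup>2" for a using KM C by simp
  have vd: "(v m has_derivative blinfun_apply (v' m x)) (at x)" if "x \<in> W" for m x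
    using ad that by (auto simp: admissible_def has_zderiv_def)
  have p1: "((\<lambda>z. Q (v m z) m z) has_derivative blinfun_apply (integrand_deriv Q v v' m x)) (at x)" if "x \<in> W" for m x
    using integrand_has_derivative(1)[of x v m v'] vd[OF that] that W(2) by blast
  have p2: "(\<lambda>m. Q (v m x) m x) \<in> borel_measurable \<mu>" if "x \<in> W" for x
  proof (rule meas)
    have "continuous_on UNIV (\<lambda>m. (v m x, m, x))"
      using ad that by (auto simp: admissible_def intro!: continuous_intros)
    from continuous_on_compose2[OF Qt_cont this] that W show "continuous_on UNIV (\<lambda>m. Q (v m x) m x)" by auto
  qed
  have p3: "(\<lambda>m. integrand_deriv Q v v' m z w) \<in> borel_measurable \<mu>" for w
  proof (rule meas)
    have "continuous_on UNIV (\<lambda>m. (v m z, m, z))"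
      using ad W(3) by (auto simp: admissible_def intro!: continuous_intros)
    from continuous_on_compose2[OF DQt_cont this] W have "continuous_on UNIV (\<lambda>m. Dfr Qt (v m z, m, z))" by auto
    moreover have "continuous_on UNIV (\<lambda>m. (v' m z w, 0::'m, w))"
      using ad W(3) by (auto simp: admissible_def intro!: continuous_on_Pair continuous_on_const)
    ultimately have "continuous_on UNIV (\<lambda>m. Dfr Qt (v m z, m, z) (v' m z w, 0, w))"
      by (rule blinfun.continuous_on)
    thus "continuous_on UNIV (\<lambda>m. integrand_deriv Q v v' m z w)"
      using integrand_has_derivative(2)[of z v _ v' w] vd[OF W(3)] W by auto
  qed
  have p4: "\<bar>Q (v m x) m x\<bar> \<le> h m" and p5: "norm (integrand_deriv Q v v' m x) \<le> h m" if x: "x \<in> W" for m x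
  proof -
    have xB: "x \<in> B" using x W by auto
    have n: "0 \<le> norm (v m x)" "0 \<le> norm (v' m x)" "norm (v m x) \<le> C * (1 + norm m)" "norm (v' m x) \<le> C * (1 + norm m)" "1 \<le> 1 + norm m"
      using C(2)[OF x, of m] C(3)[OF x, of m] by auto
    have hh: "h m = M * (1 + norm m)\<^sup>2 + (M + K * C) * C * (1 + norm m)\<^sup>2 + (M + K * C) * C * (1 + norm m)\<^sup>2"
      by (simp add: h_def D_def distrib_right)
    show "\<bar>Q (v m x) m x\<bar> \<le> h m"
      using Qb[OF xB, of "v m x" m] main[OF n(1,1,3,3,5)] one[OF n(5)] pos[of "1 + norm m"] unfolding hh by linarith
    have "norm (Du Q (v m x) m x o\<^sub>L v' m x) \<le> (M + K * norm (v m x)) * norm (v' m x)"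
      using Du[OF xB, of "v m x" m] by (intro order_trans[OF norm_blinfun_compose] mult_right_mono) auto
    hence "norm (integrand_deriv Q v v' m x) \<le> (M + K * norm (v m x)) * norm (v' m x) + (M + (M + K * norm (v m x)) * norm (v m x))"
      unfolding integrand_deriv_def using Dz[OF xB, of "v m x" m] by (intro norm_triangle_mono) auto
    thus "norm (integrand_deriv Q v v' m x) \<le> h m"
      using main[OF n(1,2,3,4,5)] main[OF n(1,1,3,3,5)] one[OF n(5)] unfolding hh by linarith
  qed
  show "((\<lambda>z. LINT m|\<mu>. Q (v m z) m z) has_derivative (\<lambda>w. LINT m|\<mu>. integrand_deriv Q v v' m z w)) (at z)"
    by (rule has_derivative_integral(1)[OF W(1,3) p1 p2 p3 int p4 p5])
  show "integrable \<mu> (\<lambda>m. integrand_deriv Q v v' m z w)" for w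
    by (rule has_derivative_integral(2)[OF W(1,3) p1 p2 p3 int p4 p5])
qed

text \<open>\<open>Du Q\<close> grows linearly in its first argument, and so does the Lipschitz
  constant of \<open>Dz Q\<close>; hence the factor \<open>1 + a + \<eta>\<close> in addition to
  \<open>\<eta>\<close>. Here \<open>a\<close> will grow linearly in \<open>norm m\<close>.\<close>

lemma integrand_deriv_diff:
  obtains E where "0 \<le> E" "\<And>u u' v v' m z a \<eta>. z \<in> B \<Longrightarrow> norm (u m z) \<le> a \<Longrightarrow> norm (u' m z) \<le> a \<Longrightarrow>
    norm (v m z - u m z) \<le> \<eta> \<Longrightarrow> norm (v' m z - u' m z) \<le> \<eta> \<Longrightarrow>
    norm (integrand_deriv Q v v' m z - integrand_deriv Q u u' m z) \<le> E * ((1 + a + \<eta>) * \<eta>)"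
proof -
  obtain K M where KM: "0 \<le> K" "0 \<le> M" and
    du: "\<And>v w m z. z \<in> B \<Longrightarrow> norm (Du Q w m z - Du Q v m z) \<le> K * norm (w - v)" and
    dz: "\<And>v w m z. z \<in> B \<Longrightarrow> norm (Dz Q w m z - Dz Q v m z) \<le> (M + K * (norm v + norm w)) * norm (w - v)" and
    Du: "\<And>v m z. z \<in> B \<Longrightarrow> norm (Du Q v m z) \<le> M + K * norm v"
    using Q_bounds by metis
  have "norm (integrand_deriv Q v v' m z - integrand_deriv Q u u' m z) \<le> (2 * M + 4 * K) * ((1 + a + \<eta>) * \<eta>)"
    if z: "z \<in> B" and a: "norm (u m z) \<le> a" "norm (u' m z) \<le> a"
      and e: "norm (v m z - u m z) \<le> \<eta>" "norm (v' m z - u' m z) \<le> \<eta>" for u v :: "'m \<Rightarrow> real ^ 'd \<Rightarrow> 'u" and u' v' m z a \<eta>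
  proof -
    have a0: "0 \<le> a" and e0: "0 \<le> \<eta>" using a(1) e(1) norm_ge_zero order_trans by blast+
    have v: "norm (v m z) \<le> a + \<eta>" using norm_triangle_sub[of "v m z" "u m z"] a e by linarith
    let ?DV = "Du Q (v m z) m z" and ?DU = "Du Q (u m z) m z"
    \<comment> \<open>The three terms are due to the error of \<open>v'\<close>, to the change of
      \<open>Du Q\<close> and to the change of \<open>Dz Q\<close>.\<close>
    have "integrand_deriv Q v v' m z - integrand_deriv Q u u' m z =
       (?DV o\<^sub>L (v' m z - u' m z)) + ((?DV - ?DU) o\<^sub>L u' m z) + (Dz Q (v m z) m z - Dz Q (u m z) m z)"
      unfolding integrand_deriv_def by (rule blinfun_eqI) (simp add: blinfun.bilinear_simps)
    also have "norm \<dots> \<le> (M + K * (a + \<eta>)) * \<eta> + (K * \<eta>) * a + (M + K * (a + (a + \<eta>))) * \<eta>"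
    proof (intro norm_triangle_mono)
      have "norm ?DV \<le> M + K * (a + \<eta>)"
        using Du[OF z, of "v m z" m] v KM(1) by (meson add_left_mono mult_left_mono order_trans)
      thus "norm (?DV o\<^sub>L (v' m z - u' m z)) \<le> (M + K * (a + \<eta>)) * \<eta>"
        using e a0 e0 KM by (intro order_trans[OF norm_blinfun_compose] mult_mono) auto
      have "norm (?DV - ?DU) \<le> K * \<eta>"
        using du[OF z, of "v m z" m "u m z"] e(1) KM(1) by (meson mult_left_mono order_trans)
      thus "norm ((?DV - ?DU) o\<^sub>L u' m z) \<le> (K * \<eta>) * a"
        using a e0 KM by (intro order_trans[OF norm_blinfun_compose] mult_mono) auto
      have "M + K * (norm (u m z) + norm (v m z)) \<le> M + K * (a + (a + \<eta>))"
        using a(1) v KM(1) by (intro add_left_mono mult_left_mono add_mono) auto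
      thus "norm (Dz Q (v m z) m z - Dz Q (u m z) m z) \<le> (M + K * (a + (a + \<eta>))) * \<eta>"
        using e(1) a0 e0 KM by (intro order_trans[OF dz[OF z]] mult_mono) auto
    qed
    also have "\<dots> = (2 * M + K * (4 * a + 2 * \<eta>)) * \<eta>" by (simp add: algebra_simps)
    also have "\<dots> \<le> ((2 * M + 4 * K) * (1 + a + \<eta>)) * \<eta>"
    proof (intro mult_right_mono e0)
      have "0 \<le> M * a" "0 \<le> M * \<eta>" "0 \<le> K * \<eta>" using a0 e0 KM by auto
      thus "2 * M + K * (4 * a + 2 * \<eta>) \<le> (2 * M + 4 * K) * (1 + a + \<eta>)" using KM by (simp add: algebra_simps)
    qed
    finally show ?thesis by (simp add: mult.assoc)
  qed
  with KM show ?thesis by (intro that[of "2 * M + 4 * K"]) auto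
qed

end

section \<open>Approximation of the gradient\<close>

lemma Dfr_apply_eq: "(f has_derivative D) (at x) \<Longrightarrow> blinfun_apply (Dfr f x) = D"
  unfolding Dfr_def
  by (simp add: frechet_derivative_at[symmetric] bounded_linear_Blinfun_apply has_derivative_bounded_linear)

lemma (in zapprox) approx_of_S:
  assumes "s \<in> S" "has_zderiv (curry s) s' Z" "\<And>m z. z \<in> Z \<Longrightarrow> \<bar>s (m, z)\<bar> \<le> b" "\<And>m z. z \<in> Z \<Longrightarrow> norm (s' m z) \<le> b"
  shows "approx (curry s) s'"
  unfolding approx_def
proof (intro conjI allI impI)
  show "\<exists>t\<in>S. \<exists>t'. has_zderiv (curry t) t' Z \<and> C1z_near e Z (curry s) s' (curry t) t'" if "e > 0" for e
    by (rule bexI[OF _ assms(1)]) (use assms(2) that in \<open>auto simp: C1z_near_def\<close>)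
  show "\<exists>b. \<forall>m. \<forall>z\<in>Z. \<bar>curry s m z\<bar> \<le> b \<and> norm (s' m z) \<le> b"
    using assms(3,4) by (intro exI[of _ b]) simp
qed (rule assms(2))

text \<open>Arranged in the order in which \<open>surrogate\<close> concatenates its inputs, so that
  elements of the span over \<open>gens\<close> are networks of the required form.\<close>

definition gens ::
  "(nat \<Rightarrow> 'm::real_inner) \<Rightarrow> 'm \<Rightarrow> nat \<Rightarrow> nat \<Rightarrow> 'm \<times> (real ^ 'd) \<Rightarrow> real" where
  "gens \<psi> bm k i = (\<lambda>(m, z). if i < k then inner (m - bm) (\<psi> i) else vec_nth z (from_nat_into UNIV (i - k)))"

lemma surrogate_input:
  fixes z :: "real ^ 'd"
  shows "encode \<psi> k (m - bm) @\<^sub>v coords z = Matrix.vec (k + CARD('d)) (\<lambda>i. gens \<psi> bm k i (m, z))"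
  by (rule eq_vecI) (auto simp: encode_def coords_def gens_def)

lemma zderiv_coord:
  fixes Z :: "(real ^ 'd) set"
  shows "has_zderiv (\<lambda>m z. vec_nth z j) (\<lambda>m z. blinfun_inner_left (axis j 1)) Z"
proof -
  have "((\<lambda>z. vec_nth z j) has_derivative blinfun_apply (blinfun_inner_left (axis j 1))) (at z)" for z :: "real ^ 'd"
    by (rule has_derivative_eq_rhs[OF bounded_linear.has_derivative[OF bounded_linear_vec_nth has_derivative_ident]])
       (simp add: fun_eq_iff inner_axis inner_commute)
  thus ?thesis by (simp add: has_zderiv_def)
qed

lemma norm_coord: "norm (blinfun_inner_left (axis j 1 :: real ^ 'd)) \<le> 1"
proof (rule norm_blinfun_bound)
  show "norm (blinfun_inner_left (axis j 1 :: real ^ 'd) x) \<le> 1 * norm x" for x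
    using component_le_norm_cart[of x j] by (simp add: inner_axis inner_commute)
qed simp

lemma gens_admissible:
  fixes \<psi> :: "nat \<Rightarrow> 'm::real_inner" and W :: "(real ^ 'd) set"
  assumes \<psi>: "orthonormal_basis \<psi>" and W: "bounded W"
  shows "\<exists>X'. admissible (curry (gens \<psi> bm k i)) X' W"
proof (cases "i < k")
  case True
  have "admissible (curry (gens \<psi> bm k i)) (\<lambda>m z. 0) W"
    unfolding admissible_def
  proof (intro conjI)
    show "\<exists>C\<ge>0. \<forall>m. \<forall>z\<in>W. norm (curry (gens \<psi> bm k i) m z) \<le> C * (1 + norm m) \<and>
       norm (0 :: (real ^ 'd) \<Rightarrow>\<^sub>L real) \<le> C * (1 + norm m)"
    proof (intro exI[of _ "1 + norm bm"] conjI allI ballI)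
      fix m z
      have "\<bar>inner (m - bm) (\<psi> i)\<bar> \<le> norm (m - bm)"
        using Cauchy_Schwarz_ineq2[of "m - bm" "\<psi> i"] by (simp add: onb_norm[OF \<psi>])
      also have "\<dots> \<le> norm m + norm bm" by (rule norm_triangle_ineq4)
      also have "\<dots> \<le> (1 + norm bm) * (1 + norm m)" by (simp add: algebra_simps)
      finally show "norm (curry (gens \<psi> bm k i) m z) \<le> (1 + norm bm) * (1 + norm m)"
        using True by (simp add: gens_def)
    qed auto
  qed (use True in \<open>auto simp: has_zderiv_def gens_def curry_def zero_blinfun.rep_eq intro!: continuous_intros\<close>)
  thus ?thesis by blast
next
  case False
  let ?j = "from_nat_into UNIV (i - k)"
  obtain r where r: "\<And>z. z \<in> W \<Longrightarrow> norm z \<le> r" using W by (auto simp: bounded_iff)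
  have eq: "curry (gens \<psi> bm k i) = (\<lambda>m z. vec_nth z ?j)" using False by (auto simp: gens_def fun_eq_iff)
  have "admissible (\<lambda>(m::'m) z. vec_nth z ?j) (\<lambda>m z. blinfun_inner_left (axis ?j 1)) W"
    unfolding admissible_def
  proof (intro conjI zderiv_coord)
    show "\<exists>C\<ge>0. \<forall>m::'m. \<forall>z\<in>W. norm (vec_nth z ?j) \<le> C * (1 + norm m) \<and>
       norm (blinfun_inner_left (axis ?j 1 :: real ^ 'd)) \<le> C * (1 + norm m)"
    proof (intro exI[of _ "1 + \<bar>r\<bar>"] conjI allI ballI)
      fix m :: 'm and z assume z: "z \<in> W"
      have p: "1 + \<bar>r\<bar> \<le> (1 + \<bar>r\<bar>) * (1 + norm m)" by (simp add: algebra_simps)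
      show "norm (vec_nth z ?j) \<le> (1 + \<bar>r\<bar>) * (1 + norm m)"
        using component_le_norm_cart[of z ?j] r[OF z] p by simp
      show "norm (blinfun_inner_left (axis ?j 1 :: real ^ 'd)) \<le> (1 + \<bar>r\<bar>) * (1 + norm m)"
        by (rule order_trans[OF norm_coord order_trans[OF _ p]]) simp
    qed auto
  qed auto
  thus ?thesis unfolding eq by blast
qed

text \<open>The network approximates \<open>u\<close> at the truncated input, a function of finitely
  many bounded coordinates, so its error \<open>d\<close> is uniform in \<open>m\<close>. Returning
  to \<open>m\<close> itself costs the Lipschitz constant times the encoding error; the sum is
  \<open>\<eta>\<close>. Accuracy is obtained on \<open>Zad\<close>, regularity on
  \<open>W\<close>.\<close>

lemma surrogate_approximates:
  fixes u :: "'m::{real_inner,polish_space} \<Rightarrow> real ^ 'd \<Rightarrow> 'u::{real_inner,polish_space}"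
    and \<phi> :: "nat \<Rightarrow> 'u" and \<psi> :: "nat \<Rightarrow> 'm"
  assumes Z: "convex Zad" "bounded Zad" and W: "bounded W" "Zad \<subseteq> W"
    and der: "has_zderiv u u' Zad"
    and K: "0 \<le> K" and lip: "\<And>z1 z2 m1 m2. z1 \<in> Zad \<Longrightarrow> z2 \<in> Zad \<Longrightarrow>
        norm (u m2 z2 - u m1 z1) \<le> K * (norm (m2 - m1) + norm (z2 - z1)) \<and>
        norm (u' m2 z2 - u' m1 z1) \<le> K * (norm (m2 - m1) + norm (z2 - z1))"
    and \<phi>: "orthonormal_basis \<phi>" and \<psi>: "orthonormal_basis \<psi>" and N: "1 \<le> N" and d: "d > 0"
  shows "\<exists>ru g v'. ru \<ge> 1 \<and> gelu_network (k + CARD('d)) ru g \<and>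
    admissible (surrogate \<phi> \<psi> bu bm k ru g) v' W \<and>
    (\<forall>m. \<forall>z\<in>Zad. let \<eta> = d + K * norm (clip_onproj \<psi> k N (m - bm) - (m - bm)) in
       norm (surrogate \<phi> \<psi> bu bm k ru g m z - u m z) \<le> \<eta> \<and> norm (v' m z - u' m z) \<le> \<eta>)"
proof -
  define n where "n = k + CARD('d)"
  let ?X = "gens \<psi> bm k :: nat \<Rightarrow> 'm \<times> (real ^ 'd) \<Rightarrow> real"
  define S where "S = gelu_span ?X n"
  interpret zapprox_dense S Zad \<phi>
  proof unfold_locales
    show "closure (span (range \<phi>)) = UNIV" using \<phi> by (simp add: orthonormal_basis_def)
  qed (simp_all add: S_def gelu_span.const gelu_span.add gelu_span.scale gelu_span.gelu)
  obtain r where r: "\<And>z. z \<in> Zad \<Longrightarrow> norm z \<le> r" using Z(2) by (auto simp: bounded_iff)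
  have coord: "approx (\<lambda>m z. z \<bullet> b) (\<lambda>m z. blinfun_inner_left b)" if "b \<in> Basis" for b :: "real ^ 'd"
  proof -
    obtain j where b: "b = axis j 1" using \<open>b \<in> Basis\<close> by (auto simp: Basis_vec_def)
    have "bij_betw (from_nat_into UNIV) {..<CARD('d)} (UNIV :: 'd set)"
      by (rule bij_betw_from_nat_into_finite) simp
    then obtain i where i: "i < CARD('d)" "from_nat_into UNIV i = j"
      by (metis UNIV_I bij_betwE bij_betw_imp_surj_on imageE lessThan_iff)
    have eq: "curry (?X (k + i)) = (\<lambda>m z. vec_nth z j)" using i by (auto simp: gens_def fun_eq_iff)
    have "approx (curry (?X (k + i))) (\<lambda>m z. blinfun_inner_left (axis j 1))"
    proof (rule approx_of_S[where b="max r 1"])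
      show "?X (k + i) \<in> S" unfolding S_def by (rule gelu_span.gen) (use i in \<open>simp add: n_def\<close>)
      show "has_zderiv (curry (?X (k + i))) (\<lambda>m z. blinfun_inner_left (axis j 1)) Zad"
        unfolding eq by (rule zderiv_coord)
      show "\<bar>?X (k + i) (m, z)\<bar> \<le> max r 1" if "z \<in> Zad" for m z
        using component_le_norm_cart[of z j] r[OF that] i by (simp add: gens_def)
      show "norm (blinfun_inner_left (axis j 1 :: real ^ 'd)) \<le> max r 1"
        using norm_coord[of j] by simp
    qed
    thus ?thesis by (simp add: eq b inner_axis)
  qed
  define y where "y = (\<lambda>i m. gelu_clip N (inner (m - bm) (\<psi> i)))"
  have Y: "approx (\<lambda>m z. y i m) (\<lambda>m z. 0)" if i: "i < k" for i
  proof -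
    have X: "?X i \<in> S" unfolding S_def by (rule gelu_span.gen) (use i in \<open>simp add: n_def\<close>)
    have "(\<lambda>x. gelu_clip N (?X i x)) \<in> S"
      unfolding gelu_clip_def by (intro S_add S_scale S_gelu S_const X)
    from approx_of_S[OF this, of "\<lambda>m z. 0" "N + 2"]
    have "approx (curry (\<lambda>x. gelu_clip N (?X i x))) (\<lambda>m z. 0)"
      using i gelu_clip_bound[OF N] N by (auto simp: has_zderiv_def gens_def curry_def zero_blinfun.rep_eq)
    thus ?thesis using i by (simp add: gens_def curry_def y_def)
  qed
  define mt where "mt = (\<lambda>m. bm + clip_onproj \<psi> k N (m - bm))"
  have mt: "norm (mt m - mt m') \<le> (\<Sum>i<k. \<bar>y i m - y i m'\<bar>)" for m m'
  proof -
    have "mt m - mt m' = (\<Sum>i<k. (y i m - y i m') *\<^sub>R \<psi> i)"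
      by (simp add: mt_def clip_onproj_def[OF \<psi>] y_def scaleR_left_diff_distrib sum_subtractf)
    also have "norm \<dots> \<le> (\<Sum>i<k. \<bar>y i m - y i m'\<bar>)"
      by (rule sum_norm_le) (simp add: onb_norm[OF \<psi>])
    finally show ?thesis .
  qed
  \<comment> \<open>The shift \<open>bu\<close> is removed here because \<open>surrogate\<close>
    adds it again.\<close>
  define f where "f = (\<lambda>m z. u (mt m) z - bu)"
  define f' where "f' = (\<lambda>m z. u' (mt m) z)"
  have V: "vapprox f f'"
  proof (rule vapprox_lipschitz[OF Z(1) coord Y _ _ _ K])
    show "has_zderiv f f' Zad"
      using der unfolding has_zderiv_def f_def f'_def by (auto intro!: derivative_eq_intros)
    show "norm (f m z - f m' z) \<le> K * (\<Sum>i<k. \<bar>y i m - y i m'\<bar>)" if "z \<in> Zad" for m m' z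
    proof -
      have "norm (f m z - f m' z) \<le> K * norm (mt m - mt m')"
        using lip[OF that that, of "mt m" "mt m'"] by (simp add: f_def)
      also have "\<dots> \<le> K * (\<Sum>i<k. \<bar>y i m - y i m'\<bar>)" by (intro mult_left_mono mt K)
      finally show ?thesis .
    qed
    show "norm (f' m z - f' m' z') \<le> K * ((\<Sum>i<k. \<bar>y i m - y i m'\<bar>) + norm (z - z'))" if "z \<in> Zad" "z' \<in> Zad" for m m' z z'
    proof -
      have "norm (f' m z - f' m' z') \<le> K * (norm (mt m - mt m') + norm (z - z'))"
        using lip[OF that(2,1), of "mt m" "mt m'"] by (simp add: f'_def)
      also have "\<dots> \<le> K * ((\<Sum>i<k. \<bar>y i m - y i m'\<bar>) + norm (z - z'))"
        by (intro mult_left_mono add_right_mono mt K)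
      finally show ?thesis .
    qed
  qed
  obtain ru s s' where ru: "ru \<ge> 1" and s: "\<And>i. s i \<in> S"
    and s': "\<And>i. has_zderiv (curry (s i)) (s' i) Zad"
    and near: "C1z_near d Zad f f' (\<lambda>m z. \<Sum>i<ru. s i (m, z) *\<^sub>R \<phi> i) (\<lambda>m z. \<Sum>i<ru. tens (s' i m z) (\<phi> i))"
  proof (rule vapprox_S[OF V d])
    fix ru s s' assume "ru \<ge> 1" "\<And>i. s i \<in> S" "\<And>i. has_zderiv (curry (s i)) (s' i) Zad"
      "C1z_near d Zad f f' (\<lambda>m z. \<Sum>i<ru. s i (m, z) *\<^sub>R \<phi> i) (\<lambda>m z. \<Sum>i<ru. tens (s' i m z) (\<phi> i))"
    thus thesis by (rule that)
  qed
  from gelu_span_network[of ru s ?X n] s obtain g where g: "gelu_network n ru g"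
    "\<And>x. g (Matrix.vec n (\<lambda>i. ?X i x)) = Matrix.vec ru (\<lambda>i. s i x)"
    unfolding S_def by blast
  have sur: "surrogate \<phi> \<psi> bu bm k ru g = (\<lambda>m z. (\<Sum>i<ru. s i (m, z) *\<^sub>R \<phi> i) + bu)"
    unfolding surrogate_def surrogate_input g(2)[unfolded n_def] by (auto simp: fun_eq_iff decode_def)
  have "\<exists>t'. admissible (curry (s i)) t' W" for i
    using s[of i] unfolding S_def by (rule gelu_span_admissible[OF gens_admissible[OF \<psi> W(1)]])
  then obtain t' where t': "\<And>i. admissible (curry (s i)) (t' i) W" by metis
  \<comment> \<open>The final \<open>+ 0\<close> is the derivative of the constant
    \<open>bu\<close>.\<close>
  define v' where "v' = (\<lambda>m z. (\<Sum>i<ru. tens (t' i m z) (\<phi> i)) + 0)"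
  have ad: "admissible (surrogate \<phi> \<psi> bu bm k ru g) v' W"
    unfolding sur v'_def
    by (intro admissible_add admissible_sum admissible_const admissible_tens t'[unfolded curry_def]) auto
  \<comment> \<open>Both are derivatives in the whole space, so they agree on \<open>Zad\<close>:
    the derivative known on \<open>W\<close> inherits the accuracy of the approximating one.\<close>
  have ts: "t' i m z = s' i m z" if "z \<in> Zad" for i m z
  proof (rule blinfun_apply_inject[THEN iffD1], rule has_derivative_unique)
    show "(curry (s i) m has_derivative blinfun_apply (s' i m z)) (at z)"
      by (rule has_zderivD[OF s' that])
    show "(curry (s i) m has_derivative blinfun_apply (t' i m z)) (at z)"
      using t'[of i] that W(2) by (auto simp: admissible_def intro: has_zderivD)
  qed
  have "norm (surrogate \<phi> \<psi> bu bm k ru g m z - u m z) \<le> d + K * norm (clip_onproj \<psi> k N (m - bm) - (m - bm)) \<and>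
     norm (v' m z - u' m z) \<le> d + K * norm (clip_onproj \<psi> k N (m - bm) - (m - bm))" if z: "z \<in> Zad" for m z
  proof
    have mm: "mt m - m = clip_onproj \<psi> k N (m - bm) - (m - bm)" by (simp add: mt_def)
    have l: "norm (u (mt m) z - u m z) \<le> K * norm (mt m - m)" "norm (u' (mt m) z - u' m z) \<le> K * norm (mt m - m)"
      using lip[OF z z, of "mt m" m] by auto
    have n: "norm ((\<Sum>i<ru. s i (m, z) *\<^sub>R \<phi> i) - f m z) \<le> d" "norm ((\<Sum>i<ru. tens (s' i m z) (\<phi> i)) - f' m z) \<le> d"
      using near z by (auto simp: C1z_near_def norm_minus_commute)
    show "norm (surrogate \<phi> \<psi> bu bm k ru g m z - u m z) \<le> d + K * norm (clip_onproj \<psi> k N (m - bm) - (m - bm))"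
      using norm_triangle_mono[OF n(1) l(1)] unfolding mm by (simp add: sur f_def algebra_simps)
    show "norm (v' m z - u' m z) \<le> d + K * norm (clip_onproj \<psi> k N (m - bm) - (m - bm))"
      using norm_triangle_mono[OF n(2) l(2)] unfolding mm by (simp add: v'_def f'_def ts[OF z])
  qed
  with ru g(1) ad show ?thesis unfolding n_def Let_def by blast
qed

section \<open>Stability of the minimizer and choice of the constants\<close>

lemma perturbed_stationary_point:
  fixes J :: "'z::real_inner \<Rightarrow> real"
  assumes sc: "\<And>z1 z2. z1 \<in> B \<Longrightarrow> z2 \<in> B \<Longrightarrow>
        J z2 \<ge> J z1 + blinfun_apply (Dfr J z1) (z2 - z1) + l / 2 * (norm (z2 - z1))\<^sup>2"
    and l: "l > 0" and B: "Zad \<subseteq> B" and min: "\<And>z. z \<in> Zad \<Longrightarrow> J zstar \<le> J z" and zstar: "zstar \<in> Zad"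
    and zd: "zd \<in> Zad" and stat: "T (zstar - zd) \<ge> 0"
    and T: "\<bar>T (zstar - zd) - Dfr J zd (zstar - zd)\<bar> \<le> d * norm (zstar - zd)"
    and d: "0 \<le> d" "d \<le> l * \<epsilon> / 2" "d \<le> \<epsilon>"
  shows "norm (zstar - zd) \<le> \<epsilon> \<and> J zd - J zstar \<le> \<epsilon>\<^sup>2"
proof -
  define r where "r = norm (zstar - zd)"
  have r0: "0 \<le> r" by (simp add: r_def)
  \<comment> \<open>Strong convexity is used once, from \<open>zd\<close> to \<open>zstar\<close>;
    its linear term is at least \<open>- d * r\<close> by stationarity and closeness of the
    gradients. Minimality of \<open>zstar\<close> then bounds \<open>l / 2 * r^2\<close> by
    \<open>d * r\<close>, and so \<open>r\<close> by \<open>2 * d / l\<close>.\<close>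
  have gap: "J zd - J zstar \<le> d * r - l / 2 * r\<^sup>2"
    using sc[OF subsetD[OF B zd] subsetD[OF B zstar]] T stat unfolding r_def[symmetric] by linarith
  hence "l / 2 * r * r \<le> l * \<epsilon> / 2 * r"
    using min[OF zd] mult_right_mono[OF d(2) r0] by (simp add: power2_eq_square)
  hence r: "r \<le> \<epsilon>"
  proof (cases "r = 0")
    case False
    hence "0 < l / 2 * r" using r0 l by simp
    moreover have "(l / 2 * r) * r \<le> (l / 2 * r) * \<epsilon>"
      using \<open>l / 2 * r * r \<le> l * \<epsilon> / 2 * r\<close> by (simp add: algebra_simps)
    ultimately show ?thesis by (simp only: mult_le_cancel_left_pos)
  qed (use d in simp)
  have "J zd - J zstar \<le> d * r" using gap l by (smt (verit) divide_nonneg_pos mult_nonneg_nonneg zero_le_power2)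
  also have "\<dots> \<le> \<epsilon> * \<epsilon>" using d r r0 by (intro mult_mono) auto
  finally show ?thesis using r by (simp add: r_def power2_eq_square)
qed

theorem theorem3p2:
  fixes \<mu> :: "'m::{real_inner,polish_space} measure"
    and u :: "'m \<Rightarrow> real ^ 'd \<Rightarrow> 'u::{real_inner,polish_space}"
    and Q :: "'u \<Rightarrow> 'm \<Rightarrow> real ^ 'd \<Rightarrow> real"
    and P :: "real ^ 'd \<Rightarrow> real"
    and Zad B :: "(real ^ 'd) set"
    and p \<epsilon> :: real
    and \<phi> :: "nat \<Rightarrow> 'u" and \<psi> :: "nat \<Rightarrow> 'm"
    and bu :: 'u and bm :: 'm and zstar :: "real ^ 'd"
  assumes "convex Zad"
    and "p \<ge> 2"
    and "assumption_A u \<mu> Zad B p"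
    and "assumption_B Q Zad B"
    and "C1_on (objective \<mu> Q P u) B"
    and "strongly_convex_on B (objective \<mu> Q P u)"
    and "is_arg_min (objective \<mu> Q P u) (\<lambda>z. z \<in> Zad) zstar"
    and "orthonormal_basis \<phi>"
    and "orthonormal_basis \<psi>"
    and "\<epsilon> > 0"
  shows "\<exists>rm ru g. rm \<ge> 1 \<and> ru \<ge> 1 \<and> gelu_network (rm + CARD('d)) ru g \<and>
    (\<forall>zd\<in>Zad.
       (\<forall>z\<in>Zad. blinfun_apply
           (Dfr (objective \<mu> Q P (surrogate \<phi> \<psi> bu bm rm ru g)) zd) (z - zd) \<ge> 0) \<longrightarrow>
       norm (zstar - zd) \<le> \<epsilon> \<and>
       objective \<mu> Q P u zd - objective \<mu> Q P u zstar \<le> \<epsilon>\<^sup>2)"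
proof -
  note A = assumption_A_D[OF assms(3,2)]
  interpret prob_space \<mu> by (rule A(1))
  have Zad: "compact Zad" "Zad \<subseteq> B" and oB: "open B" using assms(3) by (auto simp: assumption_A_def)
  let ?u' = "\<lambda>m z. Dfr (u m) z"
  let ?J = "objective \<mu> Q P u"
  obtain K where K: "0 < K" and lip: "\<And>z1 z2 m1 m2. z1 \<in> B \<Longrightarrow> z2 \<in> B \<Longrightarrow>
        norm (u m2 z2 - u m1 z1) \<le> K * (norm (m2 - m1) + norm (z2 - z1)) \<and>
        norm (?u' m2 z2 - ?u' m1 z1) \<le> K * (norm (m2 - m1) + norm (z2 - z1))"
    using A(5) by blast
  obtain R where R: "\<And>z. z \<in> Zad \<Longrightarrow> norm z < R"
    using compact_imp_bounded[OF Zad(1)] unfolding bounded_pos_less by blast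
  \<comment> \<open>An open set is needed to differentiate, a bounded one for growth constants
    independent of \<open>z\<close>.\<close>
  define W where "W = B \<inter> ball 0 R"
  have W: "open W" "W \<subseteq> B" "bounded W" "Zad \<subseteq> W" using oB Zad(2) R by (auto simp: W_def)
  have adu: "admissible u ?u' W"
    by (rule lipschitz_admissible[OF _ less_imp_le[OF K] W(3) lip[OF subsetD[OF W(2)] subsetD[OF W(2)]]])
       (use A(4) W(2) in \<open>auto simp: has_zderiv_def\<close>)
  then obtain C where C: "0 \<le> C" "\<And>m z. z \<in> W \<Longrightarrow> norm (u m z) \<le> C * (1 + norm m)"
     "\<And>m z. z \<in> W \<Longrightarrow> norm (?u' m z) \<le> C * (1 + norm m)" unfolding admissible_def by blast
  from assms(6) obtain l where l: "l > 0" "\<And>z1 z2. z1 \<in> B \<Longrightarrow> z2 \<in> B \<Longrightarrow>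
        ?J z2 \<ge> ?J z1 + blinfun_apply (Dfr ?J z1) (z2 - z1) + l / 2 * (norm (z2 - z1))\<^sup>2"
    unfolding strongly_convex_on_def by blast
  \<comment> \<open>The two bounds are those of \<open>perturbed_stationary_point\<close>, for the
    distance and for the gap.\<close>
  define \<delta> where "\<delta> = min (l * \<epsilon> / 2) \<epsilon>"
  have \<delta>: "0 < \<delta>" "\<delta> \<le> l * \<epsilon> / 2" "\<delta> \<le> \<epsilon>" using l(1) assms(10) by (auto simp: \<delta>_def)
  obtain E0 where E0: "0 \<le> E0" "\<And>(u :: 'm \<Rightarrow> real ^ 'd \<Rightarrow> 'u) u' v v' m z a \<eta>. z \<in> B \<Longrightarrow> norm (u m z) \<le> a \<Longrightarrow> norm (u' m z) \<le> a \<Longrightarrow>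
    norm (v m z - u m z) \<le> \<eta> \<Longrightarrow> norm (v' m z - u' m z) \<le> \<eta> \<Longrightarrow>
    norm (integrand_deriv Q v v' m z - integrand_deriv Q u u' m z) \<le> E0 * ((1 + a + \<eta>) * \<eta>)"
    using integrand_deriv_diff[OF assms(4)] by metis
  \<comment> \<open>Makes the constant positive, as it occurs in denominators below.\<close>
  define E where "E = E0 + 1"
  have E: "0 < E" using E0 by (simp add: E_def)
  define a2 where "a2 = (\<lambda>m::'m. 2 * (1 + C)\<^sup>2 + 2 * C\<^sup>2 * (norm m)\<^sup>2)"
  have a2: "(1 + C * (1 + norm m))\<^sup>2 \<le> a2 m" for m
    using zero_le_power2[of "(1 + C) - C * norm m"] by (simp add: a2_def power2_eq_square algebra_simps)
  have ia2: "integrable \<mu> a2" unfolding a2_def using A(3) by (intro Bochner_Integration.integrable_add integrable_mult_right) auto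
  define I where "I = (LINT m|\<mu>. a2 m)"
  have I: "0 \<le> I" unfolding I_def by (rule Bochner_Integration.integral_nonneg) (simp add: a2_def)
  \<comment> \<open>The weight in Young's inequality
    \<open>A * \<eta> \<le> t * A^2 + \<eta>^2 / t\<close>: it makes the mean contribution of the
    growth \<open>A = 1 + C * (1 + norm m)\<close> at most half of
    \<open>\<delta> / E\<close>.\<close>
  define t where "t = \<delta> / (2 * E * (I + 1))"
  have t: "0 < t" using \<delta> E I by (simp add: t_def)
  \<comment> \<open>\<open>q\<close> bounds both the network part \<open>2 * d^2\<close> and the
    mean of the encoding part; together, multiplied by \<open>1 / t + 1\<close>, they make up the
    other half.\<close>
  define q where "q = \<delta> / (4 * E * (1 / t + 1))"
  have q: "0 < q" using \<delta> E t by (simp add: q_def add_pos_pos)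
  define d where "d = sqrt (q / 2)"
  have d: "0 < d" "2 * d\<^sup>2 = q" using q by (auto simp: d_def)
  have "0 < q / (2 * K\<^sup>2)" using q K by simp
  from clip_onproj_L2[OF assms(9) A(1-3) this, of bm] obtain k N where kN: "1 \<le> k" "1 \<le> N"
    and ic: "integrable \<mu> (\<lambda>m. (norm (clip_onproj \<psi> k N (m - bm) - (m - bm)))\<^sup>2)"
    and bc: "(LINT m|\<mu>. (norm (clip_onproj \<psi> k N (m - bm) - (m - bm)))\<^sup>2) \<le> q / (2 * K\<^sup>2)"
    by blast
  define c where "c = (\<lambda>m. norm (clip_onproj \<psi> k N (m - bm) - (m - bm)))"
  have derZ: "has_zderiv u ?u' Zad" using A(4) Zad(2) by (auto simp: has_zderiv_def)
  obtain ru g v' where ru: "1 \<le> ru" and g: "gelu_network (k + CARD('d)) ru g"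
    and adv: "admissible (surrogate \<phi> \<psi> bu bm k ru g) v' W"
    and near: "\<And>m z. z \<in> Zad \<Longrightarrow> norm (surrogate \<phi> \<psi> bu bm k ru g m z - u m z) \<le> d + K * c m"
       "\<And>m z. z \<in> Zad \<Longrightarrow> norm (v' m z - ?u' m z) \<le> d + K * c m"
    using surrogate_approximates[OF assms(1) compact_imp_bounded[OF Zad(1)] W(3,4) derZ less_imp_le[OF K]
        lip[OF subsetD[OF Zad(2)] subsetD[OF Zad(2)]] assms(8,9) kN(2) d(1), where k=k and bu=bu and bm=bm]
    unfolding Let_def c_def by blast
  let ?v = "surrogate \<phi> \<psi> bu bm k ru g"
  \<comment> \<open>An integrable majorant of the gradient error of the integrand, the same for all
    \<open>zd\<close> in \<open>Zad\<close>.\<close>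
  define H where "H = (\<lambda>m. E * (t * a2 m + (1 / t + 1) * (2 * d\<^sup>2 + 2 * K\<^sup>2 * (c m)\<^sup>2)))"
  have iH: "integrable \<mu> H"
    unfolding H_def using ia2 ic by (intro integrable_mult_right Bochner_Integration.integrable_add) (auto simp: c_def)
  have bH: "(LINT m|\<mu>. H m) \<le> \<delta>"
  proof -
    have ic': "integrable \<mu> (\<lambda>m. (c m)\<^sup>2)" using ic by (simp add: c_def)
    have "(LINT m|\<mu>. H m) = E * (t * I + (1 / t + 1) * (2 * d\<^sup>2 + 2 * K\<^sup>2 * (LINT m|\<mu>. (c m)\<^sup>2)))"
      unfolding H_def I_def using ia2 ic' by (simp add: prob_space)
    also have "\<dots> \<le> E * (\<delta> / (2 * E) + (1 / t + 1) * (q + q))"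
    proof (intro mult_left_mono add_mono)
      have "t * I \<le> t * (I + 1)" using t by simp
      also have "\<dots> = \<delta> / (2 * E)" unfolding t_def using I by simp
      finally show "t * I \<le> \<delta> / (2 * E)" .
      have "K\<^sup>2 * (LINT m|\<mu>. (c m)\<^sup>2) \<le> K\<^sup>2 * (q / (2 * K\<^sup>2))"
        using bc by (intro mult_left_mono) (auto simp: c_def)
      thus "2 * K\<^sup>2 * (LINT m|\<mu>. (c m)\<^sup>2) \<le> q" using K by simp
    qed (use d t E in auto)
    also have "(1 / t + 1) * (q + q) = \<delta> / (2 * E)"
      unfolding q_def using t by (auto simp: divide_simps)
    also have "E * (\<delta> / (2 * E) + \<delta> / (2 * E)) = \<delta>" using E by (simp add: field_simps)
    finally show ?thesis .
  qed
  have grad: "\<bar>Dfr (objective \<mu> Q P ?v) zd w - Dfr ?J zd w\<bar> \<le> \<delta> * norm w" if zd: "zd \<in> Zad" for zd w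
  proof -
    have zW: "zd \<in> W" and zB: "zd \<in> B" using zd W by auto
    note hu = objective_has_derivative[OF assms(4) adu W(1,2) zW A(1-3)]
    note hv = objective_has_derivative[OF assms(4) adv W(1,2) zW A(1-3)]
    have hJ: "(?J has_derivative blinfun_apply (Dfr ?J zd)) (at zd)"
      using assms(5) zB by (intro Dfr_has_derivative) (auto simp: C1_on_def)
    define D where "D = (\<lambda>m. integrand_deriv Q ?v v' m zd - integrand_deriv Q u ?u' m zd)"
    have iD: "integrable \<mu> (\<lambda>m. D m w)"
      unfolding D_def blinfun.diff_left by (rule Bochner_Integration.integrable_diff[OF hv(2) hu(2)])
    \<comment> \<open>\<open>P\<close> is recovered as the difference of \<open>?J\<close> and its
      expectation part; its differentiability at \<open>zd\<close> is inherited from these two, and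
      it cancels from the difference of the gradients.\<close>
    from has_derivative_add[OF hv(1) has_derivative_diff[OF hJ hu(1)]]
    have "(objective \<mu> Q P ?v has_derivative (\<lambda>w. (LINT m|\<mu>. integrand_deriv Q ?v v' m zd w) +
        (Dfr ?J zd w - (LINT m|\<mu>. integrand_deriv Q u ?u' m zd w)))) (at zd)"
      by (simp add: objective_def[abs_def])
    from Dfr_apply_eq[OF this]
    have "Dfr (objective \<mu> Q P ?v) zd w - Dfr ?J zd w =
        (LINT m|\<mu>. integrand_deriv Q ?v v' m zd w) - (LINT m|\<mu>. integrand_deriv Q u ?u' m zd w)"
      by simp
    also have "\<dots> = (LINT m|\<mu>. integrand_deriv Q ?v v' m zd w - integrand_deriv Q u ?u' m zd w)"
      by (rule Bochner_Integration.integral_diff[OF hv(2) hu(2), symmetric])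
    also have "\<dots> = (LINT m|\<mu>. D m w)" by (simp add: D_def blinfun.diff_left)
    also have "\<bar>\<dots>\<bar> \<le> (LINT m|\<mu>. norm (D m w))"
      unfolding real_norm_def[symmetric] by (rule Bochner_Integration.integral_norm_bound)
    also have "\<dots> \<le> (LINT m|\<mu>. H m * norm w)"
    proof (rule Bochner_Integration.integral_mono)
      show "integrable \<mu> (\<lambda>m. norm (D m w))" using iD by (rule integrable_norm)
      show "integrable \<mu> (\<lambda>m. H m * norm w)" using iH by simp
      fix m
      let ?a = "C * (1 + norm m)" and ?e = "d + K * c m"
      have e0: "0 \<le> ?e" using d K by (simp add: c_def)
      have e2: "?e\<^sup>2 \<le> 2 * d\<^sup>2 + 2 * K\<^sup>2 * (c m)\<^sup>2"
        using zero_le_power2[of "d - K * c m"] by (simp add: power2_eq_square algebra_simps)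
      have "norm (D m) \<le> E0 * ((1 + ?a + ?e) * ?e)"
        unfolding D_def by (rule E0(2)[of zd u m ?a ?u' ?v ?e v', OF zB C(2,3)[OF zW] near[OF zd]])
      also have "\<dots> \<le> E * ((1 + ?a + ?e) * ?e)"
        using e0 C(1) by (intro mult_right_mono mult_nonneg_nonneg) (auto simp: E_def)
      also have "\<dots> \<le> H m"
        unfolding H_def
      proof (intro mult_left_mono less_imp_le[OF E])
        have "(1 + ?a) * ?e \<le> t * (1 + ?a)\<^sup>2 + 1 / t * ?e\<^sup>2"
        proof -
          \<comment> \<open>Expanding the square turns this into Young's inequality multiplied by
            \<open>t\<close>.\<close>
          have "0 \<le> (t * (1 + ?a) - ?e)\<^sup>2 + t * (1 + ?a) * ?e" using t C(1) e0 by simp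
          hence "t * ((1 + ?a) * ?e) \<le> t * (t * (1 + ?a)\<^sup>2 + 1 / t * ?e\<^sup>2)"
            using t by (simp add: power2_eq_square algebra_simps)
          thus ?thesis using t by (simp only: mult_le_cancel_left_pos)
        qed
        hence "(1 + ?a + ?e) * ?e \<le> t * (1 + ?a)\<^sup>2 + (1 / t + 1) * ?e\<^sup>2"
          by (simp add: distrib_right power2_eq_square)
        also have "\<dots> \<le> t * a2 m + (1 / t + 1) * (2 * d\<^sup>2 + 2 * K\<^sup>2 * (c m)\<^sup>2)"
          using t by (intro add_mono mult_left_mono a2 e2) auto
        finally show "(1 + ?a + ?e) * ?e \<le> t * a2 m + (1 / t + 1) * (2 * d\<^sup>2 + 2 * K\<^sup>2 * (c m)\<^sup>2)" .
      qed
      finally have "norm (D m) \<le> H m" .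
      thus "norm (D m w) \<le> H m * norm w"
        by (intro order_trans[OF norm_blinfun] mult_right_mono) auto
    qed
    also have "\<dots> \<le> \<delta> * norm w" using bH by (simp add: mult_right_mono)
    finally show ?thesis .
  qed
  have zs: "zstar \<in> Zad" "\<And>z. z \<in> Zad \<Longrightarrow> ?J zstar \<le> ?J z"
    using assms(7) by (auto simp: is_arg_min_linorder)
  show ?thesis
  proof (intro exI conjI ballI impI)
    show "gelu_network (k + CARD('d)) ru g" by (rule g)
    fix zd assume zd: "zd \<in> Zad" and stat: "\<forall>z\<in>Zad. 0 \<le> Dfr (objective \<mu> Q P ?v) zd (z - zd)"
    have "norm (zstar - zd) \<le> \<epsilon> \<and> ?J zd - ?J zstar \<le> \<epsilon>\<^sup>2"
      by (rule perturbed_stationary_point[where J="?J" and T="blinfun_apply (Dfr (objective \<mu> Q P ?v) zd)",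
            OF l(2,1) Zad(2) zs(2,1) zd _ grad[OF zd] less_imp_le[OF \<delta>(1)] \<delta>(2,3)])
         (use stat zs in auto)
    thus "norm (zstar - zd) \<le> \<epsilon>" "?J zd - ?J zstar \<le> \<epsilon>\<^sup>2" by auto
  qed (use kN ru in auto)
qed

end
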